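(* The nondistinct locus $Z\subset V$ decomposes into $Z_3\cup Z_5\cup Z_7$, where each $Z_i$ generically corresponds to squares with $i$ distinct entries. All irreducible components of $Z$ are smooth geometrically connected curves defined over $\mathbb{Q}$, whose number, genera and degrees (as curves in $\mathbb{P}^8$) are as follows: $Z_3$ has 128 components, of genus $0$ and degree $2$; $Z_5$ has 32 components, of genus $5$ and degree $8$; $Z_7$ has 16 components, of genus $49$ and degree $32$. In particular, $Z$ has 176 irreducible components in total.
   Context: Let $V \subset \mathbb{P}^8_{\mathbb{Q}}$, with homogeneous coordinates $[A:B:C:D:M:E:F:G:H]$, be the variety of $3\times 3$ magic squares of squares, i.e. the variety defined by requiring all rows, columns and the two main diagonals of the array with rows $(A^2,B^2,C^2)$, $(D^2,M^2,E^2)$, $(F^2,G^2,H^2)$ to have sum $3M^2$. Equivalently, $V$ is the complete intersection surface defined by the six quadrics $3A^2-2F^2-2G^2+H^2$, $3B^2-2F^2+G^2-2H^2$, $3C^2+F^2-2G^2-2H^2$, $3D^2+2F^2-G^2-4H^2$, $3E^2-4F^2-G^2+2H^2$, $3M^2-F^2-G^2-H^2$. The associated magic square of a point $[A:B:C:D:M:E:F:G:H]$ of $V$ is the $3\times 3$ array with rows $(A^2,B^2,C^2)$, $(D^2,M^2,E^2)$, $(F^2,G^2,H^2)$ (its entries are $A^2,\dots,H^2$). The nondistinct locus $Z\subset V$ is the closed locus of points whose associated magic square has non-distinct entries (i.e. two of the nine entries $A^2,B^2,C^2,D^2,M^2,E^2,F^2,G^2,H^2$ coincide); it is a union of hyperplane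 sections of $V$ equating two coordinates up to sign. $Z_3$ is the union of the hyperplane sections $A=\pm M$, $C=\pm M$ of $V$; $Z_5$ is the union of the hyperplane sections $A=\pm C$, $A=\pm F$; $Z_7$ is the union of the hyperplane sections $A=\pm B$, $B=\pm C$, $A=\pm D$, $C=\pm E$. *)

theory Defs
  imports
    "HOL-Analysis.Analysis"
    "HOL-Library.Poly_Mapping"
    "HOL-Library.Extended_Nat"
    "HOL-Algebra.Algebraic_Closure_Type"
begin

text \<open>This notation would make \<open>x $ i\<close> ambiguous for vectors.\<close>

no_notation fps_nth (infixl \<open>$\<close> 75)

section \<open>Multivariate polynomials\<close>

type_synonym ('n, 'a) mpoly = "('n \<Rightarrow>\<^sub>0 nat) \<Rightarrow>\<^sub>0 'a"

definition coeffs_in :: "'a::zero set \<Rightarrow> ('n, 'a) mpoly \<Rightarrow> bool" where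
  "coeffs_in k f \<longleftrightarrow> (\<forall>m. Poly_Mapping.lookup f m \<in> k)"

definition mpeval :: "('n::finite, 'a::field) mpoly \<Rightarrow> 'a ^ 'n \<Rightarrow> 'a" where
  "mpeval f x = (\<Sum>m\<in>Poly_Mapping.keys f.
     Poly_Mapping.lookup f m * (\<Prod>i\<in>UNIV. x $ i ^ Poly_Mapping.lookup m i))"

text \<open>In \<open>gradient\<close>, the truncated subtraction at exponent 0 is harmless, since that
  term carries the factor \<open>of_nat 0\<close>.\<close>

definition gradient :: "('n::finite, 'a::field) mpoly \<Rightarrow> 'a ^ 'n \<Rightarrow> 'a ^ 'n" where
  "gradient f x = (\<chi> i. \<Sum>m\<in>Poly_Mapping.keys f.
     Poly_Mapping.lookup f m * of_nat (Poly_Mapping.lookup m i) *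
       (\<Prod>j\<in>UNIV. x $ j ^ (if j = i then Poly_Mapping.lookup m j - 1 else Poly_Mapping.lookup m j)))"

definition forms :: "nat \<Rightarrow> ('n::finite, 'a::zero) mpoly set" where
  "forms d = {f. \<forall>m\<in>Poly_Mapping.keys f. (\<Sum>i\<in>UNIV. Poly_Mapping.lookup m i) = d}"

interpretation mpoly: vector_space
  "\<lambda>(c::'a::field) (f::('n, 'a) mpoly). Poly_Mapping.single 0 c * f"
  by unfold_locales
     (auto simp: distrib_left distrib_right single_add mult_single mult.assoc [symmetric]
       single_one)

interpretation mpoly_ring: Modules.module
  "(*) :: ('n, 'a::field) mpoly \<Rightarrow> ('n, 'a) mpoly \<Rightarrow> ('n, 'a) mpoly"
  by unfold_locales (auto simp: algebra_simps)


section \<open>Projective algebraic sets\<close>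

text \<open>
  A subset of the projective space of \<open>'a ^ 'n\<close>, of dimension \<open>CARD('n) - 1\<close>, is represented by
  the set of all homogeneous coordinate vectors of its points: a set of nonzero vectors that is
  closed under nonzero scaling.

  The field \<open>'a\<close> is meant to be an algebraic closure of its subfield \<open>k\<close>, and the closed
  sets of \<open>zariski k\<close> are the zero loci of homogeneous polynomials with coefficients in \<open>k\<close>. So
  a closed set of \<open>zariski k\<close> is (the set of geometric points of) a reduced closed subscheme of
  projective space over \<open>k\<close>, and \<open>zariski UNIV\<close> is the geometric Zariski topology.
\<close>

definition zariski :: "'a::field set \<Rightarrow> ('a ^ 'n::finite) topology" where
  "zariski k = topology_generated_by
     {{x. x \<noteq> 0 \<and> mpeval f x \<noteq> 0} | f. coeffs_in k f \<and> (\<exists>d. f \<in> forms d)}"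

abbreviation geom_zariski :: "('a::field ^ 'n::finite) topology" where
  "geom_zariski \<equiv> zariski UNIV"

definition irreducible_in :: "'b topology \<Rightarrow> 'b set \<Rightarrow> bool" where
  "irreducible_in T S \<longleftrightarrow> S \<subseteq> topspace T \<and> S \<noteq> {} \<and>
     (\<forall>Y Y'. closedin T Y \<and> closedin T Y' \<and> S \<subseteq> Y \<union> Y' \<longrightarrow> S \<subseteq> Y \<or> S \<subseteq> Y')"

definition irreducible_components :: "'b topology \<Rightarrow> 'b set \<Rightarrow> 'b set set" where
  "irreducible_components T S =
     {C. C \<subseteq> S \<and> irreducible_in T C \<and>
         (\<forall>D. D \<subseteq> S \<and> irreducible_in T D \<and> C \<subseteq> D \<longrightarrow> D = C)}"

definition krull_dim :: "'b topology \<Rightarrow> 'b set \<Rightarrow> enat" where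
  "krull_dim T S = Sup {enat r | r. \<exists>c :: nat \<Rightarrow> 'b set.
     (\<forall>i\<le>r. irreducible_in T (c i) \<and> closedin (subtopology T S) (c i)) \<and>
     (\<forall>i<r. c i \<subset> c (Suc i))}"

text \<open>For nonempty \<open>S\<close> over an infinite field this is the homogeneous ideal of \<open>S\<close>: as \<open>S\<close> is
  closed under scaling, the homogeneous parts of a polynomial vanishing on \<open>S\<close> vanish on \<open>S\<close>.\<close>

definition vanishing_ideal :: "('a::field ^ 'n::finite) set \<Rightarrow> ('n, 'a) mpoly set" where
  "vanishing_ideal S = {f. \<forall>x\<in>S. mpeval f x = 0}"

definition defined_over :: "'a::field set \<Rightarrow> ('a ^ 'n::finite) set \<Rightarrow> bool" where
  "defined_over k S \<longleftrightarrow> closedin geom_zariski S \<and>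
     vanishing_ideal S = mpoly_ring.span {f \<in> vanishing_ideal S. coeffs_in k f}"

text \<open>The Jacobian criterion for equidimensional \<open>S\<close>, at all geometric points of \<open>S\<close>.\<close>

definition smooth :: "('a::field ^ 'n::finite) set \<Rightarrow> bool" where
  "smooth S \<longleftrightarrow> (\<forall>x\<in>S.
     enat (vec.dim {gradient f x | f. f \<in> vanishing_ideal S}) + krull_dim geom_zariski S
       = enat (CARD('n) - 1))"

text \<open>The dimension of the degree \<open>d\<close> part of the (geometric) homogeneous coordinate ring.\<close>

definition hilbert_function :: "('a::field ^ 'n::finite) set \<Rightarrow> nat \<Rightarrow> nat" where
  "hilbert_function S d =
     mpoly.dim (forms d :: ('n, 'a) mpoly set) - mpoly.dim (forms d \<inter> vanishing_ideal S)"

definition hilbert_poly :: "('a::field ^ 'n::finite) set \<Rightarrow> rat poly" where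
  "hilbert_poly S =
     (THE P. \<forall>\<^sub>F d in sequentially. poly P (of_nat d) = of_nat (hilbert_function S d))"

definition proj_degree :: "('a::field ^ 'n::finite) set \<Rightarrow> rat" where
  "proj_degree S = fact (Polynomial.degree (hilbert_poly S)) * Polynomial.lead_coeff (hilbert_poly S)"

text \<open>The arithmetic genus; for a smooth geometrically connected projective curve it is
  \<open>1 - \<chi>(\<O>) = h\<^sup>1(\<O>)\<close>, the genus of the curve.\<close>

definition genus :: "('a::field ^ 'n::finite) set \<Rightarrow> rat" where
  "genus S = (- 1) ^ Polynomial.degree (hilbert_poly S) * (poly (hilbert_poly S) 0 - 1)"


section \<open>Magic squares of squares\<close>

datatype coord = cA | cB | cC | cD | cM | cE | cF | cG | cH

lemma UNIV_coord: "UNIV = {cA, cB, cC, cD, cM, cE, cF, cG, cH}"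
proof (rule UNIV_eq_I)
  fix x
  show "x \<in> {cA, cB, cC, cD, cM, cE, cF, cG, cH}" by (cases x) simp_all
qed

instance coord :: finite
  by standard (unfold UNIV_coord, intro finite.intros)

type_synonym qbar = "rat alg_closure"

definition magic_surface :: "(qbar ^ coord) set" where
  "magic_surface = {x. x \<noteq> 0 \<and>
     (x$cA)^2 + (x$cB)^2 + (x$cC)^2 = 3 * (x$cM)^2 \<and>
     (x$cD)^2 + (x$cM)^2 + (x$cE)^2 = 3 * (x$cM)^2 \<and>
     (x$cF)^2 + (x$cG)^2 + (x$cH)^2 = 3 * (x$cM)^2 \<and>
     (x$cA)^2 + (x$cD)^2 + (x$cF)^2 = 3 * (x$cM)^2 \<and>
     (x$cB)^2 + (x$cM)^2 + (x$cG)^2 = 3 * (x$cM)^2 \<and>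
     (x$cC)^2 + (x$cE)^2 + (x$cH)^2 = 3 * (x$cM)^2 \<and>
     (x$cA)^2 + (x$cM)^2 + (x$cH)^2 = 3 * (x$cM)^2 \<and>
     (x$cC)^2 + (x$cM)^2 + (x$cF)^2 = 3 * (x$cM)^2}"

definition entries :: "qbar ^ coord \<Rightarrow> qbar set" where
  "entries x = range (\<lambda>i. (x$i)^2)"

definition nondistinct :: "(qbar ^ coord) set" where
  "nondistinct = {x \<in> magic_surface. \<exists>i j. i \<noteq> j \<and> (x$i)^2 = (x$j)^2}"

definition Z3 :: "(qbar ^ coord) set" where
  "Z3 = {x \<in> magic_surface. x$cA = x$cM \<or> x$cA = - x$cM \<or> x$cC = x$cM \<or> x$cC = - x$cM}"

definition Z5 :: "(qbar ^ coord) set" where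
  "Z5 = {x \<in> magic_surface. x$cA = x$cC \<or> x$cA = - x$cC \<or> x$cA = x$cF \<or> x$cA = - x$cF}"

definition Z7 :: "(qbar ^ coord) set" where
  "Z7 = {x \<in> magic_surface. x$cA = x$cB \<or> x$cA = - x$cB \<or> x$cB = x$cC \<or> x$cB = - x$cC \<or>
                 x$cA = x$cD \<or> x$cA = - x$cD \<or> x$cC = x$cE \<or> x$cC = - x$cE}"

text \<open>The scale-invariant number of distinct entries is \<open>i\<close> on a dense open subset of \<open>S\<close>.\<close>

definition generic_entries :: "(qbar ^ coord) set \<Rightarrow> nat \<Rightarrow> bool" where
  "generic_entries S i \<longleftrightarrow> (\<exists>U. openin (subtopology (zariski \<rat>) S) U \<and>
     S \<subseteq> Abstract_Topology.closure_of (zariski \<rat>) U \<and> (\<forall>x\<in>U. card (entries x) = i))"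


section \<open>Consistency of the definitions\<close>

lemma mpeval_superset:
  assumes "finite S" "Poly_Mapping.keys f \<subseteq> S"
  shows "mpeval f x = (\<Sum>m\<in>S. Poly_Mapping.lookup f m * (\<Prod>i\<in>UNIV. x $ i ^ Poly_Mapping.lookup m i))"
  unfolding mpeval_def using assms
  by (intro sum.mono_neutral_left) (auto simp: in_keys_iff)

lemma mpeval_add: "mpeval (f + g) x = mpeval f x + mpeval g x"
proof -
  let ?S = "Poly_Mapping.keys f \<union> Poly_Mapping.keys g"
  have "mpeval h x = (\<Sum>m\<in>?S. Poly_Mapping.lookup h m * (\<Prod>i\<in>UNIV. x $ i ^ Poly_Mapping.lookup m i))"
    if "h \<in> {f, g, f + g}" for h
    using that keys_add [of f g] by (intro mpeval_superset) auto
  then show ?thesis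
    by (simp add: lookup_add distrib_right sum.distrib)
qed

lemma mpeval_single: "mpeval (Poly_Mapping.single m c) x = c * (\<Prod>i\<in>UNIV. x $ i ^ Poly_Mapping.lookup m i)"
  by (simp add: mpeval_def)

lemma mpoly_induct [case_names zero single_add]:
  fixes f :: "('n, 'a::field) mpoly"
  assumes "P 0" "\<And>m c f. P f \<Longrightarrow> P (Poly_Mapping.single m c + f)"
  shows "P f"
proof (induction f rule: update_induct)
  case const
  then show ?case by (rule assms)
next
  case (update f a b)
  have "Poly_Mapping.update a b f = Poly_Mapping.single a b + f"
    using update.hyps
    by (intro poly_mapping_eqI) (auto simp: lookup_update lookup_add lookup_single in_keys_iff when_def)
  then show ?case using update.IH assms(2) by simp
qed

lemma mpeval_mult: "mpeval (f * g) x = mpeval f x * mpeval g x"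
proof (induction f rule: mpoly_induct)
  case zero
  then show ?case by (simp add: mpeval_def)
next
  case (single_add m c f)
  have "mpeval (Poly_Mapping.single m c * g) x = mpeval (Poly_Mapping.single m c) x * mpeval g x"
  proof (induction g rule: mpoly_induct)
    case zero
    then show ?case by (simp add: mpeval_def)
  next
    case (single_add m' c' g)
    then show ?case
      by (simp add: distrib_left mult_single mpeval_add mpeval_single lookup_add power_add prod.distrib)
  qed
  then show ?case
    using single_add by (simp add: distrib_right mpeval_add)
qed

lemma forms_mult:
  assumes "f \<in> forms d" "g \<in> forms e"
  shows "f * g \<in> forms (d + e)"
  unfolding forms_def
proof (intro CollectI ballI)
  fix m assume "m \<in> Poly_Mapping.keys (f * g)"
  then obtain a b where "m = a + b" "a \<in> Poly_Mapping.keys f" "b \<in> Poly_Mapping.keys g"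
    using keys_mult [of f g] by blast
  then show "(\<Sum>i\<in>UNIV. Poly_Mapping.lookup m i) = d + e"
    using assms by (simp add: forms_def lookup_add sum.distrib)
qed

lemma coeffs_in_mult:
  fixes f g :: "('n, 'a::field) mpoly"
  assumes k: "0 \<in> k" "\<And>a b. a \<in> k \<Longrightarrow> b \<in> k \<Longrightarrow> a + b \<in> k" "\<And>a b. a \<in> k \<Longrightarrow> b \<in> k \<Longrightarrow> a * b \<in> k"
    and fg: "coeffs_in k f" "coeffs_in k g"
  shows "coeffs_in k (f * g)"
proof -
  have sum: "sum h S \<in> k" if "\<And>s. h s \<in> k" for h :: "('n \<Rightarrow>\<^sub>0 nat) \<Rightarrow> 'a" and S
    using that k by (induction S rule: infinite_finite_induct) auto
  have "Poly_Mapping.lookup (f * g) m \<in> k" for m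
    unfolding lookup_mult Sum_any.expand_set using k fg
    by (intro sum k(3)) (auto simp: coeffs_in_def when_def)
  then show ?thesis by (simp add: coeffs_in_def)
qed

lemma topspace_zariski:
  fixes k :: "'a::field set"
  assumes "0 \<in> k" "1 \<in> k"
  shows "topspace (zariski k :: ('a ^ 'n::finite) topology) = {x. x \<noteq> 0}"
proof -
  let ?one = "Poly_Mapping.single 0 1 :: ('n, 'a) mpoly"
  have k: "coeffs_in k ?one" "\<exists>d. ?one \<in> forms d" "mpeval ?one x = 1" for x
    using assms
    by (auto simp: forms_def coeffs_in_def lookup_single when_def mpeval_single simp del: single_one)
  show ?thesis
  proof (intro Set.set_eqI iffI)
    fix x :: "'a ^ 'n"
    assume "x \<in> topspace (zariski k)"
    then obtain U where "x \<in> U" "U \<in> {{x. x \<noteq> 0 \<and> mpeval f x \<noteq> 0} | f. coeffs_in k f \<and> (\<exists>d. f \<in> forms d)}"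
      unfolding zariski_def topology_generated_by_topspace by (elim UnionE)
    then show "x \<in> {x. x \<noteq> 0}" by auto
  next
    fix x :: "'a ^ 'n"
    assume "x \<in> {x. x \<noteq> 0}"
    then have "x \<in> {x. x \<noteq> 0 \<and> mpeval ?one x \<noteq> 0}"
      unfolding k(3) by simp
    moreover have "openin (zariski k) {x. x \<noteq> 0 \<and> mpeval ?one x \<noteq> 0}"
      unfolding zariski_def by (rule topology_generated_by_Basis, rule CollectI)
        (rule exI [of _ ?one], rule conjI [OF refl], rule conjI, rule k(1), rule k(2))
    ultimately show "x \<in> topspace (zariski k)"
      using openin_subset by blast
  qed
qed

proposition closedin_zariski_iff:
  fixes S :: "('a::field ^ 'n::finite) set"
  assumes k: "0 \<in> k" "1 \<in> k" "\<And>a b. a \<in> k \<Longrightarrow> b \<in> k \<Longrightarrow> a + b \<in> k"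
    "\<And>a b. a \<in> k \<Longrightarrow> b \<in> k \<Longrightarrow> a * b \<in> k"
  shows "closedin (zariski k) S \<longleftrightarrow>
    (\<exists>F. (\<forall>f\<in>F. coeffs_in k f \<and> (\<exists>d. f \<in> forms d)) \<and> S = {x. x \<noteq> 0 \<and> (\<forall>f\<in>F. mpeval f x = 0)})"
proof -
  define H where "H = {f :: ('n, 'a) mpoly. coeffs_in k f \<and> (\<exists>d. f \<in> forms d)}"
  define D where "D F = {x. x \<noteq> 0 \<and> (\<exists>f\<in>F. mpeval f x \<noteq> 0)}" for F :: "('n, 'a) mpoly set"
  have "\<exists>F\<subseteq>H. U = D F" if "openin (zariski k) U" for U
    using that[unfolded zariski_def openin_topology_generated_by_iff]
  proof (induction U)
    case Empty
    then show ?case by (intro exI [of _ "{}"]) (auto simp: D_def)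
  next
    case (Int a b)
    then obtain F G where F: "F \<subseteq> H" "a = D F" and G: "G \<subseteq> H" "b = D G" by blast
    have "f * g \<in> H" if "f \<in> F" "g \<in> G" for f g
    proof -
      have "f \<in> H" "g \<in> H" using that F G by auto
      then show ?thesis
        unfolding H_def using coeffs_in_mult [OF k(1,3,4)] forms_mult by blast
    qed
    then have "{f * g | f g. f \<in> F \<and> g \<in> G} \<subseteq> H" by blast
    moreover have "a \<inter> b = D {f * g | f g. f \<in> F \<and> g \<in> G}"
      unfolding F(2) G(2) D_def
    proof (intro Set.set_eqI iffI)
      fix x assume "x \<in> {x. x \<noteq> 0 \<and> (\<exists>f\<in>F. mpeval f x \<noteq> 0)} \<inter> {x. x \<noteq> 0 \<and> (\<exists>f\<in>G. mpeval f x \<noteq> 0)}"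
      then obtain f g where "x \<noteq> 0" "f \<in> F" "g \<in> G" "mpeval (f * g) x \<noteq> 0"
        by (auto simp: mpeval_mult)
      then show "x \<in> {x. x \<noteq> 0 \<and> (\<exists>h\<in>{f * g | f g. f \<in> F \<and> g \<in> G}. mpeval h x \<noteq> 0)}" by blast
    qed (auto simp: mpeval_mult)
    ultimately show ?case by blast
  next
    case (UN K)
    then obtain \<F> where \<F>: "\<And>u. u \<in> K \<Longrightarrow> \<F> u \<subseteq> H" "\<And>u. u \<in> K \<Longrightarrow> u = D (\<F> u)"
      by metis
    have "\<Union>K = (\<Union>u\<in>K. D (\<F> u))" using \<F>(2) by (intro arg_cong [of _ _ Union]) force
    also have "\<dots> = D (\<Union>u\<in>K. \<F> u)" unfolding D_def by blast
    finally show ?case using \<F>(1) by (intro exI [of _ "\<Union>u\<in>K. \<F> u"]) blast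
  next
    case (Basis s)
    then obtain f where "f \<in> H" "s = D {f}" by (auto simp: H_def D_def)
    then show ?case by (intro exI [of _ "{f}"]) auto
  qed
  moreover have "openin (zariski k) (D F)" if "F \<subseteq> H" for F
  proof -
    have "openin (zariski k) {x. x \<noteq> 0 \<and> mpeval f x \<noteq> 0}" if "f \<in> F" for f
      unfolding zariski_def using that \<open>F \<subseteq> H\<close>
      by (intro topology_generated_by_Basis) (auto simp: H_def)
    then have "openin (zariski k) (\<Union>f\<in>F. {x. x \<noteq> 0 \<and> mpeval f x \<noteq> 0})" by blast
    also have "(\<Union>f\<in>F. {x. x \<noteq> 0 \<and> mpeval f x \<noteq> 0}) = D F" by (auto simp: D_def)
    finally show ?thesis .
  qed
  ultimately have opn: "openin (zariski k) U \<longleftrightarrow> (\<exists>F\<subseteq>H. U = D F)" for U by blast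
  have *: "S \<subseteq> {x. x \<noteq> 0} \<and> {x. x \<noteq> 0} - S = D F \<longleftrightarrow>
      S = {x. x \<noteq> 0 \<and> (\<forall>f\<in>F. mpeval f x = 0)}" for F
    by (auto simp: D_def)
  have "closedin (zariski k) S \<longleftrightarrow> (\<exists>F\<subseteq>H. S \<subseteq> {x. x \<noteq> 0} \<and> {x. x \<noteq> 0} - S = D F)"
    unfolding closedin_def opn topspace_zariski [OF k(1,2)] by iprover
  also have "\<dots> \<longleftrightarrow> (\<exists>F\<subseteq>H. S = {x. x \<noteq> 0 \<and> (\<forall>f\<in>F. mpeval f x = 0)})"
    by (simp only: *)
  also have "\<dots> \<longleftrightarrow> (\<exists>F. (\<forall>f\<in>F. coeffs_in k f \<and> (\<exists>d. f \<in> forms d)) \<and>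
      S = {x. x \<noteq> 0 \<and> (\<forall>f\<in>F. mpeval f x = 0)})"
    unfolding H_def by blast
  finally show ?thesis .
qed

lemma magic_surface_quadrics:
  "magic_surface = {x. x \<noteq> 0 \<and>
     3 * (x$cA)^2 - 2 * (x$cF)^2 - 2 * (x$cG)^2 + (x$cH)^2 = 0 \<and>
     3 * (x$cB)^2 - 2 * (x$cF)^2 + (x$cG)^2 - 2 * (x$cH)^2 = 0 \<and>
     3 * (x$cC)^2 + (x$cF)^2 - 2 * (x$cG)^2 - 2 * (x$cH)^2 = 0 \<and>
     3 * (x$cD)^2 + 2 * (x$cF)^2 - (x$cG)^2 - 4 * (x$cH)^2 = 0 \<and>
     3 * (x$cE)^2 - 4 * (x$cF)^2 - (x$cG)^2 + 2 * (x$cH)^2 = 0 \<and>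
     3 * (x$cM)^2 - (x$cF)^2 - (x$cG)^2 - (x$cH)^2 = 0}"
proof -
  have *: "(a + b + c = 3 * m \<and> d + m + e = 3 * m \<and> f + g + h = 3 * m \<and> a + d + f = 3 * m \<and>
      b + m + g = 3 * m \<and> c + e + h = 3 * m \<and> a + m + h = 3 * m \<and> c + m + f = 3 * m) \<longleftrightarrow>
    (3 * a - 2 * f - 2 * g + h = 0 \<and> 3 * b - 2 * f + g - 2 * h = 0 \<and> 3 * c + f - 2 * g - 2 * h = 0 \<and>
     3 * d + 2 * f - g - 4 * h = 0 \<and> 3 * e - 4 * f - g + 2 * h = 0 \<and> 3 * m - f - g - h = 0)"
    (is "?L \<longleftrightarrow> ?R") for a b c d e f g h m :: qbar
  proof
    assume L: ?L
    then have m: "3 * m = f + g + h" by simp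
    have *: "u = 2 * m - v" if "u + m + v = 3 * m" for u v
    proof -
      have "u = 3 * m - m - v" unfolding that [symmetric] by simp
      then show ?thesis by simp
    qed
    have abc: "a = 2 * m - h" "b = 2 * m - g" "c = 2 * m - f"
      using L by (auto intro: *)
    have de: "u = m + v - w" if "2 * m - v + u + w = 3 * m" for u v w
    proof -
      have "u = 3 * m - (2 * m - v) - w" unfolding that [symmetric] by simp
      then show ?thesis by simp
    qed
    have d: "d = m + h - f" using L abc(1) by (intro de) simp
    have e: "e = m + f - h" using L abc(3) by (intro de) simp
    have h: "h = 3 * m - f - g" unfolding m by simp
    show ?R unfolding abc d e unfolding h by (simp add: algebra_simps)
  next
    assume R: ?R
    then have a: "3 * a = 2 * f + 2 * g - h" and b: "3 * b = 2 * f - g + 2 * h"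
      and c: "3 * c = 2 * g + 2 * h - f" and d: "3 * d = g + 4 * h - 2 * f"
      and e: "3 * e = 4 * f + g - 2 * h" and m: "3 * m = f + g + h"
      by (simp_all add: algebra_simps)
    have eq: "u = v" if "3 * u = 3 * v" for u v :: qbar using that by simp
    show ?L
      by (intro conjI; rule eq; simp only: distrib_left a b c d e m; simp add: algebra_simps)
  qed
  show ?thesis unfolding magic_surface_def by (simp only: *)
qed

end

theory Submission
  imports Defs
begin

text \<open>
  Write the square of \<open>x\<^sub>i\<close> as \<open>M\<^sup>2 + a\<^sub>i s + b\<^sub>i t\<close> with \<open>s = A\<^sup>2 - M\<^sup>2\<close>, \<open>t = C\<^sup>2 - M\<^sup>2\<close> and small integers
  \<open>a\<^sub>i, b\<^sub>i\<close>. Two entries coincide iff \<open>(s, t)\<close> lies on a certain line through the origin, and the 36 pairs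
  of entries give only eight lines. On the line through \<open>p\<close> the nine squares become
  \<open>M\<^sup>2 + k u\<close>, where the slope \<open>k\<close> depends on the coordinate and runs through \<open>{-r, ..., r}\<close> with
  \<open>r = 1, 2, 3\<close> (for two, two and four of the lines): an arithmetic progression of \<open>2 r + 1\<close> squares,
  which are distinct in general. Coordinates with the same slope agree up to sign, and each choice of these signs gives
  one curve; so a line contributes \<open>2\<^bsup>9 - (2 r + 1)\<^esup>\<close> curves, and there are
  \<open>2 \<cdot> 64 + 2 \<cdot> 16 + 4 \<cdot> 4 = 128 + 32 + 16\<close> of them in total.

  All these curves are instances of one construction, the locale \<open>root_curve_data\<close>: finitely many
  coordinates, each the square root of \<open>m + k u\<close>. Let \<open>K\<close> be its set of slopes.

  \<^item> Modulo the defining equations every polynomial is a combination of products of distinct square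
    roots with monomials in \<open>m\<close> and \<open>u\<close>; the reduction has rational coefficients. These products are linearly
    independent as functions on the curve, since changing signs of the roots separates them
    (\<open>multilin_sign_independent\<close>, \<open>basis_independent\<close>). So the vanishing ideal is known exactly
    (\<open>vanishing_ideal_eq_J\<close>): it is generated by rational polynomials, and the Hilbert function counts
    the products of the given degree. With \<open>n = card K - 2\<close> this count is \<open>2\<^sup>n (d + 1 - n / 2)\<close> for large \<open>d\<close>
    (\<open>sum_quadratic_count\<close>), which gives degree and genus.

  \<^item> The curve is irreducible because \<open>1 + k t\<close> is never a square in the function field generated
    by the other roots; this is proved by infinite descent (\<open>square_class_descent\<close>). Taking norms, a form
    that is not identically zero on the curve has zeros over only finitely many parameters
    (\<open>finite_zeros_on_chart\<close>). Hence the curve is not a union of two smaller closed sets, and its proper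
    closed subsets are finite, so that its dimension is 1.

  \<^item> At any point at most one of the roots vanishes. Then two coordinates can be
    chosen such that a tangent vector of the affine cone is determined by, and may have arbitrary,
    entries there, and the gradients span the orthogonal complement of the tangent plane (\<open>gradient_space\<close>).

  A generic point of a curve determines its line and its signs, so no curve is contained in
  another one, and the curves are the irreducible components, over \<open>\<rat>\<close> as well as geometrically.
\<close>

section \<open>Multivariate polynomials as a ring of functions\<close>

text \<open>These two rules regroup products of polynomials in the direction opposite to \<open>mult.assoc\<close>, with which
  they would make the simplifier loop.\<close>

declare mpoly.scale_scale [simp del] mpoly_ring.scale_scale [simp del]

definition const :: "'a::field \<Rightarrow> ('n, 'a) mpoly" where
  "const c = Poly_Mapping.single 0 c"

definition var :: "'n \<Rightarrow> ('n, 'a::field) mpoly" where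
  "var i = Poly_Mapping.single (Poly_Mapping.single i 1) 1"

lemma const_simps [simp]: "const 0 = 0" "const 1 = 1" "const (a + b) = const a + const b"
  "const (a * b) = const a * const b" "const (- a) = - const a" "const (a - b) = const a - const b"
  by (simp_all add: const_def single_add mult_single single_uminus single_diff)

lemma const_sum: "const (sum f A) = (\<Sum>a\<in>A. const (f a))"
  by (induction A rule: infinite_finite_induct) auto

lemma mpeval_zero [simp]: "mpeval 0 x = 0"
  by (simp add: mpeval_def)

lemma mpeval_const [simp]: "mpeval (const c) x = c"
  by (simp add: const_def mpeval_single)

lemma mpeval_one [simp]: "mpeval 1 x = 1"
  using mpeval_const [of 1 x] by simp

lemma mpeval_var [simp]: "mpeval (var i) x = x $ i"
proof -
  have "x $ j ^ Poly_Mapping.lookup (Poly_Mapping.single i 1) j = (if j = i then x $ j else 1)" for j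
    by (auto simp: lookup_single when_def)
  then have "mpeval (var i) x = (\<Prod>j\<in>UNIV. if j = i then x $ j else 1)"
    unfolding var_def mpeval_single by simp
  then show ?thesis by simp
qed

lemma mpeval_uminus [simp]: "mpeval (- f) x = - mpeval f x"
  using mpeval_add [of f "- f" x] by (simp add: eq_neg_iff_add_eq_0 add.commute)

lemma mpeval_diff [simp]: "mpeval (f - g) x = mpeval f x - mpeval g x"
  using mpeval_add [of f "- g" x] by simp

lemma mpeval_sum: "mpeval (sum f A) x = (\<Sum>a\<in>A. mpeval (f a) x)"
  by (induction A rule: infinite_finite_induct) (auto simp: mpeval_add)

lemma mpeval_prod: "mpeval (prod f A) x = (\<Prod>a\<in>A. mpeval (f a) x)"
  by (induction A rule: infinite_finite_induct) (auto simp: mpeval_mult)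

lemma mpeval_power: "mpeval (f ^ n) x = mpeval f x ^ n"
  by (induction n) (auto simp: mpeval_mult)

lemmas mpeval_hom = mpeval_add mpeval_mult mpeval_sum mpeval_prod mpeval_power

lemma mpoly_eq_sum_monomials:
  "f = (\<Sum>m\<in>Poly_Mapping.keys f. const (Poly_Mapping.lookup f m) * Poly_Mapping.single m 1)"
  by (intro poly_mapping_eqI)
     (auto simp: lookup_sum const_def mult_single lookup_single when_def in_keys_iff)

lemma mpeval_scale:
  assumes "f \<in> forms d"
  shows "mpeval f (c *s x) = c ^ d * mpeval f x"
proof -
  have "(\<Prod>i\<in>UNIV. (c *s x) $ i ^ Poly_Mapping.lookup m i) =
      c ^ d * (\<Prod>i\<in>UNIV. x $ i ^ Poly_Mapping.lookup m i)" if "m \<in> Poly_Mapping.keys f" for m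
  proof -
    have "(\<Sum>i\<in>UNIV. Poly_Mapping.lookup m i) = d"
      using that assms by (simp add: forms_def)
    then show ?thesis
      by (simp add: power_mult_distrib prod.distrib flip: power_sum)
  qed
  then show ?thesis
    unfolding mpeval_def by (simp add: sum_distrib_left mult_ac)
qed

text \<open>For properties that multiplication by a coordinate carries from one degree to the next, such as the
  existence of a normal form.\<close>

lemma monomial_induct [consumes 1, case_names one times]:
  fixes m :: "'n::finite \<Rightarrow>\<^sub>0 nat"
  assumes "(\<Sum>i\<in>UNIV. Poly_Mapping.lookup m i) = d"
    and "P 0 (1 :: ('n, 'a::field) mpoly)"
    and "\<And>d i f. P d f \<Longrightarrow> P (Suc d) (var i * f)"
  shows "P d (Poly_Mapping.single m 1)"
  using assms(1)
proof (induction d arbitrary: m)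
  case 0
  then have "m = 0" by (intro poly_mapping_eqI) simp
  then show ?case using assms(2) by simp
next
  case (Suc d)
  then obtain i where i: "Poly_Mapping.lookup m i \<noteq> 0"
    by (metis Zero_not_Suc finite sum.neutral)
  define m' where "m' = m - Poly_Mapping.single i 1"
  have m: "m = Poly_Mapping.single i 1 + m'"
    using i unfolding m'_def
    by (intro poly_mapping_eqI) (auto simp: lookup_add lookup_minus lookup_single when_def)
  have "(\<Sum>j\<in>UNIV. Poly_Mapping.lookup m j) =
      (\<Sum>j\<in>UNIV. Poly_Mapping.lookup (Poly_Mapping.single i (1::nat)) j) +
      (\<Sum>j\<in>UNIV. Poly_Mapping.lookup m' j)"
    by (subst m) (simp add: lookup_add sum.distrib)
  also have "(\<Sum>j\<in>UNIV. Poly_Mapping.lookup (Poly_Mapping.single i (1::nat)) j) = 1"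
    by (simp add: lookup_single when_def)
  finally have "P d (Poly_Mapping.single m' 1)"
    using Suc by simp
  then have "P (Suc d) (var i * Poly_Mapping.single m' 1)"
    by (rule assms(3))
  then show ?case
    by (simp add: m var_def mult_single)
qed

subsection \<open>Homogeneous polynomials and rational coefficients\<close>

lemma forms_add:
  fixes f g :: "('n::finite, 'a::field) mpoly"
  shows "f \<in> forms d \<Longrightarrow> g \<in> forms d \<Longrightarrow> f + g \<in> forms d"
  unfolding forms_def using keys_add [of f g] by auto

lemma forms_zero [simp]: "0 \<in> forms d"
  by (simp add: forms_def)

lemma forms_const [simp]: "const c \<in> forms 0"
  by (auto simp: forms_def const_def split: if_splits)

lemma forms_one [simp]: "(1 :: ('n::finite, 'a::field) mpoly) \<in> forms 0"
  using forms_const [of "1::'a"] by (simp del: forms_const)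

lemma forms_var [simp]: "var i \<in> forms 1"
  by (auto simp: forms_def var_def lookup_single when_def)

lemma forms_const_mult: "f \<in> forms d \<Longrightarrow> const c * f \<in> forms d"
  using forms_mult [of "const c" 0 f d] by simp

lemma forms_uminus:
  fixes f :: "('n::finite, 'a::field) mpoly"
  shows "f \<in> forms d \<Longrightarrow> - f \<in> forms d"
  by (simp add: forms_def)

lemma forms_diff:
  fixes f g :: "('n::finite, 'a::field) mpoly"
  shows "f \<in> forms d \<Longrightarrow> g \<in> forms d \<Longrightarrow> f - g \<in> forms d"
  using forms_add [of f d "- g"] by (simp add: forms_uminus)

lemma forms_sum:
  fixes f :: "'b \<Rightarrow> ('n::finite, 'a::field) mpoly"
  shows "(\<And>a. a \<in> A \<Longrightarrow> f a \<in> forms d) \<Longrightarrow> sum f A \<in> forms d"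
  by (induction A rule: infinite_finite_induct) (auto simp: forms_add)

lemma forms_power:
  fixes f :: "('n::finite, 'a::field) mpoly"
  shows "f \<in> forms d \<Longrightarrow> f ^ n \<in> forms (n * d)"
  by (induction n) (auto intro: forms_mult)

lemma forms_prod:
  fixes f :: "'b \<Rightarrow> ('n::finite, 'a::field) mpoly"
  shows "(\<And>a. a \<in> A \<Longrightarrow> f a \<in> forms 1) \<Longrightarrow> prod f A \<in> forms (card A)"
proof (induction A rule: infinite_finite_induct)
  case (insert a A)
  then show ?case using forms_mult [of "f a" 1 "prod f A" "card A"] by simp
qed auto

lemma rational_const [simp]: "c \<in> \<rat> \<Longrightarrow> coeffs_in \<rat> (const c)"
  by (auto simp: coeffs_in_def const_def lookup_single when_def)

lemma rational_monomial [simp]: "coeffs_in \<rat> (Poly_Mapping.single m 1)"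
  by (auto simp: coeffs_in_def lookup_single when_def)

lemma rational_var [simp]: "coeffs_in \<rat> (var i)"
  by (simp add: var_def)

lemma rational_add: "coeffs_in \<rat> f \<Longrightarrow> coeffs_in \<rat> g \<Longrightarrow> coeffs_in \<rat> (f + g)"
  by (simp add: coeffs_in_def lookup_add)

lemma rational_diff: "coeffs_in \<rat> f \<Longrightarrow> coeffs_in \<rat> g \<Longrightarrow> coeffs_in \<rat> (f - g)"
  by (simp add: coeffs_in_def lookup_minus)

lemma rational_mult: "coeffs_in \<rat> f \<Longrightarrow> coeffs_in \<rat> g \<Longrightarrow> coeffs_in \<rat> (f * g)"
  by (intro coeffs_in_mult) auto

lemma rational_sum: "(\<And>a. a \<in> A \<Longrightarrow> coeffs_in \<rat> (f a)) \<Longrightarrow> coeffs_in \<rat> (sum f A)"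
  by (simp add: coeffs_in_def lookup_sum Rats_sum)

lemma rational_one [simp]: "coeffs_in \<rat> 1"
  using rational_const [of 1] by (simp del: rational_const)

lemma rational_power: "coeffs_in \<rat> f \<Longrightarrow> coeffs_in \<rat> (f ^ n)"
  by (induction n) (auto intro: rational_mult)

lemma rational_prod: "(\<And>a. a \<in> A \<Longrightarrow> coeffs_in \<rat> (f a)) \<Longrightarrow> coeffs_in \<rat> (prod f A)"
  by (induction A rule: infinite_finite_induct) (auto intro: rational_mult)

subsection \<open>Directional derivatives\<close>

definition deriv_along :: "('n::finite, 'a::field) mpoly \<Rightarrow> 'a ^ 'n \<Rightarrow> 'a ^ 'n \<Rightarrow> 'a" where
  "deriv_along f x v = (\<Sum>i\<in>UNIV. gradient f x $ i * v $ i)"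

lemma gradient_superset:
  assumes "finite S" "Poly_Mapping.keys f \<subseteq> S"
  shows "gradient f x $ i = (\<Sum>m\<in>S.
     Poly_Mapping.lookup f m * of_nat (Poly_Mapping.lookup m i) *
       (\<Prod>j\<in>UNIV. x $ j ^ (if j = i then Poly_Mapping.lookup m j - 1 else Poly_Mapping.lookup m j)))"
  unfolding gradient_def vec_lambda_beta using assms
  by (intro sum.mono_neutral_left) (auto simp: in_keys_iff)

lemma gradient_add: "gradient (f + g) x = gradient f x + gradient g x"
proof -
  let ?S = "Poly_Mapping.keys f \<union> Poly_Mapping.keys g"
  have *: "gradient h x $ i = (\<Sum>m\<in>?S.
     Poly_Mapping.lookup h m * of_nat (Poly_Mapping.lookup m i) *
       (\<Prod>j\<in>UNIV. x $ j ^ (if j = i then Poly_Mapping.lookup m j - 1 else Poly_Mapping.lookup m j)))"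
    if "h \<in> {f, g, f + g}" for h i
    using that keys_add [of f g] by (intro gradient_superset) auto
  show ?thesis
    unfolding vec_eq_iff vector_add_component
    by (subst (1 2 3) *) (simp_all add: lookup_add distrib_right sum.distrib)
qed

lemma gradient_single:
  "gradient (Poly_Mapping.single m c) x $ i = c * (of_nat (Poly_Mapping.lookup m i) *
     x $ i ^ (Poly_Mapping.lookup m i - 1) * (\<Prod>j\<in>UNIV - {i}. x $ j ^ Poly_Mapping.lookup m j))"
proof -
  have "(\<Prod>j\<in>UNIV. x $ j ^ (if j = i then Poly_Mapping.lookup m j - 1 else Poly_Mapping.lookup m j)) =
      x $ i ^ (Poly_Mapping.lookup m i - 1) * (\<Prod>j\<in>UNIV - {i}. x $ j ^ Poly_Mapping.lookup m j)"
    by (subst prod.remove [of _ i]) auto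
  then show ?thesis by (simp add: gradient_def mult.assoc)
qed

lemma gradient_mult: "gradient (f * g) x = mpeval g x *s gradient f x + mpeval f x *s gradient g x"
proof (induction f rule: mpoly_induct)
  case zero
  then show ?case by (simp add: gradient_def vec_eq_iff)
next
  case (single_add m c f)
  have "gradient (Poly_Mapping.single m c * g) x =
      mpeval g x *s gradient (Poly_Mapping.single m c) x +
      mpeval (Poly_Mapping.single m c) x *s gradient g x"
  proof (induction g rule: mpoly_induct)
    case zero
    then show ?case by (simp add: gradient_def vec_eq_iff)
  next
    case (single_add m' c' g)
    have power_rule: "of_nat (n + n') * a ^ (n + n' - 1) =
        a ^ n' * (of_nat n * a ^ (n - 1)) + a ^ n * (of_nat n' * a ^ (n' - 1))" for n n' and a :: "'a::field"
      by (cases n; cases n') (auto simp: algebra_simps power_add)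
    have "gradient (Poly_Mapping.single m c * Poly_Mapping.single m' c') x =
      mpeval (Poly_Mapping.single m' c') x *s gradient (Poly_Mapping.single m c) x +
      mpeval (Poly_Mapping.single m c) x *s gradient (Poly_Mapping.single m' c') x"
      unfolding vec_eq_iff mult_single vector_add_component vector_smult_component gradient_single
        mpeval_single lookup_add
    proof
      fix i
      have split: "(\<Prod>j\<in>UNIV. x $ j ^ Poly_Mapping.lookup n j) =
          x $ i ^ Poly_Mapping.lookup n i * (\<Prod>j\<in>UNIV - {i}. x $ j ^ Poly_Mapping.lookup n j)" for n
        by (subst prod.remove [of _ i]) auto
      show "c * c' * (of_nat (Poly_Mapping.lookup m i + Poly_Mapping.lookup m' i) *
          x $ i ^ (Poly_Mapping.lookup m i + Poly_Mapping.lookup m' i - 1) *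
          (\<Prod>j\<in>UNIV - {i}. x $ j ^ (Poly_Mapping.lookup m j + Poly_Mapping.lookup m' j))) =
        c' * (\<Prod>i\<in>UNIV. x $ i ^ Poly_Mapping.lookup m' i) *
        (c * (of_nat (Poly_Mapping.lookup m i) * x $ i ^ (Poly_Mapping.lookup m i - 1) *
          (\<Prod>j\<in>UNIV - {i}. x $ j ^ Poly_Mapping.lookup m j))) +
        c * (\<Prod>i\<in>UNIV. x $ i ^ Poly_Mapping.lookup m i) *
        (c' * (of_nat (Poly_Mapping.lookup m' i) * x $ i ^ (Poly_Mapping.lookup m' i - 1) *
          (\<Prod>j\<in>UNIV - {i}. x $ j ^ Poly_Mapping.lookup m' j)))"
        unfolding split power_rule power_add prod.distrib by (simp add: algebra_simps)
    qed
    then show ?case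
      using single_add
      by (simp add: distrib_left gradient_add mpeval_add vector_sadd_rdistrib vector_add_ldistrib)
  qed
  then show ?case
    using single_add
    by (simp add: distrib_right gradient_add mpeval_add vector_sadd_rdistrib vector_add_ldistrib)
qed

lemma deriv_along_zero [simp]: "deriv_along 0 x v = 0"
  by (simp add: deriv_along_def gradient_def)

lemma deriv_along_add: "deriv_along (f + g) x v = deriv_along f x v + deriv_along g x v"
  by (simp add: deriv_along_def gradient_add distrib_right sum.distrib)

lemma deriv_along_mult:
  "deriv_along (f * g) x v = mpeval g x * deriv_along f x v + mpeval f x * deriv_along g x v"
  by (simp add: deriv_along_def gradient_mult distrib_right sum.distrib sum_distrib_left mult.assoc)

lemma deriv_along_uminus [simp]: "deriv_along (- f) x v = - deriv_along f x v"
  using deriv_along_add [of f "- f" x v] by (simp add: eq_neg_iff_add_eq_0 add.commute)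

lemma deriv_along_diff [simp]: "deriv_along (f - g) x v = deriv_along f x v - deriv_along g x v"
  using deriv_along_add [of f "- g" x v] by simp

lemma deriv_along_const [simp]: "deriv_along (const c) x v = 0"
  by (simp add: deriv_along_def const_def gradient_single)

lemma gradient_var: "gradient (var i) x = axis i 1"
proof -
  have "(\<Prod>l\<in>UNIV - {j}. x $ l ^ Poly_Mapping.lookup (Poly_Mapping.single i (1::nat)) l) = 1" if "j = i" for j
    using that by (intro prod.neutral) (auto simp: lookup_single when_def)
  then show ?thesis
    unfolding vec_eq_iff var_def gradient_single by (auto simp: axis_def lookup_single when_def)
qed

lemma deriv_along_var [simp]: "deriv_along (var i) x v = v $ i"
  by (simp add: deriv_along_def gradient_var axis_def if_distrib if_distribR cong: if_cong)

section \<open>Multilinear polynomials in square roots\<close>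

definition multilin :: "'k set \<Rightarrow> ('k set \<Rightarrow> 'a) \<Rightarrow> ('k \<Rightarrow> 'a) \<Rightarrow> 'a::comm_ring_1" where
  "multilin K c w = (\<Sum>S\<in>Pow K. c S * (\<Prod>k\<in>S. w k))"

lemma sum_Pow_insert:
  assumes "finite K" "k \<notin> K"
  shows "sum g (Pow (insert k K)) = sum g (Pow K) + (\<Sum>S\<in>Pow K. g (insert k S))"
proof -
  have "inj_on (insert k) (Pow K)" using assms by (auto simp: inj_on_def)
  moreover have "Pow K \<inter> insert k ` Pow K = {}" using assms by auto
  ultimately show ?thesis
    unfolding Pow_insert using assms by (simp add: sum.union_disjoint sum.reindex)
qed

lemma multilin_insert:
  assumes "finite K" "k \<notin> K"
  shows "multilin (insert k K) c w = multilin K c w + w k * multilin K (\<lambda>S. c (insert k S)) w"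
proof -
  have "(\<Prod>j\<in>insert k S. w j) = w k * (\<Prod>j\<in>S. w j)" if "S \<in> Pow K" for S
  proof -
    have "finite S" "k \<notin> S" using assms that finite_subset by auto
    then show ?thesis by simp
  qed
  then have "(\<Sum>S\<in>Pow K. c (insert k S) * (\<Prod>j\<in>insert k S. w j)) =
      (\<Sum>S\<in>Pow K. w k * (c (insert k S) * (\<Prod>j\<in>S. w j)))"
    by (intro sum.cong) (auto simp: mult.left_commute)
  then show ?thesis
    unfolding multilin_def sum_Pow_insert [OF assms] by (simp add: sum_distrib_left)
qed

lemma multilin_cong:
  assumes "\<And>S. S \<subseteq> K \<Longrightarrow> c S = c' S" "\<And>k. k \<in> K \<Longrightarrow> w k = w' k"
  shows "multilin K c w = multilin K c' w'"
  unfolding multilin_def using assms by (intro sum.cong arg_cong2 [of _ _ _ _ "(*)"] prod.cong) auto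

lemma multilin_join:
  assumes "finite K" "k \<notin> K"
  shows "multilin (insert k K) (\<lambda>S. if k \<in> S then c' (S - {k}) else c S) w =
    multilin K c w + w k * multilin K c' w"
proof -
  have "multilin K (\<lambda>S. if k \<in> S then c' (S - {k}) else c S) w = multilin K c w"
    "multilin K (\<lambda>S. if k \<in> insert k S then c' (insert k S - {k}) else c (insert k S)) w = multilin K c' w"
    using assms by (auto intro!: multilin_cong arg_cong [of _ _ c'])
  then show ?thesis unfolding multilin_insert [OF assms] by simp
qed

lemma multilin_empty [simp]: "multilin {} c w = c {}"
  by (simp add: multilin_def)

lemma multilin_add: "multilin K (\<lambda>S. c S + c' S) w = multilin K c w + multilin K c' w"
  by (simp add: multilin_def distrib_right sum.distrib)

lemma multilin_scale: "multilin K (\<lambda>S. a * c S) w = a * multilin K c w"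
  by (simp add: multilin_def sum_distrib_left mult.assoc)

text \<open>
  Flipping the sign of one variable separates the terms that contain it from those that do not, so
  the values at all sign choices determine the coefficients.
\<close>

lemma multilin_sign_independent:
  fixes c :: "'k set \<Rightarrow> 'a::field_char_0"
  assumes "finite K" "\<And>k. k \<in> K \<Longrightarrow> v k \<noteq> 0"
    and "\<And>w. (\<And>k. k \<in> K \<Longrightarrow> w k = v k \<or> w k = - v k) \<Longrightarrow> multilin K c w = 0"
    and "S \<subseteq> K"
  shows "c S = 0"
  using assms
proof (induction K arbitrary: c S rule: finite_induct)
  case empty
  then show ?case by auto
next
  case (insert k K)
  have both: "multilin K c w = 0 \<and> multilin K (\<lambda>S. c (insert k S)) w = 0"
    if w: "\<And>j. j \<in> K \<Longrightarrow> w j = v j \<or> w j = - v j" for w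
  proof -
    have *: "multilin K c w + s * multilin K (\<lambda>S. c (insert k S)) w = 0" if "s = v k \<or> s = - v k" for s
    proof -
      have "multilin (insert k K) c (w(k := s)) = 0"
        using w that insert.hyps by (intro insert.prems) auto
      moreover have "multilin K d (w(k := s)) = multilin K d w" for d :: "'k set \<Rightarrow> 'a"
        using insert.hyps by (intro multilin_cong) auto
      ultimately show ?thesis
        unfolding multilin_insert [OF insert.hyps] by simp
    qed
    have "2 * multilin K c w = (multilin K c w + v k * multilin K (\<lambda>S. c (insert k S)) w) +
        (multilin K c w + (- v k) * multilin K (\<lambda>S. c (insert k S)) w)" by simp
    then have "multilin K c w = 0" unfolding * [OF disjI1 [OF refl]] * [OF disjI2 [OF refl]] by simp
    then show ?thesis using * [OF disjI1 [OF refl]] insert.prems(1) [of k] by simp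
  qed
  show ?case
  proof (cases "k \<in> S")
    case True
    have "c (insert k (S - {k})) = 0"
      using both insert.prems True by (intro insert.IH [of "\<lambda>S. c (insert k S)"]) auto
    then show ?thesis using True by (simp add: insert_absorb)
  next
    case False
    then show ?thesis
      using both insert.prems by (intro insert.IH [of c]) auto
  qed
qed

section \<open>The affine curve of square roots of linear polynomials\<close>

text \<open>The affine part of the curves below: \<open>w k\<close> is a square root of \<open>1 + k t\<close>, with slopes \<open>k\<close> in \<open>K\<close>.\<close>

definition chart :: "'a set \<Rightarrow> ('a::field \<times> ('a \<Rightarrow> 'a)) set" where
  "chart K = {(t, w). \<forall>k\<in>K. (w k)\<^sup>2 = 1 + k * t}"

definition chart_eval :: "'a set \<Rightarrow> ('a set \<Rightarrow> 'a poly) \<Rightarrow> 'a \<Rightarrow> ('a \<Rightarrow> 'a) \<Rightarrow> 'a::field" where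
  "chart_eval K p t w = multilin K (\<lambda>S. poly (p S) t) w"

definition regular_on_chart :: "'a set \<Rightarrow> ('a \<Rightarrow> ('a \<Rightarrow> 'a) \<Rightarrow> 'a::field) \<Rightarrow> bool" where
  "regular_on_chart K \<phi> \<longleftrightarrow> (\<exists>p. \<forall>t w. (t, w) \<in> chart K \<longrightarrow> \<phi> t w = chart_eval K p t w)"

lemma chart_insert: "(t, w) \<in> chart (insert k K) \<longleftrightarrow> (w k)\<^sup>2 = 1 + k * t \<and> (t, w) \<in> chart K"
  by (auto simp: chart_def)

lemma square_root_exists: "\<exists>y. y\<^sup>2 = (x :: 'a::alg_closed_field)"
  using nth_root_exists [of 2 x] by auto

lemma chart_over:
  fixes t :: "'a::alg_closed_field"
  obtains w where "(t, w) \<in> chart K"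
proof -
  have "(t, \<lambda>k. SOME y. y\<^sup>2 = 1 + k * t) \<in> chart K"
    unfolding chart_def by (auto intro: someI_ex [OF square_root_exists])
  then show ?thesis by (rule that)
qed

lemma chart_change_sign:
  assumes "(t, v) \<in> chart K" "\<And>k. k \<in> K \<Longrightarrow> w k = v k \<or> w k = - v k"
  shows "(t, w) \<in> chart K"
proof -
  have "(w k)\<^sup>2 = (v k)\<^sup>2" if "k \<in> K" for k using assms(2) [OF that] by auto
  then show ?thesis using assms(1) by (auto simp: chart_def)
qed

lemma chart_eval_insert:
  "finite K \<Longrightarrow> k \<notin> K \<Longrightarrow>
    chart_eval (insert k K) p t w = chart_eval K p t w + w k * chart_eval K (\<lambda>S. p (insert k S)) t w"
  by (simp add: chart_eval_def multilin_insert)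

lemma chart_eval_join:
  assumes "finite K" "k \<notin> K"
  shows "chart_eval (insert k K) (\<lambda>S. if k \<in> S then q (S - {k}) else p S) t w =
    chart_eval K p t w + w k * chart_eval K q t w"
  unfolding chart_eval_def multilin_join [OF assms, symmetric]
  by (intro multilin_cong) auto

lemma chart_eval_mult_poly: "chart_eval K (\<lambda>S. q * p S) t w = poly q t * chart_eval K p t w"
  by (simp add: chart_eval_def multilin_scale)

lemma chart_eval_add: "chart_eval K (\<lambda>S. p S + q S) t w = chart_eval K p t w + chart_eval K q t w"
  by (simp add: chart_eval_def multilin_add)

lemma regular_chart_eval [intro]: "regular_on_chart K (chart_eval K p)"
  by (auto simp: regular_on_chart_def)

lemma regular_poly:
  assumes "finite K" shows "regular_on_chart K (\<lambda>t w. poly q t)"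
proof -
  have "chart_eval K (\<lambda>S. if S = {} then q else 0) t w = poly q t" for t w
    unfolding chart_eval_def multilin_def using assms
    by (subst sum.mono_neutral_right [of _ "{{}}"]) auto
  then show ?thesis unfolding regular_on_chart_def by metis
qed

lemma regular_root:
  assumes "finite K" "k \<in> K" shows "regular_on_chart K (\<lambda>t w. w k)"
proof -
  have "chart_eval K (\<lambda>S. if S = {k} then 1 else 0) t w = w k" for t w
    unfolding chart_eval_def multilin_def using assms
    by (subst sum.mono_neutral_right [of _ "{{k}}"]) auto
  then show ?thesis unfolding regular_on_chart_def by metis
qed

lemma regular_add:
  assumes "regular_on_chart K \<phi>" "regular_on_chart K \<psi>"
  shows "regular_on_chart K (\<lambda>t w. \<phi> t w + \<psi> t w)"
proof -
  obtain p q where pq: "\<And>t w. (t, w) \<in> chart K \<Longrightarrow> \<phi> t w = chart_eval K p t w"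
    "\<And>t w. (t, w) \<in> chart K \<Longrightarrow> \<psi> t w = chart_eval K q t w"
    using assms unfolding regular_on_chart_def by blast
  show ?thesis unfolding regular_on_chart_def
    by (rule exI [of _ "\<lambda>S. p S + q S"]) (simp add: pq chart_eval_add)
qed

lemma regular_mult_chart_eval:
  assumes "finite K"
  shows "regular_on_chart K (\<lambda>t w. chart_eval K p t w * chart_eval K q t w)"
  using assms
proof (induction K arbitrary: p q rule: finite_induct)
  case empty
  have "chart_eval {} p t w * chart_eval {} q t w = chart_eval {} (\<lambda>S. p S * q S) t w" for t w
    by (simp add: chart_eval_def)
  then show ?case by (simp add: regular_chart_eval)
next
  case (insert k K)
  let ?p = "\<lambda>S. p (insert k S)" and ?q = "\<lambda>S. q (insert k S)"
  have times: "\<exists>r. \<forall>t w. (t, w) \<in> chart K \<longrightarrow>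
      chart_eval K p t w * chart_eval K q t w = chart_eval K r t w" for p q
    using insert.IH [of p q] by (simp add: regular_on_chart_def)
  obtain a where a: "\<And>t w. (t, w) \<in> chart K \<Longrightarrow> chart_eval K p t w * chart_eval K q t w = chart_eval K a t w"
    using times [of p q] by auto
  obtain b where b: "\<And>t w. (t, w) \<in> chart K \<Longrightarrow> chart_eval K ?p t w * chart_eval K ?q t w = chart_eval K b t w"
    using times [of ?p ?q] by auto
  obtain c where c: "\<And>t w. (t, w) \<in> chart K \<Longrightarrow> chart_eval K p t w * chart_eval K ?q t w = chart_eval K c t w"
    using times [of p ?q] by auto
  obtain d where d: "\<And>t w. (t, w) \<in> chart K \<Longrightarrow> chart_eval K ?p t w * chart_eval K q t w = chart_eval K d t w"
    using times [of ?p q] by auto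
  let ?u = "\<lambda>S. a S + [:1, k:] * b S" and ?v = "\<lambda>S. c S + d S"
  have "chart_eval (insert k K) p t w * chart_eval (insert k K) q t w =
      chart_eval (insert k K) (\<lambda>S. if k \<in> S then ?v (S - {k}) else ?u S) t w"
    if "(t, w) \<in> chart (insert k K)" for t w
  proof -
    have w: "(w k)\<^sup>2 = 1 + k * t" "(t, w) \<in> chart K" using that by (auto simp: chart_insert)
    have "chart_eval (insert k K) p t w * chart_eval (insert k K) q t w =
        chart_eval K p t w * chart_eval K q t w + (w k)\<^sup>2 * (chart_eval K ?p t w * chart_eval K ?q t w) +
        w k * (chart_eval K p t w * chart_eval K ?q t w + chart_eval K ?p t w * chart_eval K q t w)"
      unfolding chart_eval_insert [OF insert.hyps] by (simp add: algebra_simps power2_eq_square)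
    also have "\<dots> = chart_eval K ?u t w + w k * chart_eval K ?v t w"
      unfolding chart_eval_add chart_eval_mult_poly a [OF w(2)] b [OF w(2)] c [OF w(2)] d [OF w(2)] w(1)
      by (simp add: mult.commute)
    finally show ?thesis by (simp only: chart_eval_join [OF insert.hyps, of ?v ?u])
  qed
  then show ?case unfolding regular_on_chart_def by blast
qed

lemma regular_mult:
  assumes "finite K" "regular_on_chart K \<phi>" "regular_on_chart K \<psi>"
  shows "regular_on_chart K (\<lambda>t w. \<phi> t w * \<psi> t w)"
proof -
  obtain p q where pq: "\<And>t w. (t, w) \<in> chart K \<Longrightarrow> \<phi> t w = chart_eval K p t w"
    "\<And>t w. (t, w) \<in> chart K \<Longrightarrow> \<psi> t w = chart_eval K q t w"
    using assms unfolding regular_on_chart_def by blast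
  obtain r where "\<And>t w. (t, w) \<in> chart K \<Longrightarrow>
      chart_eval K p t w * chart_eval K q t w = chart_eval K r t w"
    using regular_mult_chart_eval [OF assms(1)] unfolding regular_on_chart_def by blast
  then show ?thesis unfolding regular_on_chart_def by (intro exI [of _ r]) (simp add: pq)
qed

text \<open>Where no root vanishes, the points over \<open>t\<close> are all the sign changes of one of them.\<close>

lemma chart_coeff_zero_at:
  fixes p :: "'a::{alg_closed_field, field_char_0} set \<Rightarrow> 'a poly"
  assumes "finite K" "\<And>k. k \<in> K \<Longrightarrow> 1 + k * t \<noteq> 0"
    and "\<And>w. (t, w) \<in> chart K \<Longrightarrow> chart_eval K p t w = 0" "S \<subseteq> K"
  shows "poly (p S) t = 0"
proof -
  obtain v where v: "(t, v) \<in> chart K" by (rule chart_over)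
  have "v k \<noteq> 0" if "k \<in> K" for k
    using v assms(2) that by (auto simp: chart_def)
  then show ?thesis
    using assms(1,3,4) chart_change_sign [OF v] unfolding chart_eval_def
    by (intro multilin_sign_independent [of K v "\<lambda>S. poly (p S) t"]) blast+
qed

lemma chart_coeffs_zero:
  fixes p :: "'a::{alg_closed_field, field_char_0} set \<Rightarrow> 'a poly"
  assumes "finite K" "infinite T" "S \<subseteq> K"
    and zero: "\<And>t w. t \<in> T \<Longrightarrow> (t, w) \<in> chart K \<Longrightarrow> chart_eval K p t w = 0"
  shows "p S = 0"
proof (rule ccontr)
  assume "p S \<noteq> 0"
  have "T \<subseteq> {t. poly (p S) t = 0} \<union> (\<lambda>k. - 1 / k) ` K"
  proof
    fix t assume t: "t \<in> T"
    show "t \<in> {t. poly (p S) t = 0} \<union> (\<lambda>k. - 1 / k) ` K"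
    proof (cases "\<exists>k\<in>K. 1 + k * t = 0")
      case True
      then obtain k where k: "k \<in> K" "1 + k * t = 0" by blast
      then have "k \<noteq> 0" by auto
      with k have "t = - 1 / k" by (simp add: field_simps eq_neg_iff_add_eq_0)
      with k show ?thesis by auto
    next
      case False
      then have "poly (p S) t = 0"
        using assms t by (intro chart_coeff_zero_at [of K]) auto
      then show ?thesis by simp
    qed
  qed
  moreover have "finite {t. poly (p S) t = 0}" using \<open>p S \<noteq> 0\<close> by (rule poly_roots_finite)
  ultimately show False using assms(1,2) finite_subset by blast
qed

text \<open>The coefficients of a function in the square roots are determined by its values, so the function is
  zero as soon as it is zero outside finitely many parameters.\<close>

lemma regular_cancel:
  fixes k :: "'a::{alg_closed_field, field_char_0}"
  assumes "finite K" "regular_on_chart K \<phi>" "(t, w) \<in> chart K"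
    and "\<And>t w. (t, w) \<in> chart K \<Longrightarrow> (1 + k * t) * \<phi> t w = 0"
  shows "\<phi> t w = 0"
proof -
  obtain r where r: "\<And>t w. (t, w) \<in> chart K \<Longrightarrow> \<phi> t w = chart_eval K r t w"
    using assms(2) unfolding regular_on_chart_def by auto
  have "chart_eval K (\<lambda>S. [:1, k:] * r S) t w = 0" if "(t, w) \<in> chart K" for t w
    unfolding chart_eval_mult_poly using assms(4) [OF that] r [OF that] by (simp add: mult.commute)
  then have "[:1, k:] * r S = 0" if "S \<subseteq> K" for S
    using assms(1) infinite_UNIV_char_0 that
    by (intro chart_coeffs_zero [of K UNIV S "\<lambda>S. [:1, k:] * r S"])
  then have "r S = 0" if "S \<subseteq> K" for S using that by (auto simp del: mult_pCons_left)
  then show ?thesis using r assms(3) by (simp add: chart_eval_def multilin_def)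
qed

text \<open>
  Infinite descent: \<open>a\<^sup>2 = (1 + k t) b\<^sup>2\<close> forces \<open>a\<close> to vanish over the point where \<open>1 + k t = 0\<close>. The
  other square roots are nonzero there, so each coefficient of \<open>a\<close> is divisible by \<open>1 + k t\<close>; then so
  is each coefficient of \<open>b\<close>, and the quotients satisfy the same equation.
\<close>

lemma square_class_descent:
  fixes k :: "'a::{alg_closed_field, field_char_0}"
  assumes "finite K" "k \<notin> K" "k \<noteq> 0"
    and "\<And>t w. (t, w) \<in> chart K \<Longrightarrow> (chart_eval K p t w)\<^sup>2 = (1 + k * t) * (chart_eval K q t w)\<^sup>2"
    and "S \<subseteq> K"
  shows "[:1, k:] ^ n dvd p S \<and> [:1, k:] ^ n dvd q S"
  using assms(4,5)
proof (induction n arbitrary: p q S)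
  case 0
  then show ?case by simp
next
  case (Suc n)
  have other: "1 + j * (- 1 / k) \<noteq> 0" if "j \<in> K" for j
    using assms that by (auto simp: field_simps)
  have divisible: "\<exists>p'. \<forall>S\<subseteq>K. p S = [:1, k:] * p' S"
    if vanish: "\<And>w. (- 1 / k, w) \<in> chart K \<Longrightarrow> chart_eval K p (- 1 / k) w = 0" for p
  proof -
    have "[:1, k:] dvd p S" if "S \<subseteq> K" for S
    proof -
      have "poly (p S) (- 1 / k) = 0"
        using assms(1) other vanish that by (rule chart_coeff_zero_at)
      then have "[:1 / k, 1:] dvd p S" by (simp add: poly_eq_0_iff_dvd)
      moreover have "[:1, k:] = Polynomial.smult k [:1 / k, 1:]" using assms(3) by simp
      ultimately show ?thesis using assms(3) by (metis smult_dvd)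
    qed
    then show ?thesis by (auto simp: dvd_def intro: choice)
  qed
  have "\<exists>p'. \<forall>S\<subseteq>K. p S = [:1, k:] * p' S"
    using Suc.prems(1) [of "- 1 / k"] assms(3) by (intro divisible) auto
  then obtain p' where p': "\<And>S. S \<subseteq> K \<Longrightarrow> p S = [:1, k:] * p' S" by blast
  have p_eval: "chart_eval K p t w = (1 + k * t) * chart_eval K p' t w" for t w
  proof -
    have "chart_eval K p t w = chart_eval K (\<lambda>S. [:1, k:] * p' S) t w"
      unfolding chart_eval_def by (intro multilin_cong) (simp_all add: p')
    then show ?thesis unfolding chart_eval_mult_poly by (simp add: mult.commute)
  qed
  have q_eq: "(chart_eval K q t w)\<^sup>2 = (1 + k * t) * (chart_eval K p' t w)\<^sup>2" if "(t, w) \<in> chart K" for t w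
  proof -
    let ?\<phi> = "\<lambda>t w. chart_eval K q t w * chart_eval K q t w +
      poly [:- 1, - k:] t * (chart_eval K p' t w * chart_eval K p' t w)"
    have "?\<phi> t w = 0"
    proof (rule regular_cancel [OF assms(1) _ that])
      show "regular_on_chart K ?\<phi>"
        using assms(1) by (intro regular_add regular_mult regular_poly regular_chart_eval)
      show "(1 + k * t) * ?\<phi> t w = 0" if "(t, w) \<in> chart K" for t w
        using Suc.prems(1) [OF that] unfolding p_eval by (simp add: algebra_simps power2_eq_square)
    qed
    then show ?thesis by (simp add: algebra_simps power2_eq_square)
  qed
  have "\<exists>q'. \<forall>S\<subseteq>K. q S = [:1, k:] * q' S"
    using q_eq [of "- 1 / k"] assms(3) by (intro divisible) auto
  then obtain q' where q': "\<And>S. S \<subseteq> K \<Longrightarrow> q S = [:1, k:] * q' S" by blast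
  have q_eval: "chart_eval K q t w = (1 + k * t) * chart_eval K q' t w" for t w
  proof -
    have "chart_eval K q t w = chart_eval K (\<lambda>S. [:1, k:] * q' S) t w"
      unfolding chart_eval_def by (intro multilin_cong) (simp_all add: q')
    then show ?thesis unfolding chart_eval_mult_poly by (simp add: mult.commute)
  qed
  have "(chart_eval K p' t w)\<^sup>2 = (1 + k * t) * (chart_eval K q' t w)\<^sup>2" if "(t, w) \<in> chart K" for t w
  proof -
    let ?\<phi> = "\<lambda>t w. chart_eval K p' t w * chart_eval K p' t w +
      poly [:- 1, - k:] t * (chart_eval K q' t w * chart_eval K q' t w)"
    have "?\<phi> t w = 0"
    proof (rule regular_cancel [OF assms(1) _ that])
      show "regular_on_chart K ?\<phi>"
        using assms(1) by (intro regular_add regular_mult regular_poly regular_chart_eval)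
      show "(1 + k * t) * ?\<phi> t w = 0" if "(t, w) \<in> chart K" for t w
        using q_eq [OF that] unfolding q_eval by (simp add: algebra_simps power2_eq_square)
    qed
    then show ?thesis by (simp add: algebra_simps power2_eq_square)
  qed
  then have "[:1, k:] ^ n dvd p' S \<and> [:1, k:] ^ n dvd q' S"
    using Suc.prems(2) by (rule Suc.IH)
  then show ?case
    using p' q' Suc.prems(2) by (auto simp del: mult_pCons_left intro: mult_dvd_mono)
qed

text \<open>Only the zero polynomial is divisible by all powers of \<open>1 + k t\<close>, so the descent ends at zero: the
  function \<open>1 + k t\<close> is not a square in the field generated by the roots of the other slopes.\<close>

lemma square_classes_independent:
  fixes k :: "'a::{alg_closed_field, field_char_0}"
  assumes "finite K" "k \<notin> K" "k \<noteq> 0"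
    and "\<And>t w. (t, w) \<in> chart K \<Longrightarrow> (chart_eval K p t w)\<^sup>2 = (1 + k * t) * (chart_eval K q t w)\<^sup>2"
    and "S \<subseteq> K"
  shows "p S = 0 \<and> q S = 0"
proof -
  have "r = 0" if "\<And>n. [:1, k:] ^ n dvd r" for r :: "'a poly"
  proof (rule ccontr)
    assume "r \<noteq> 0"
    then have "Polynomial.degree ([:1, k:] ^ Suc (Polynomial.degree r)) \<le> Polynomial.degree r"
      using that by (intro dvd_imp_degree_le)
    then show False using assms(3) by (simp add: degree_power_eq del: power_Suc)
  qed
  then show ?thesis using square_class_descent [OF assms] by blast
qed

text \<open>
  Taking norms eliminates the square roots one at a time: a zero of \<open>a + b w\<^sub>k\<close> is a zero of
  \<open>a\<^sup>2 - (1 + k t) b\<^sup>2\<close>, which is not identically zero by \<open>square_classes_independent\<close>.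
\<close>

proposition finite_zeros_on_chart:
  fixes K :: "'a::{alg_closed_field, field_char_0} set"
  assumes "finite K" "0 \<notin> K" "S \<subseteq> K" "p S \<noteq> 0"
  shows "finite {t. \<exists>w. (t, w) \<in> chart K \<and> chart_eval K p t w = 0}"
  using assms
proof (induction K arbitrary: p S rule: finite_induct)
  case empty
  then have "finite {t. poly (p {}) t = 0}" by (intro poly_roots_finite) auto
  then show ?case by (elim rev_finite_subset) (auto simp: chart_eval_def)
next
  case (insert k K)
  let ?a = "chart_eval K p" and ?b = "chart_eval K (\<lambda>S. p (insert k S))"
  let ?\<phi> = "\<lambda>t w. ?a t w * ?a t w + poly [:- 1, - k:] t * (?b t w * ?b t w)"
  have "regular_on_chart K ?\<phi>"
    using insert.hyps by (intro regular_add regular_mult regular_poly regular_chart_eval)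
  then obtain r where r: "\<And>t w. (t, w) \<in> chart K \<Longrightarrow> ?\<phi> t w = chart_eval K r t w"
    unfolding regular_on_chart_def by auto
  have "\<exists>S\<subseteq>K. r S \<noteq> 0"
  proof (rule ccontr)
    assume "\<not> ?thesis"
    then have "chart_eval K r t w = 0" for t w by (auto simp: chart_eval_def multilin_def)
    then have eq: "(?a t w)\<^sup>2 = (1 + k * t) * (?b t w)\<^sup>2" if "(t, w) \<in> chart K" for t w
      using r [OF that] by (simp add: algebra_simps power2_eq_square)
    have "S - {k} \<subseteq> K" "k \<noteq> 0" using insert.prems by auto
    then have "p (S - {k}) = 0 \<and> p (insert k (S - {k})) = 0"
      using square_classes_independent [OF insert.hyps(1,2) _ eq] by blast
    then show False using insert.prems(3) by (cases "k \<in> S") (auto simp: insert_absorb)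
  qed
  then have "finite {t. \<exists>w. (t, w) \<in> chart K \<and> chart_eval K r t w = 0}"
    using insert by blast
  moreover have "chart_eval K r t w = 0"
    if "(t, w) \<in> chart (insert k K)" "chart_eval (insert k K) p t w = 0" for t w
  proof -
    have w: "(w k)\<^sup>2 = 1 + k * t" "(t, w) \<in> chart K" using that by (auto simp: chart_insert)
    have "?a t w = - (w k * ?b t w)"
      using that(2) unfolding chart_eval_insert [OF insert.hyps] by (simp add: eq_neg_iff_add_eq_0)
    then have "?a t w * ?a t w = (w k)\<^sup>2 * (?b t w * ?b t w)"
      by (simp add: power2_eq_square mult_ac)
    then show ?thesis unfolding r [OF w(2), symmetric] w(1) by (simp add: algebra_simps)
  qed
  ultimately show ?case
    by (elim rev_finite_subset) (auto simp: chart_insert)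
qed

section \<open>Irreducible sets and the Zariski topology\<close>

lemma irreducible_in_finite_Union:
  assumes "irreducible_in T S" "finite \<F>" "\<And>Y. Y \<in> \<F> \<Longrightarrow> closedin T Y" "S \<subseteq> \<Union>\<F>"
  obtains Y where "Y \<in> \<F>" "S \<subseteq> Y"
proof -
  have "\<exists>Y\<in>\<F>. S \<subseteq> Y"
    using assms(2-)
  proof (induction \<F> rule: finite_induct)
    case empty
    then show ?case using assms(1) by (auto simp: irreducible_in_def)
  next
    case (insert Y \<F>)
    have "closedin T Y" "closedin T (\<Union>\<F>)" "S \<subseteq> Y \<union> \<Union>\<F>"
      using insert by (auto intro: closedin_Union)
    then have "S \<subseteq> Y \<or> S \<subseteq> \<Union>\<F>" using assms(1) unfolding irreducible_in_def by blast
    then show ?case using insert by blast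
  qed
  then show ?thesis using that by blast
qed

lemma irreducible_components_finite_Union:
  assumes fin: "finite \<F>" and S: "S = \<Union>\<F>"
    and closed: "\<And>C. C \<in> \<F> \<Longrightarrow> closedin T C" and irr: "\<And>C. C \<in> \<F> \<Longrightarrow> irreducible_in T C"
    and antichain: "\<And>C D. C \<in> \<F> \<Longrightarrow> D \<in> \<F> \<Longrightarrow> C \<subseteq> D \<Longrightarrow> C = D"
  shows "irreducible_components T S = \<F>"
proof (intro Set.set_eqI iffI)
  fix C assume "C \<in> irreducible_components T S"
  then have C: "C \<subseteq> S" "irreducible_in T C"
    "\<And>D. D \<subseteq> S \<Longrightarrow> irreducible_in T D \<Longrightarrow> C \<subseteq> D \<Longrightarrow> D = C"
    by (auto simp: irreducible_components_def)
  obtain D where "D \<in> \<F>" "C \<subseteq> D"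
    using irreducible_in_finite_Union [OF C(2) fin closed] C(1) S by blast
  then show "C \<in> \<F>" using C(3) [of D] irr S by blast
next
  fix C assume C: "C \<in> \<F>"
  have "D = C" if D: "D \<subseteq> S" "irreducible_in T D" "C \<subseteq> D" for D
  proof -
    obtain E where "E \<in> \<F>" "D \<subseteq> E"
      using irreducible_in_finite_Union [OF D(2) fin closed] D(1) S by blast
    then show ?thesis using antichain [OF C, of E] D(3) by blast
  qed
  then show "C \<in> irreducible_components T S"
    using C irr S by (auto simp: irreducible_components_def)
qed

lemma irreducible_imp_connectedin:
  assumes "irreducible_in T S"
  shows "connectedin T S"
  unfolding connectedin_closedin
proof (intro conjI notI)
  show "S \<subseteq> topspace T" using assms by (simp add: irreducible_in_def)
  assume "\<exists>E1 E2. closedin T E1 \<and> closedin T E2 \<and> S \<subseteq> E1 \<union> E2 \<and> E1 \<inter> E2 \<inter> S = {} \<and>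
    E1 \<inter> S \<noteq> {} \<and> E2 \<inter> S \<noteq> {}"
  then obtain E1 E2 where E: "closedin T E1" "closedin T E2" "S \<subseteq> E1 \<union> E2" "E1 \<inter> E2 \<inter> S = {}"
    "E1 \<inter> S \<noteq> {}" "E2 \<inter> S \<noteq> {}" by blast
  then have "S \<subseteq> E1 \<or> S \<subseteq> E2" using assms unfolding irreducible_in_def by blast
  then show False using E by blast
qed

lemma closedin_geom_zariski_iff:
  "closedin geom_zariski S \<longleftrightarrow>
    (\<exists>F. (\<forall>f\<in>F. \<exists>d. f \<in> forms d) \<and> S = {x. x \<noteq> 0 \<and> (\<forall>f\<in>F. mpeval f x = 0)})"
  by (subst closedin_zariski_iff) (auto simp: coeffs_in_def)

lemma closedin_rational_zariski_iff:
  fixes S :: "('a::field_char_0 ^ 'n::finite) set"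
  shows "closedin (zariski \<rat>) S \<longleftrightarrow>
    (\<exists>F. (\<forall>f\<in>F. coeffs_in \<rat> f \<and> (\<exists>d. f \<in> forms d)) \<and> S = {x. x \<noteq> 0 \<and> (\<forall>f\<in>F. mpeval f x = 0)})"
  by (rule closedin_zariski_iff) auto

lemma rational_closed_imp_geom_closed:
  fixes S :: "('a::field_char_0 ^ 'n::finite) set"
  assumes "closedin (zariski \<rat>) S"
  shows "closedin geom_zariski S"
  using assms unfolding closedin_geom_zariski_iff closedin_rational_zariski_iff by blast

lemma geom_irreducible_imp_rational_irreducible:
  fixes S :: "('a::field_char_0 ^ 'n::finite) set"
  assumes "irreducible_in geom_zariski S"
  shows "irreducible_in (zariski \<rat>) S"
proof -
  have "topspace geom_zariski = (topspace (zariski \<rat>) :: ('a ^ 'n) set)"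
    by (simp add: topspace_zariski)
  then show ?thesis
    using assms rational_closed_imp_geom_closed unfolding irreducible_in_def by metis
qed

lemma zariski_closed_scale:
  assumes "closedin geom_zariski Y" "x \<in> Y" "c \<noteq> 0"
  shows "c *s x \<in> Y"
proof -
  obtain F where F: "\<forall>f\<in>F. \<exists>d. f \<in> forms d" "Y = {x. x \<noteq> 0 \<and> (\<forall>f\<in>F. mpeval f x = 0)}"
    using assms(1) unfolding closedin_geom_zariski_iff by blast
  have "mpeval f (c *s x) = 0" if "f \<in> F" for f
  proof -
    obtain d where "f \<in> forms d" using F(1) \<open>f \<in> F\<close> by blast
    then show ?thesis using F(2) assms(2) that by (auto simp: mpeval_scale)
  qed
  then show ?thesis using F(2) assms by auto
qed

text \<open>A point of projective space in the representation of point sets by homogeneous coordinates.\<close>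

definition ray :: "'a::field ^ 'n \<Rightarrow> ('a ^ 'n) set" where
  "ray x = {c *s x | c. c \<noteq> 0}"

lemma in_ray: "x \<in> ray x"
  unfolding ray_def by (intro CollectI exI [of _ 1]) simp

lemma closedin_ray:
  fixes x :: "'a::field ^ 'n::finite"
  assumes "x \<noteq> 0"
  shows "closedin geom_zariski (ray x)"
proof -
  let ?F = "{const (x $ i) * var j - const (x $ j) * var i | i j. True} :: ('n, 'a) mpoly set"
  obtain p where p: "x $ p \<noteq> 0" using assms by (auto simp: vec_eq_iff)
  \<comment> \<open>The 2 by 2 minors of the matrix with rows \<open>x\<close> and \<open>y\<close> express that \<open>y\<close> is proportional to \<open>x\<close>.\<close>
  have "ray x = {y. y \<noteq> 0 \<and> (\<forall>f\<in>?F. mpeval f y = 0)}"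
  proof (intro Set.set_eqI iffI)
    fix y assume "y \<in> ray x"
    then show "y \<in> {y. y \<noteq> 0 \<and> (\<forall>f\<in>?F. mpeval f y = 0)}"
      using assms by (auto simp: ray_def mpeval_mult)
  next
    fix y assume "y \<in> {y. y \<noteq> 0 \<and> (\<forall>f\<in>?F. mpeval f y = 0)}"
    then have y: "y \<noteq> 0" and all: "\<forall>f\<in>?F. mpeval f y = 0" by auto
    have "mpeval (const (x $ i) * var j - const (x $ j) * var i) y = 0" for i j
      by (rule bspec [OF all]) blast
    then have proportional: "x $ i * y $ j = x $ j * y $ i" for i j
      by (simp add: mpeval_mult)
    have "y = (y $ p / x $ p) *s x"
      using p proportional [of _ p] by (simp add: vec_eq_iff field_simps)
    moreover from this y have "y $ p / x $ p \<noteq> 0" by (metis vector_smult_lzero)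
    ultimately show "y \<in> ray x" unfolding ray_def by blast
  qed
  moreover have "const (x $ i) * var j - const (x $ j) * var i \<in> forms 1" for i j
    by (intro forms_diff forms_const_mult forms_var)
  then have "\<forall>f\<in>?F. \<exists>d. f \<in> forms d" by blast
  ultimately show ?thesis unfolding closedin_geom_zariski_iff by blast
qed

lemma irreducible_ray:
  fixes x :: "'a::field ^ 'n::finite"
  assumes "x \<noteq> 0"
  shows "irreducible_in geom_zariski (ray x)"
proof -
  have "ray x \<subseteq> Y" if "closedin geom_zariski Y" "x \<in> Y" for Y
    using zariski_closed_scale [OF that] by (auto simp: ray_def)
  moreover have "ray x \<subseteq> topspace geom_zariski"
    using closedin_ray [OF assms] by (rule closedin_subset)
  ultimately show ?thesis using in_ray [of x] unfolding irreducible_in_def by blast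
qed

lemma finite_vectors_with_squares: "finite {x :: 'a::idom ^ 'n::finite. \<forall>i. (x $ i)\<^sup>2 = a i}"
proof -
  have "finite {y. y\<^sup>2 = c}" for c :: 'a
  proof (cases "\<exists>z. z\<^sup>2 = c")
    case True
    then obtain z where "z\<^sup>2 = c" by blast
    then have "{y. y\<^sup>2 = c} \<subseteq> {z, - z}" by (auto simp: power2_eq_iff)
    then show ?thesis using finite_subset by blast
  qed simp
  then have "finite (vec_lambda ` (\<Pi>\<^sub>E i\<in>UNIV. {y. y\<^sup>2 = a i}))"
    by (intro finite_imageI finite_PiE) auto
  moreover have "{x :: 'a ^ 'n. \<forall>i. (x $ i)\<^sup>2 = a i} \<subseteq> vec_lambda ` (\<Pi>\<^sub>E i\<in>UNIV. {y. y\<^sup>2 = a i})"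
  proof
    fix x :: "'a ^ 'n" assume "x \<in> {x. \<forall>i. (x $ i)\<^sup>2 = a i}"
    then have "vec_nth x \<in> (\<Pi>\<^sub>E i\<in>UNIV. {y. y\<^sup>2 = a i})" by auto
    then show "x \<in> vec_lambda ` (\<Pi>\<^sub>E i\<in>UNIV. {y. y\<^sup>2 = a i})"
      by (rule rev_image_eqI) simp
  qed
  ultimately show ?thesis by (rule rev_finite_subset)
qed

section \<open>Curves of square roots of linear forms\<close>

text \<open>
  The curve of all points with \<open>x\<^sub>i\<^sup>2 = m + \<kappa>\<^sub>i u\<close> for some \<open>m\<close> and \<open>u\<close>, in which coordinates of the same slope
  \<open>\<kappa>\<^sub>i\<close> are linked by fixed signs: \<open>rep k\<close> is a chosen coordinate of slope \<open>k\<close>, and \<open>N\<close> is the set of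
  coordinates that are the negative of the chosen one. The parameters are eliminated by means of the
  slopes 0 and 1: \<open>m\<close> is the square at \<open>rep 0\<close>, and \<open>m + u\<close> the square at \<open>rep 1\<close>.
\<close>

definition root_curve :: "('n \<Rightarrow> 'a) \<Rightarrow> ('a \<Rightarrow> 'n) \<Rightarrow> 'n set \<Rightarrow> ('a::field ^ 'n::finite) set" where
  "root_curve \<kappa> rep N = {x. x \<noteq> 0 \<and>
     (\<forall>i. x $ i = (if i \<in> N then - 1 else 1) * x $ rep (\<kappa> i)) \<and>
     (\<forall>i. (x $ i)\<^sup>2 = (x $ rep 0)\<^sup>2 + \<kappa> i * ((x $ rep 1)\<^sup>2 - (x $ rep 0)\<^sup>2))}"

locale root_curve_data =
  fixes \<kappa> :: "'n::finite \<Rightarrow> 'a::{alg_closed_field, field_char_0}" and rep :: "'a \<Rightarrow> 'n" and N :: "'n set"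
  assumes rep: "\<kappa> (rep (\<kappa> i)) = \<kappa> i"
    and rep_notin: "rep (\<kappa> i) \<notin> N"
    and slope_rational: "\<kappa> i \<in> \<rat>"
    and slope_zero: "0 \<in> range \<kappa>"
    and slope_one: "1 \<in> range \<kappa>"
begin

abbreviation C :: "('a ^ 'n) set" where "C \<equiv> root_curve \<kappa> rep N"
abbreviation sgn_of :: "'n \<Rightarrow> 'a" where "sgn_of i \<equiv> (if i \<in> N then - 1 else 1)"
abbreviation K :: "'a set" where "K \<equiv> range \<kappa>"

lemma rep_K: "k \<in> K \<Longrightarrow> \<kappa> (rep k) = k" "k \<in> K \<Longrightarrow> rep k \<notin> N"
  using rep rep_notin by auto

lemmas rep_zero [simp] = rep_K [OF slope_zero] and rep_one [simp] = rep_K [OF slope_one]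

subsection \<open>Points\<close>

definition point :: "('a \<Rightarrow> 'a) \<Rightarrow> 'a ^ 'n" where
  "point y = (\<chi> i. sgn_of i * y (\<kappa> i))"

lemma point_nth [simp]: "point y $ i = sgn_of i * y (\<kappa> i)"
  by (simp add: point_def)

lemma point_rep: "k \<in> K \<Longrightarrow> point y $ rep k = y k"
  using rep_K by simp

lemma point_in_curve:
  assumes "\<And>k. k \<in> K \<Longrightarrow> (y k)\<^sup>2 = m + k * u" "m \<noteq> 0 \<or> u \<noteq> 0"
  shows "point y \<in> C"
proof -
  have sq: "(y 0)\<^sup>2 = m" "(y 1)\<^sup>2 = m + u" using assms(1) slope_zero slope_one by force+
  have "point y \<noteq> 0"
  proof
    assume "point y = 0"
    then have "y 0 = 0" "y 1 = 0"
      using point_rep [of 0 y] point_rep [of 1 y] slope_zero slope_one by simp_all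
    then show False using sq assms(2) by simp
  qed
  moreover have "(sgn_of i * y (\<kappa> i))\<^sup>2 = m + \<kappa> i * u" for i
    using assms(1) [of "\<kappa> i"] by (simp add: power_mult_distrib)
  ultimately show ?thesis
    unfolding root_curve_def using sq rep rep_notin by simp
qed

lemma point_exists:
  assumes "m \<noteq> 0 \<or> u \<noteq> 0"
  obtains x where "x \<in> C" "\<And>i. (x $ i)\<^sup>2 = m + \<kappa> i * u"
proof -
  define y where "y k = (SOME y. y\<^sup>2 = m + k * u)" for k
  have y: "(y k)\<^sup>2 = m + k * u" for k
    unfolding y_def by (rule someI_ex [OF square_root_exists])
  have "(point y $ i)\<^sup>2 = m + \<kappa> i * u" for i
    using y by (simp add: power_mult_distrib)
  then show ?thesis using that point_in_curve [OF y assms] by blast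
qed

lemma curve_squares:
  assumes "x \<in> C"
  obtains m u where "m \<noteq> 0 \<or> u \<noteq> 0" "\<And>i. (x $ i)\<^sup>2 = m + \<kappa> i * u" "m = (x $ rep 0)\<^sup>2" "m + u = (x $ rep 1)\<^sup>2"
proof -
  let ?m = "(x $ rep 0)\<^sup>2" and ?u = "(x $ rep 1)\<^sup>2 - (x $ rep 0)\<^sup>2"
  have sq: "(x $ i)\<^sup>2 = ?m + \<kappa> i * ?u" and "x \<noteq> 0" for i
    using assms unfolding root_curve_def by blast+
  have "?m \<noteq> 0 \<or> ?u \<noteq> 0"
  proof (rule ccontr)
    assume "\<not> ?thesis"
    then have "?m = 0" "?u = 0" by blast+
    then have "(x $ i)\<^sup>2 = 0" for i unfolding sq [of i] by (simp only: mult_zero_right add_0_left)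
    then show False using \<open>x \<noteq> 0\<close> by (simp add: vec_eq_iff)
  qed
  then show ?thesis using sq by (rule that) simp_all
qed

lemma curve_nth: "x \<in> C \<Longrightarrow> x $ i = sgn_of i * x $ rep (\<kappa> i)"
  unfolding root_curve_def by blast

subsection \<open>Normal forms\<close>

definition mid :: "('n, 'a) mpoly" where "mid = var (rep 0) ^ 2"
definition step :: "('n, 'a) mpoly" where "step = var (rep 1) ^ 2 - var (rep 0) ^ 2"

text \<open>
  The normal forms are the linear combinations of the following polynomials. A square of a root is replaced
  by \<open>m + k u\<close>, where \<open>mid\<close> and \<open>step\<close> are the quadratic forms that represent \<open>m\<close> and \<open>u\<close>.
\<close>

fun basis :: "'a set \<times> nat \<times> nat \<Rightarrow> ('n, 'a) mpoly" where
  "basis (S, a, b) = (\<Prod>k\<in>S. var (rep k)) * (mid ^ a * step ^ b)"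

definition indices :: "nat \<Rightarrow> ('a set \<times> nat \<times> nat) set" where
  "indices d = {(S, a, b). S \<subseteq> K \<and> card S + 2 * a + 2 * b = d}"

text \<open>
  The pairs \<open>(x, v)\<close> such that \<open>x + \<epsilon> v\<close> satisfies the equations of the curve modulo \<open>\<epsilon>\<^sup>2\<close>; the factor 2 that
  comes from the squares is cancelled.
\<close>

definition tangents :: "(('a ^ 'n) \<times> ('a ^ 'n)) set" where
  "tangents = {(x, v). x \<in> C \<and> (\<forall>i. v $ i = sgn_of i * v $ rep (\<kappa> i)) \<and>
     (\<forall>i. x $ i * v $ i = x $ rep 0 * v $ rep 0 +
        \<kappa> i * (x $ rep 1 * v $ rep 1 - x $ rep 0 * v $ rep 0))}"

text \<open>
  This ideal contains the equations of the curve, so the reduction to normal form takes place modulo it. It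
  turns out to be the whole vanishing ideal, so that all gradients that occur in the definition of smoothness are
  orthogonal to the tangent vectors.
\<close>

definition J :: "('n, 'a) mpoly set" where
  "J = {f. \<forall>x v. (x, v) \<in> tangents \<longrightarrow> mpeval f x = 0 \<and> deriv_along f x v = 0}"

lemma J_zero [simp]: "0 \<in> J"
  by (auto simp: J_def)

lemma J_add: "f \<in> J \<Longrightarrow> g \<in> J \<Longrightarrow> f + g \<in> J"
  by (auto simp: J_def mpeval_add deriv_along_add)

lemma J_mult: "f \<in> J \<Longrightarrow> g * f \<in> J"
  by (auto simp: J_def mpeval_mult deriv_along_mult)

lemma J_sum: "(\<And>a. a \<in> A \<Longrightarrow> f a \<in> J) \<Longrightarrow> sum f A \<in> J"
  by (induction A rule: infinite_finite_induct) (auto simp: J_add)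

lemma J_linear: "var i - const (sgn_of i) * var (rep (\<kappa> i)) \<in> J"
  unfolding J_def
proof (intro CollectI allI impI)
  fix x v assume "(x, v) \<in> tangents"
  then have "x $ i = sgn_of i * x $ rep (\<kappa> i)" "v $ i = sgn_of i * v $ rep (\<kappa> i)"
    unfolding tangents_def using curve_nth by blast+
  then show "mpeval (var i - const (sgn_of i) * var (rep (\<kappa> i))) x = 0 \<and>
      deriv_along (var i - const (sgn_of i) * var (rep (\<kappa> i))) x v = 0"
    by (simp only: mpeval_diff deriv_along_diff mpeval_mult deriv_along_mult mpeval_const mpeval_var
        deriv_along_const deriv_along_var mult_zero_right add_0_left diff_self simp_thms)
qed

lemma J_square: "var i ^ 2 - (mid + const (\<kappa> i) * step) \<in> J"
  unfolding J_def
proof (intro CollectI allI impI)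
  fix x v assume xv: "(x, v) \<in> tangents"
  then have "(x $ i)\<^sup>2 = (x $ rep 0)\<^sup>2 + \<kappa> i * ((x $ rep 1)\<^sup>2 - (x $ rep 0)\<^sup>2)"
    unfolding tangents_def root_curve_def by blast
  then have "mpeval (var i ^ 2 - (mid + const (\<kappa> i) * step)) x = 0"
    by (simp add: mid_def step_def mpeval_hom)
  moreover have *: "(p + p) - ((q + q) + (r * 0 + k * ((s + s) - (q + q)))) = 2 * (p - (q + k * (s - q)))"
    for p q r s k :: 'a by (simp add: algebra_simps)
  have "deriv_along (var i ^ 2 - (mid + const (\<kappa> i) * step)) x v =
      2 * (x $ i * v $ i - (x $ rep 0 * v $ rep 0 + \<kappa> i * (x $ rep 1 * v $ rep 1 - x $ rep 0 * v $ rep 0)))"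
    unfolding mid_def step_def power2_eq_square deriv_along_diff deriv_along_add deriv_along_mult
      deriv_along_const deriv_along_var mpeval_const mpeval_var mpeval_diff mpeval_mult
    by (rule *)
  moreover have "x $ i * v $ i =
      x $ rep 0 * v $ rep 0 + \<kappa> i * (x $ rep 1 * v $ rep 1 - x $ rep 0 * v $ rep 0)"
    using xv unfolding tangents_def by blast
  ultimately show "mpeval (var i ^ 2 - (mid + const (\<kappa> i) * step)) x = 0 \<and>
      deriv_along (var i ^ 2 - (mid + const (\<kappa> i) * step)) x v = 0" by simp
qed

lemma J_vanishes: "J \<subseteq> vanishing_ideal C"
proof -
  have "(x, 0) \<in> tangents" if "x \<in> C" for x using that by (simp add: tangents_def)
  then show ?thesis unfolding J_def vanishing_ideal_def by blast
qed

lemma finite_indices: "finite (indices d)"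
proof -
  have "indices d \<subseteq> Pow K \<times> {..d} \<times> {..d}" by (auto simp: indices_def)
  then show ?thesis by (rule finite_subset) auto
qed

definition normalizable :: "nat \<Rightarrow> ('n, 'a) mpoly set" where
  "normalizable d = {f. \<exists>c. (\<forall>b. c b \<in> \<rat>) \<and> f - (\<Sum>b\<in>indices d. const (c b) * basis b) \<in> J}"

lemma normalizable_add:
  assumes "f \<in> normalizable d" "g \<in> normalizable d"
  shows "f + g \<in> normalizable d"
proof -
  obtain c c' where c: "\<forall>b. c b \<in> \<rat>" "f - (\<Sum>b\<in>indices d. const (c b) * basis b) \<in> J"
    and c': "\<forall>b. c' b \<in> \<rat>" "g - (\<Sum>b\<in>indices d. const (c' b) * basis b) \<in> J"
    using assms by (auto simp: normalizable_def)
  have "f + g - (\<Sum>b\<in>indices d. const (c b + c' b) * basis b) =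
    (f - (\<Sum>b\<in>indices d. const (c b) * basis b)) + (g - (\<Sum>b\<in>indices d. const (c' b) * basis b))"
    by (simp add: distrib_right sum.distrib)
  then have "f + g - (\<Sum>b\<in>indices d. const (c b + c' b) * basis b) \<in> J"
    using J_add [OF c(2) c'(2)] by metis
  then show ?thesis
    unfolding normalizable_def using c(1) c'(1)
    by (intro CollectI exI [of _ "\<lambda>b. c b + c' b"]) simp
qed

lemma normalizable_scale:
  assumes "f \<in> normalizable d" "q \<in> \<rat>"
  shows "const q * f \<in> normalizable d"
proof -
  obtain c where c: "\<forall>b. c b \<in> \<rat>" "f - (\<Sum>b\<in>indices d. const (c b) * basis b) \<in> J"
    using assms by (auto simp: normalizable_def)
  have "const q * f - (\<Sum>b\<in>indices d. const (q * c b) * basis b) =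
    const q * (f - (\<Sum>b\<in>indices d. const (c b) * basis b))"
    by (simp add: right_diff_distrib sum_distrib_left mult.assoc)
  then have "const q * f - (\<Sum>b\<in>indices d. const (q * c b) * basis b) \<in> J"
    using J_mult [OF c(2), of "const q"] by metis
  then show ?thesis
    unfolding normalizable_def using c(1) assms(2)
    by (intro CollectI exI [of _ "\<lambda>b. q * c b"]) simp
qed

lemma normalizable_zero: "0 \<in> normalizable d"
  unfolding normalizable_def by (intro CollectI exI [of _ "\<lambda>_. 0"]) simp

lemma normalizable_sum: "(\<And>a. a \<in> A \<Longrightarrow> f a \<in> normalizable d) \<Longrightarrow> sum f A \<in> normalizable d"
  by (induction A rule: infinite_finite_induct) (auto simp: normalizable_add normalizable_zero)

lemma normalizable_basis:
  assumes "b \<in> indices d"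
  shows "basis b \<in> normalizable d"
proof -
  have "(\<Sum>b'\<in>indices d. const (if b' = b then 1 else 0) * basis b') = basis b"
    using assms finite_indices by (subst sum.mono_neutral_right [of _ "{b}"]) auto
  then show ?thesis
    unfolding normalizable_def by (intro CollectI exI [of _ "\<lambda>b'. if b' = b then 1 else 0"]) simp
qed

lemma normalizable_cong: "f - g \<in> J \<Longrightarrow> g \<in> normalizable d \<Longrightarrow> f \<in> normalizable d"
proof -
  assume fg: "f - g \<in> J" and "g \<in> normalizable d"
  then obtain c where c: "\<forall>b. c b \<in> \<rat>" "g - (\<Sum>b\<in>indices d. const (c b) * basis b) \<in> J"
    by (auto simp: normalizable_def)
  have "f - (\<Sum>b\<in>indices d. const (c b) * basis b) \<in> J"
    using J_add [OF fg c(2)] by simp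
  then show ?thesis using c(1) by (auto simp: normalizable_def)
qed

text \<open>
  A new root extends the square-free product; a root that occurs already gives a square, which is
  replaced by the linear form in \<open>m\<close> and \<open>u\<close> that it is equal to.
\<close>

lemma normalizable_var_basis:
  assumes "b \<in> indices d"
  shows "var i * basis b \<in> normalizable (Suc d)"
proof -
  obtain S a e where b: "b = (S, a, e)" "S \<subseteq> K" "card S + 2 * a + 2 * e = d"
    using assms by (cases b) (auto simp: indices_def)
  let ?k = "\<kappa> i"
  have fin: "finite S" using b(2) by (rule finite_subset) simp
  have "var (rep ?k) * basis b \<in> normalizable (Suc d)"
  proof (cases "?k \<in> S")
    case True
    let ?S = "S - {?k}"
    have card: "Suc (card ?S) = card S" using fin True by (rule card_Suc_Diff1)
    have "(\<Prod>k\<in>S. var (rep k) :: ('n, 'a) mpoly) = var (rep ?k) * (\<Prod>k\<in>?S. var (rep k))"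
      using True fin by (simp add: prod.remove)
    then have "var (rep ?k) * basis b = var (rep ?k) ^ 2 * basis (?S, a, e)"
      by (simp add: b(1) power2_eq_square mult_ac)
    moreover have "(mid + const (\<kappa> (rep ?k)) * step) * basis (?S, a, e) =
        basis (?S, Suc a, e) + const ?k * basis (?S, a, Suc e)"
      unfolding rep by (simp add: algebra_simps)
    ultimately have "var (rep ?k) * basis b - (basis (?S, Suc a, e) + const ?k * basis (?S, a, Suc e)) =
        basis (?S, a, e) * (var (rep ?k) ^ 2 - (mid + const (\<kappa> (rep ?k)) * step))"
      by (simp only: right_diff_distrib mult.commute)
    then have "var (rep ?k) * basis b - (basis (?S, Suc a, e) + const ?k * basis (?S, a, Suc e)) \<in> J"
      using J_mult [OF J_square, of "basis (?S, a, e)"] by (simp only:)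
    moreover have "(?S, Suc a, e) \<in> indices (Suc d)" "(?S, a, Suc e) \<in> indices (Suc d)"
      using b(2,3) card by (auto simp: indices_def)
    ultimately show ?thesis
      using slope_rational
      by (meson normalizable_cong normalizable_add normalizable_scale normalizable_basis)
  next
    case False
    then have "var (rep ?k) * basis b = basis (insert ?k S, a, e)"
      using fin by (simp add: b(1) mult.assoc)
    moreover have "(insert ?k S, a, e) \<in> indices (Suc d)"
      using b(2,3) False fin by (auto simp: indices_def)
    ultimately show ?thesis by (metis normalizable_basis)
  qed
  then have "const (sgn_of i) * (var (rep ?k) * basis b) \<in> normalizable (Suc d)"
    by (intro normalizable_scale) auto
  moreover have "var i * basis b - const (sgn_of i) * (var (rep ?k) * basis b) =
      basis b * (var i - const (sgn_of i) * var (rep ?k))"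
    by (simp only: algebra_simps)
  then have "var i * basis b - const (sgn_of i) * (var (rep ?k) * basis b) \<in> J"
    using J_mult [OF J_linear, of "basis b"] by (simp only:)
  ultimately show ?thesis using normalizable_cong by blast
qed

lemma normalizable_var:
  assumes "f \<in> normalizable d"
  shows "var i * f \<in> normalizable (Suc d)"
proof -
  obtain c where c: "\<forall>b. c b \<in> \<rat>" "f - (\<Sum>b\<in>indices d. const (c b) * basis b) \<in> J"
    using assms by (auto simp: normalizable_def)
  have "var i * f - (\<Sum>b\<in>indices d. const (c b) * (var i * basis b)) =
      var i * (f - (\<Sum>b\<in>indices d. const (c b) * basis b))"
    by (simp add: right_diff_distrib sum_distrib_left mult.left_commute)
  then have "var i * f - (\<Sum>b\<in>indices d. const (c b) * (var i * basis b)) \<in> J"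
    using J_mult [OF c(2), of "var i"] by (simp only:)
  moreover have "(\<Sum>b\<in>indices d. const (c b) * (var i * basis b)) \<in> normalizable (Suc d)"
    using c(1) by (intro normalizable_sum normalizable_scale normalizable_var_basis) auto
  ultimately show ?thesis by (rule normalizable_cong)
qed

lemma monomial_normalizable:
  assumes "(\<Sum>i\<in>UNIV. Poly_Mapping.lookup m i) = d"
  shows "Poly_Mapping.single m 1 \<in> normalizable d"
  using assms
proof (induction rule: monomial_induct)
  case one
  have "basis ({}, 0, 0) \<in> normalizable 0" by (intro normalizable_basis) (simp add: indices_def)
  then show ?case by simp
next
  case (times d i f)
  then show ?case by (rule normalizable_var)
qed

lemma mpeval_basis_point:
  assumes "\<And>k. k \<in> K \<Longrightarrow> (y k)\<^sup>2 = m + k * u" "S \<subseteq> K"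
  shows "mpeval (basis (S, a, b)) (point y) = (\<Prod>k\<in>S. y k) * (m ^ a * u ^ b)"
proof -
  have "(\<Prod>k\<in>S. point y $ rep k) = (\<Prod>k\<in>S. y k)"
    using assms(2) point_rep by (intro prod.cong) (auto simp del: point_nth)
  moreover have "point y $ rep 0 = y 0" "point y $ rep 1 = y 1"
    using point_rep slope_zero slope_one by blast+
  moreover have "(y 0)\<^sup>2 = m" "(y 1)\<^sup>2 = m + u"
    using assms(1) slope_zero slope_one by force+
  ultimately show ?thesis
    by (simp add: mid_def step_def mpeval_hom del: point_nth)
qed

lemma polynomial_coeffs_zero:
  fixes a :: "nat \<Rightarrow> 'a"
  assumes "infinite T" "\<And>t. t \<in> T \<Longrightarrow> (\<Sum>i\<le>n. a i * t ^ i) = 0" "i \<le> n"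
  shows "a i = 0"
proof -
  let ?p = "\<Sum>i\<le>n. Polynomial.monom (a i) i"
  have "poly ?p t = (\<Sum>i\<le>n. a i * t ^ i)" for t
    by (simp add: poly_sum poly_monom)
  then have "T \<subseteq> {t. poly ?p t = 0}" using assms(2) by auto
  then have "?p = 0"
    using assms(1) poly_roots_finite finite_subset by blast
  then have "Polynomial.coeff ?p i = 0" by simp
  then show ?thesis using assms(3) by (simp add: coeff_sum)
qed

text \<open>
  At points with nonzero coordinates, the square-free monomials in the square roots are independent
  by sign changes, and their coefficients are polynomials in the two parameters.
\<close>

lemma basis_independent:
  assumes vanish: "\<And>x. x \<in> C \<Longrightarrow> (\<And>i. x $ i \<noteq> 0) \<Longrightarrow>
      mpeval (\<Sum>b\<in>Pow K \<times> {..n} \<times> {..n}. const (c b) * basis b) x = 0"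
    and b: "b \<in> Pow K \<times> {..n} \<times> {..n}"
  shows "c b = 0"
proof -
  obtain S a e where b: "b = (S, a, e)" "S \<subseteq> K" "a \<le> n" "e \<le> n" using b by auto
  define q where "q S m u = (\<Sum>e\<le>n. (\<Sum>a\<le>n. c (S, a, e) * m ^ a) * u ^ e)" for S m u
  have q: "q S m u = 0" if mu: "m \<noteq> 0" "\<And>k. k \<in> K \<Longrightarrow> m + k * u \<noteq> 0" for m u
  proof -
    obtain v where v: "v \<in> C" "\<And>i. (v $ i)\<^sup>2 = m + \<kappa> i * u" using point_exists mu(1) by blast
    show ?thesis
    proof (rule multilin_sign_independent [of K "\<lambda>k. v $ rep k" "\<lambda>S. q S m u"])
      show "v $ rep k \<noteq> 0" if "k \<in> K" for k
        using v(2) [of "rep k"] mu(2) [OF that] rep_K [OF that] by force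
      fix w assume "\<And>k. k \<in> K \<Longrightarrow> w k = v $ rep k \<or> w k = - v $ rep k"
      then have w: "(w k)\<^sup>2 = m + k * u" if "k \<in> K" for k
        using v(2) [of "rep k"] that rep_K [OF that] by force
      have "point w \<in> C" using w mu(1) by (intro point_in_curve) auto
      moreover have "point w $ i \<noteq> 0" for i
        using w [of "\<kappa> i"] mu(2) [of "\<kappa> i"] by auto
      ultimately have "0 = mpeval (\<Sum>b\<in>Pow K \<times> {..n} \<times> {..n}. const (c b) * basis b) (point w)"
        using vanish by simp
      also have "\<dots> = (\<Sum>S\<in>Pow K. \<Sum>a\<le>n. \<Sum>e\<le>n. c (S, a, e) * mpeval (basis (S, a, e)) (point w))"
        by (simp add: mpeval_sum mpeval_mult sum.cartesian_product case_prod_beta del: basis.simps)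
      also have "\<dots> = (\<Sum>S\<in>Pow K. \<Sum>a\<le>n. \<Sum>e\<le>n. c (S, a, e) * ((\<Prod>k\<in>S. w k) * (m ^ a * u ^ e)))"
        using mpeval_basis_point [OF w] by (intro sum.cong) auto
      also have "\<dots> = multilin K (\<lambda>S. q S m u) w"
        unfolding multilin_def q_def
        by (intro sum.cong refl) (subst sum.swap, simp add: sum_distrib_left sum_distrib_right mult_ac)
      finally show "multilin K (\<lambda>S. q S m u) w = 0" by simp
    qed (use b in auto)
  qed
  have "(\<Sum>a\<le>n. c (S, a, e) * m ^ a) = 0" if "m \<in> - {0}" for m
  proof (rule polynomial_coeffs_zero [of "- ((\<lambda>k. - m / k) ` K)"
        "\<lambda>e. \<Sum>a\<le>n. c (S, a, e) * m ^ a" n e])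
    show "infinite (- ((\<lambda>k. - m / k) ` K))"
      unfolding Compl_eq_Diff_UNIV by (intro Diff_infinite_finite infinite_UNIV_char_0) simp
    fix u assume u: "u \<in> - ((\<lambda>k. - m / k) ` K)"
    have "m + k * u \<noteq> 0" if "k \<in> K" for k
    proof
      assume "m + k * u = 0"
      moreover from this have "k \<noteq> 0" using \<open>m \<in> - {0}\<close> by auto
      ultimately have "u = - m / k" by (simp add: field_simps eq_neg_iff_add_eq_0)
      then show False using u that by blast
    qed
    then show "(\<Sum>e\<le>n. (\<Sum>a\<le>n. c (S, a, e) * m ^ a) * u ^ e) = 0"
      using q \<open>m \<in> - {0}\<close> by (simp add: q_def)
  qed (fact b)
  moreover have "infinite (- {0 :: 'a})"
    unfolding Compl_eq_Diff_UNIV by (intro Diff_infinite_finite infinite_UNIV_char_0) simp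
  ultimately show ?thesis
    using polynomial_coeffs_zero [of "- {0}" "\<lambda>a. c (S, a, e)" n a] b by blast
qed

lemma indices_subset_box: "d \<le> n \<Longrightarrow> indices d \<subseteq> Pow K \<times> {..n} \<times> {..n}"
  by (auto simp: indices_def)

text \<open>The exponents of \<open>m\<close> and \<open>u\<close> range over a box, so that normal forms of different degrees can be added.\<close>

definition combination :: "nat \<Rightarrow> ('a set \<times> nat \<times> nat \<Rightarrow> 'a) \<Rightarrow> ('n, 'a) mpoly" where
  "combination n c = (\<Sum>b\<in>Pow K \<times> {..n} \<times> {..n}. const (c b) * basis b)"

lemma rational_basis: "coeffs_in \<rat> (basis b)"
  by (cases b) (auto simp: mid_def step_def intro!: rational_mult rational_prod rational_power rational_diff)

lemma monomial_normal_form: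
  assumes "(\<Sum>i\<in>UNIV. Poly_Mapping.lookup m i) = d" "d \<le> n"
  obtains c where "Poly_Mapping.single m 1 - combination n c \<in> J"
    "\<And>b. b \<notin> indices d \<Longrightarrow> c b = 0" "coeffs_in \<rat> (combination n c)"
proof -
  obtain c where c: "\<forall>b. c b \<in> \<rat>" "Poly_Mapping.single m 1 - (\<Sum>b\<in>indices d. const (c b) * basis b) \<in> J"
    using monomial_normalizable [OF assms(1)] by (auto simp: normalizable_def)
  let ?c = "\<lambda>b. if b \<in> indices d then c b else 0"
  have "combination n ?c = (\<Sum>b\<in>indices d. const (?c b) * basis b)"
    unfolding combination_def using indices_subset_box [OF assms(2)]
    by (intro sum.mono_neutral_right) auto
  also have "\<dots> = (\<Sum>b\<in>indices d. const (c b) * basis b)"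
    by (intro sum.cong) auto
  finally have "combination n ?c = (\<Sum>b\<in>indices d. const (c b) * basis b)" .
  moreover have "coeffs_in \<rat> (combination n ?c)"
    unfolding combination_def using c(1) by (intro rational_sum rational_mult rational_basis rational_const) auto
  ultimately show ?thesis using that [of ?c] c(2) by simp
qed

text \<open>
  For each monomial, the difference to its normal form is a rational polynomial in the vanishing ideal. So
  the difference of \<open>f\<close> and its normal form is a combination of such rational polynomials, whatever the coefficients
  of \<open>f\<close> are.
\<close>

lemma normal_form:
  assumes n: "\<And>m. m \<in> Poly_Mapping.keys f \<Longrightarrow> (\<Sum>i\<in>UNIV. Poly_Mapping.lookup m i) \<le> n"
  obtains c where "f - combination n c \<in> J"
    "f - combination n c \<in> mpoly_ring.span {g \<in> vanishing_ideal C. coeffs_in \<rat> g}"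
    "\<And>d b. f \<in> forms d \<Longrightarrow> b \<notin> indices d \<Longrightarrow> c b = 0"
proof -
  let ?deg = "\<lambda>m. \<Sum>i\<in>UNIV. Poly_Mapping.lookup m i"
  let ?m = "\<lambda>m. Poly_Mapping.single m (1 :: 'a)"
  have "\<exists>c. ?m m - combination n c \<in> J \<and> (\<forall>b. b \<notin> indices (?deg m) \<longrightarrow> c b = 0) \<and>
      coeffs_in \<rat> (combination n c)" if "m \<in> Poly_Mapping.keys f" for m
    using monomial_normal_form [OF refl n [OF that]] by metis
  then obtain c where c: "\<And>m. m \<in> Poly_Mapping.keys f \<Longrightarrow> ?m m - combination n (c m) \<in> J"
    "\<And>m b. m \<in> Poly_Mapping.keys f \<Longrightarrow> b \<notin> indices (?deg m) \<Longrightarrow> c m b = 0"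
    "\<And>m. m \<in> Poly_Mapping.keys f \<Longrightarrow> coeffs_in \<rat> (combination n (c m))"
    by metis
  let ?f = "Poly_Mapping.lookup f"
  define c' where "c' b = (\<Sum>m\<in>Poly_Mapping.keys f. ?f m * c m b)" for b
  have "combination n c' = (\<Sum>m\<in>Poly_Mapping.keys f. const (?f m) * combination n (c m))"
    unfolding combination_def c'_def const_sum const_simps sum_distrib_right sum_distrib_left
    by (subst sum.swap) (simp only: mult.assoc)
  then have "f - combination n c' = (\<Sum>m\<in>Poly_Mapping.keys f. const (?f m) * (?m m - combination n (c m)))"
    by (subst (1) mpoly_eq_sum_monomials) (simp add: right_diff_distrib sum_subtractf)
  moreover have "(\<Sum>m\<in>Poly_Mapping.keys f. const (?f m) * (?m m - combination n (c m))) \<in> J"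
    using c(1) by (intro J_sum J_mult)
  moreover have "?m m - combination n (c m) \<in> {g \<in> vanishing_ideal C. coeffs_in \<rat> g}"
    if "m \<in> Poly_Mapping.keys f" for m
    using that c(1,3) J_vanishes by (auto intro: rational_diff)
  then have "(\<Sum>m\<in>Poly_Mapping.keys f. const (?f m) * (?m m - combination n (c m))) \<in>
      mpoly_ring.span {g \<in> vanishing_ideal C. coeffs_in \<rat> g}"
    by (intro mpoly_ring.span_sum mpoly_ring.span_scale mpoly_ring.span_base)
  moreover have "c' b = 0" if "f \<in> forms d" "b \<notin> indices d" for d b
    unfolding c'_def using that c(2) by (intro sum.neutral) (auto simp: forms_def)
  ultimately show ?thesis using that [of c'] by simp
qed

lemma degree_bound:
  obtains n where "\<And>m. m \<in> Poly_Mapping.keys (f :: ('n, 'a) mpoly) \<Longrightarrow> (\<Sum>i\<in>UNIV. Poly_Mapping.lookup m i) \<le> n"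
  by (rule that [of "\<Sum>m\<in>Poly_Mapping.keys f. \<Sum>i\<in>UNIV. Poly_Mapping.lookup m i"])
     (rule member_le_sum, auto)

lemma generically_zero_combination:
  assumes "\<And>x. x \<in> C \<Longrightarrow> (\<And>i. x $ i \<noteq> 0) \<Longrightarrow> mpeval f x = 0" "f - combination n c \<in> J"
  shows "combination n c = 0"
proof -
  have eq: "mpeval (combination n c) x = mpeval f x" if "x \<in> C" for x
    using assms(2) J_vanishes that by (force simp: vanishing_ideal_def)
  have "c b = 0" if "b \<in> Pow K \<times> {..n} \<times> {..n}" for b
  proof (rule basis_independent [OF _ that])
    fix x assume "x \<in> C" "\<And>i. x $ i \<noteq> 0"
    then show "mpeval (\<Sum>b\<in>Pow K \<times> {..n} \<times> {..n}. const (c b) * basis b) x = 0"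
      unfolding combination_def [symmetric] using eq assms(1) by simp
  qed
  then show ?thesis by (auto simp: combination_def)
qed

text \<open>
  If \<open>f\<close> vanishes at the points with nonzero coordinates, then so does its normal form, which is therefore
  zero by independence: \<open>f\<close> is its own difference to the normal form.
\<close>

lemma generically_zero_in_J:
  assumes "\<And>x. x \<in> C \<Longrightarrow> (\<And>i. x $ i \<noteq> 0) \<Longrightarrow> mpeval f x = 0"
  shows "f \<in> J" "f \<in> mpoly_ring.span {g \<in> vanishing_ideal C. coeffs_in \<rat> g}"
proof -
  obtain n where n: "\<And>m. m \<in> Poly_Mapping.keys f \<Longrightarrow> (\<Sum>i\<in>UNIV. Poly_Mapping.lookup m i) \<le> n"
    using degree_bound by metis
  obtain c where c: "f - combination n c \<in> J"
    "f - combination n c \<in> mpoly_ring.span {g \<in> vanishing_ideal C. coeffs_in \<rat> g}"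
    by (rule normal_form [OF n]) blast+
  then show "f \<in> J" "f \<in> mpoly_ring.span {g \<in> vanishing_ideal C. coeffs_in \<rat> g}"
    using generically_zero_combination [OF assms c(1)] by simp_all
qed

lemma vanishing_ideal_eq_J: "vanishing_ideal C = J"
  using J_vanishes generically_zero_in_J by (auto simp: vanishing_ideal_def)

lemma closedin_rational_curve: "closedin (zariski \<rat>) C"
proof -
  let ?l = "\<lambda>i. var i - const (sgn_of i) * var (rep (\<kappa> i))"
  let ?q = "\<lambda>i. var i ^ 2 - (mid + const (\<kappa> i) * step)"
  have l: "mpeval (?l i) x = 0 \<longleftrightarrow> x $ i = sgn_of i * x $ rep (\<kappa> i)" for i x
    by (simp only: mpeval_diff mpeval_mult mpeval_const mpeval_var right_minus_eq)
  have q: "mpeval (?q i) x = 0 \<longleftrightarrow>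
      (x $ i)\<^sup>2 = (x $ rep 0)\<^sup>2 + \<kappa> i * ((x $ rep 1)\<^sup>2 - (x $ rep 0)\<^sup>2)" for i x
    by (simp only: mpeval_diff mpeval_hom mpeval_const mpeval_var right_minus_eq mid_def step_def)
  have "C = {x. x \<noteq> 0 \<and> (\<forall>f\<in>range ?l \<union> range ?q. mpeval f x = 0)}"
    unfolding ball_Un ball_simps l q root_curve_def by blast
  moreover have "?l i \<in> forms 1" for i
    by (intro forms_diff forms_const_mult forms_var)
  moreover have "var j ^ 2 \<in> (forms 2 :: ('n, 'a) mpoly set)" for j
    using forms_power [OF forms_var [of j], of 2] by simp
  then have "?q i \<in> forms 2" for i
    unfolding mid_def step_def by (intro forms_diff forms_add forms_const_mult)
  moreover have "coeffs_in \<rat> (?l i)" for i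
    by (intro rational_diff rational_mult rational_const) auto
  moreover have "coeffs_in \<rat> (?q i)" for i
    unfolding mid_def step_def using slope_rational
    by (intro rational_diff rational_add rational_mult rational_power rational_const rational_var)
  ultimately show ?thesis
    unfolding closedin_rational_zariski_iff by (intro exI [of _ "range ?l \<union> range ?q"]) blast
qed

lemma defined_over_rationals: "defined_over \<rat> C"
  unfolding defined_over_def
proof
  show "closedin geom_zariski C"
    using closedin_rational_curve by (rule rational_closed_imp_geom_closed)
  have "f \<in> mpoly_ring.span {g \<in> vanishing_ideal C. coeffs_in \<rat> g}" if "f \<in> vanishing_ideal C" for f
    using that by (intro generically_zero_in_J) (auto simp: vanishing_ideal_def)
  moreover have "mpoly_ring.span {g \<in> vanishing_ideal C. coeffs_in \<rat> g} \<subseteq> vanishing_ideal C"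
  proof
    fix f assume "f \<in> mpoly_ring.span {g \<in> vanishing_ideal C. coeffs_in \<rat> g}"
    then show "f \<in> vanishing_ideal C"
      by (induction rule: mpoly_ring.span_induct_alt) (auto simp: vanishing_ideal_def mpeval_hom)
  qed
  ultimately show "vanishing_ideal C = mpoly_ring.span {f \<in> vanishing_ideal C. coeffs_in \<rat> f}"
    by blast
qed


subsection \<open>Irreducibility and dimension\<close>

text \<open>The chart omits the slope 0, whose root is normalized to 1.\<close>

definition affine_point :: "('a \<Rightarrow> 'a) \<Rightarrow> 'a ^ 'n" where
  "affine_point w = point (w(0 := 1))"

lemma affine_point_squares:
  assumes "(t, w) \<in> chart (K - {0})" "k \<in> K"
  shows "((w(0 := 1)) k)\<^sup>2 = 1 + k * t"
  using assms by (auto simp: chart_def)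

lemma affine_point_in_curve:
  assumes "(t, w) \<in> chart (K - {0})"
  shows "affine_point w \<in> C"
  unfolding affine_point_def
  using affine_point_squares [OF assms] by (intro point_in_curve [of _ 1 t]) auto

lemma curve_point_affine:
  assumes "x \<in> C" "x $ rep 0 \<noteq> 0"
  obtains w t where "(t, w) \<in> chart (K - {0})" "x = x $ rep 0 *s affine_point w"
    "\<And>i. (x $ i)\<^sup>2 = (x $ rep 0)\<^sup>2 * (1 + \<kappa> i * t)"
proof -
  let ?c = "x $ rep 0"
  obtain m u where sq: "\<And>i. (x $ i)\<^sup>2 = m + \<kappa> i * u" "m = ?c\<^sup>2"
    by (rule curve_squares [OF assms(1)]) (use that in blast)
  define w where "w k = x $ rep k / ?c" for k
  have m: "m \<noteq> 0" using sq(2) assms(2) by simp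
  have "(w k)\<^sup>2 = 1 + k * (u / m)" if "k \<in> K" for k
  proof -
    have "(x $ rep k)\<^sup>2 = m + k * u" using sq(1) [of "rep k"] rep_K(1) [OF that] by simp
    then show ?thesis using m unfolding w_def power_divide sq(2) [symmetric] by (simp add: field_simps)
  qed
  then have "(u / m, w) \<in> chart (K - {0})" by (simp add: chart_def)
  moreover have "x $ i = ?c * affine_point w $ i" for i
    using assms(2) curve_nth [OF assms(1), of i] by (simp add: affine_point_def w_def)
  then have "x = ?c *s affine_point w" unfolding vec_eq_iff vector_smult_component by blast
  moreover have "(x $ i)\<^sup>2 = ?c\<^sup>2 * (1 + \<kappa> i * (u / m))" for i
    unfolding sq(1) using m unfolding sq(2) [symmetric] by (simp add: field_simps)
  ultimately show ?thesis by (rule that)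
qed

lemma regular_affine_point: "regular_on_chart (K - {0}) (\<lambda>t w. mpeval f (affine_point w))"
proof -
  have fin: "finite (K - {0})" by simp
  have const: "regular_on_chart (K - {0}) (\<lambda>t w. c)" for c
    using regular_poly [OF fin, of "[:c:]"] by simp
  have var: "regular_on_chart (K - {0}) (\<lambda>t w. affine_point w $ i)" for i
  proof (cases "\<kappa> i = 0")
    case True
    then show ?thesis using const by (simp add: affine_point_def)
  next
    case False
    then have "regular_on_chart (K - {0}) (\<lambda>t w. sgn_of i * w (\<kappa> i))"
      by (intro regular_mult const regular_root fin) auto
    then show ?thesis using False by (simp add: affine_point_def)
  qed
  have monomial: "regular_on_chart (K - {0}) (\<lambda>t w. mpeval (Poly_Mapping.single m 1) (affine_point w))" for m
    by (rule monomial_induct [OF refl]) (simp_all add: const var regular_mult fin mpeval_mult)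
  show ?thesis
  proof (induction f rule: mpoly_induct)
    case zero
    then show ?case using const by simp
  next
    case (single_add m c f)
    have "Poly_Mapping.single m c = const c * Poly_Mapping.single m 1"
      by (simp add: const_def mult_single)
    then show ?case
      using single_add monomial const by (simp add: mpeval_hom regular_add regular_mult fin)
  qed
qed

text \<open>By homogeneity, a form that is zero on the affine chart is zero at all points with nonzero coordinates, so
  it belongs to the vanishing ideal. Hence \<open>finite_zeros_on_chart\<close> applies to \<open>f\<close>.\<close>

lemma finite_zeros_of_form:
  assumes "f \<in> forms d" "f \<notin> vanishing_ideal C"
  shows "finite {t. \<exists>w. (t, w) \<in> chart (K - {0}) \<and> mpeval f (affine_point w) = 0}"
proof -
  obtain p where p: "\<And>t w. (t, w) \<in> chart (K - {0}) \<Longrightarrow>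
      mpeval f (affine_point w) = chart_eval (K - {0}) p t w"
    using regular_affine_point [of f] unfolding regular_on_chart_def by blast
  have "\<exists>S\<subseteq>K - {0}. p S \<noteq> 0"
  proof (rule ccontr)
    assume "\<not> ?thesis"
    then have zero: "chart_eval (K - {0}) p t w = 0" for t w by (auto simp: chart_eval_def multilin_def)
    have "mpeval f x = 0" if x: "x \<in> C" "\<And>i. x $ i \<noteq> 0" for x
    proof -
      obtain w t where wt: "(t, w) \<in> chart (K - {0})" "x = x $ rep 0 *s affine_point w"
        using curve_point_affine [OF x(1) x(2)] by blast
      have "mpeval f (x $ rep 0 *s affine_point w) = 0"
        unfolding mpeval_scale [OF assms(1)] p [OF wt(1)] zero by simp
      then show ?thesis using wt(2) by simp
    qed
    then show False using generically_zero_in_J assms(2) vanishing_ideal_eq_J by blast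
  qed
  then obtain S where "S \<subseteq> K - {0}" "p S \<noteq> 0" by blast
  then have "finite {t. \<exists>w. (t, w) \<in> chart (K - {0}) \<and> chart_eval (K - {0}) p t w = 0}"
    by (intro finite_zeros_on_chart [of _ S]) auto
  then show ?thesis by (elim rev_finite_subset) (use p in auto)
qed

lemma nonvanishing_form:
  assumes "closedin geom_zariski Y" "\<not> C \<subseteq> Y"
  obtains f d where "f \<in> forms d" "f \<notin> vanishing_ideal C" "\<And>x. x \<in> Y \<Longrightarrow> mpeval f x = 0"
proof -
  obtain F where F: "\<forall>f\<in>F. \<exists>d. f \<in> forms d" "Y = {x. x \<noteq> 0 \<and> (\<forall>f\<in>F. mpeval f x = 0)}"
    using assms(1) unfolding closedin_geom_zariski_iff by blast
  obtain x where x: "x \<in> C" "x \<notin> Y" using assms(2) by blast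
  then have "x \<noteq> 0" by (simp add: root_curve_def)
  with x F(2) obtain f where f: "f \<in> F" "mpeval f x \<noteq> 0" by blast
  then obtain d where "f \<in> forms d" using F(1) by blast
  then show ?thesis using that f F(2) x(1) by (auto simp: vanishing_ideal_def)
qed

lemma nonempty: "C \<noteq> {}"
  using point_exists [of 1 0] by fastforce

text \<open>
  Two closed sets that cover the curve, neither of them containing it, would lie in the zero sets of two forms that are not
  identically zero on the curve; but these zero sets meet the chart over finitely many parameters only.
\<close>

lemma irreducible: "irreducible_in geom_zariski C"
  unfolding irreducible_in_def
proof (intro conjI allI impI nonempty)
  show "C \<subseteq> topspace geom_zariski"
    by (auto simp: topspace_zariski root_curve_def)
  fix Y Y' assume Y: "closedin geom_zariski Y \<and> closedin geom_zariski Y' \<and> C \<subseteq> Y \<union> Y'"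
  show "C \<subseteq> Y \<or> C \<subseteq> Y'"
  proof (rule ccontr)
    assume not: "\<not> ?thesis"
    obtain f d where f: "f \<in> forms d" "f \<notin> vanishing_ideal C" "\<And>x. x \<in> Y \<Longrightarrow> mpeval f x = 0"
      using Y not nonvanishing_form [of Y] by blast
    obtain g e where g: "g \<in> forms e" "g \<notin> vanishing_ideal C" "\<And>x. x \<in> Y' \<Longrightarrow> mpeval g x = 0"
      using Y not nonvanishing_form [of Y'] by blast
    have "t \<in> {t. \<exists>w. (t, w) \<in> chart (K - {0}) \<and> mpeval f (affine_point w) = 0} \<union>
        {t. \<exists>w. (t, w) \<in> chart (K - {0}) \<and> mpeval g (affine_point w) = 0}" for t
    proof -
      obtain w where w: "(t, w) \<in> chart (K - {0})" by (rule chart_over)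
      then have "affine_point w \<in> Y \<union> Y'" using affine_point_in_curve Y by blast
      then show ?thesis using f(3) g(3) w by blast
    qed
    then have "finite (UNIV :: 'a set)"
      using finite_zeros_of_form [OF f(1,2)] finite_zeros_of_form [OF g(1,2)]
      by (metis (no_types, lifting) UNIV_eq_I finite_UnI)
    then show False using infinite_UNIV_char_0 by blast
  qed
qed

lemma proper_closed_subset_finite:
  assumes "closedin geom_zariski Y" "Y \<subset> C"
  obtains P where "finite P" "0 \<notin> P" "Y \<subseteq> (\<Union>x\<in>P. ray x)"
proof -
  obtain f d where f: "f \<in> forms d" "f \<notin> vanishing_ideal C" "\<And>x. x \<in> Y \<Longrightarrow> mpeval f x = 0"
    using assms nonvanishing_form [of Y] by blast
  define T where "T = {t. \<exists>w. (t, w) \<in> chart (K - {0}) \<and> mpeval f (affine_point w) = 0}"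
  \<comment> \<open>The coordinates are normalized at slope 0, and at slope 1 for the points with \<open>m = 0\<close>.\<close>
  define P where "P = (\<Union>t\<in>T. {x. \<forall>i. (x $ i)\<^sup>2 = 1 + \<kappa> i * t}) \<union> {x. \<forall>i. (x $ i)\<^sup>2 = \<kappa> i}"
  have "finite T" unfolding T_def by (rule finite_zeros_of_form [OF f(1,2)])
  then have "finite P" unfolding P_def by (simp add: finite_vectors_with_squares)
  moreover have "0 \<notin> P"
  proof
    assume "0 \<in> P"
    then have "(\<exists>t. \<forall>i. 0 = 1 + \<kappa> i * t) \<or> (\<forall>i. \<kappa> i = 0)" unfolding P_def by auto
    then show False using rep_zero(1) rep_one(1) by (metis add_0_right mult_zero_left zero_neq_one)
  qed
  moreover have "\<exists>y\<in>P. x \<in> ray y" if "x \<in> Y" for x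
  proof (cases "x $ rep 0 = 0")
    case True
    have "x \<in> C" using assms(2) that by blast
    then obtain m u where mu: "m \<noteq> 0 \<or> u \<noteq> 0" "\<And>i. (x $ i)\<^sup>2 = m + \<kappa> i * u" "m = (x $ rep 0)\<^sup>2"
        "m + u = (x $ rep 1)\<^sup>2"
      by (rule curve_squares) (use that in blast)
    let ?c = "x $ rep 1"
    have u: "u = ?c\<^sup>2" "m = 0" using mu(3,4) True by auto
    then have c: "?c \<noteq> 0" using mu(1) by auto
    have "x = ?c *s (inverse ?c *s x)" using c by (simp add: vec_eq_iff)
    then have "x \<in> ray (inverse ?c *s x)" unfolding ray_def using c by blast
    moreover have "((inverse ?c *s x) $ i)\<^sup>2 = \<kappa> i" for i
      using c mu(2) [of i] u by (simp add: power_mult_distrib power_inverse field_simps)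
    ultimately show ?thesis unfolding P_def by blast
  next
    case False
    let ?c = "x $ rep 0"
    have "x \<in> C" using assms(2) that by blast
    then obtain w t where wt: "(t, w) \<in> chart (K - {0})" "x = ?c *s affine_point w"
        "\<And>i. (x $ i)\<^sup>2 = ?c\<^sup>2 * (1 + \<kappa> i * t)"
      using curve_point_affine False by blast
    have "0 = mpeval f (?c *s affine_point w)"
      using f(3) [OF that] wt(2) by simp
    then have "mpeval f (affine_point w) = 0"
      unfolding mpeval_scale [OF f(1)] using False by simp
    then have "t \<in> T" using wt(1) unfolding T_def by blast
    moreover have "(affine_point w $ i)\<^sup>2 = 1 + \<kappa> i * t" for i
      using affine_point_squares [OF wt(1), of "\<kappa> i"] by (simp add: affine_point_def power_mult_distrib)
    ultimately have "affine_point w \<in> P" unfolding P_def by blast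
    moreover have "x \<in> ray (affine_point w)" using wt(2) False unfolding ray_def by blast
    ultimately show ?thesis by blast
  qed
  then have "Y \<subseteq> (\<Union>x\<in>P. ray x)" by blast
  ultimately show ?thesis by (rule that)
qed

text \<open>A proper closed subset is a finite union of points, so it is a single point if it is irreducible.\<close>

lemma proper_irreducible_subset:
  assumes "closedin geom_zariski Y" "Y \<subset> C" "irreducible_in geom_zariski Y"
  obtains x where "Y = ray x"
proof -
  obtain P where P: "finite P" "0 \<notin> P" "Y \<subseteq> \<Union>(ray ` P)"
    by (rule proper_closed_subset_finite [OF assms(1,2)])
  have "closedin geom_zariski R" if R: "R \<in> ray ` P" for R
  proof -
    obtain x where "R = ray x" "x \<in> P" using R by blast
    then show ?thesis using P(2) closedin_ray [of x] by metis
  qed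
  then obtain R where "R \<in> ray ` P" "Y \<subseteq> R"
    by (rule irreducible_in_finite_Union [OF assms(3) finite_imageI [OF P(1)] _ P(3)])
  then obtain x where x: "Y \<subseteq> ray x" by blast
  obtain y where y: "y \<in> Y" using assms(3) unfolding irreducible_in_def by blast
  with x obtain c where c: "c \<noteq> 0" "y = c *s x" unfolding ray_def by blast
  have "a *s x \<in> Y" if "a \<noteq> 0" for a
  proof -
    have "a *s x = (a / c) *s y" using c by (simp add: vec_eq_iff)
    then show ?thesis using zariski_closed_scale [OF assms(1) y, of "a / c"] that c(1) by simp
  qed
  then have "ray x \<subseteq> Y" unfolding ray_def by blast
  then show ?thesis using x that by blast
qed

lemma closedin_curve: "closedin geom_zariski C"
  using closedin_rational_curve by (rule rational_closed_imp_geom_closed)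

text \<open>
  In a chain of length 2 the two smaller sets would be points, one of them contained in the other. A point inside the
  curve is a chain of length 1.
\<close>

lemma krull_dim_curve: "krull_dim geom_zariski C = 1"
proof -
  let ?T = "geom_zariski :: ('a ^ 'n) topology"
  let ?chain = "\<lambda>r c. (\<forall>i\<le>r. irreducible_in ?T (c i) \<and> closedin (subtopology ?T C) (c i)) \<and>
    (\<forall>i<r. c i \<subset> c (Suc i))"
  let ?R = "{enat r | r. \<exists>c :: nat \<Rightarrow> _. ?chain r c}"
  have closed: "closedin ?T Y" "Y \<subseteq> C" if "closedin (subtopology ?T C) Y" for Y
    using that unfolding closedin_closed_subtopology [OF closedin_curve] by blast+
  have "r \<le> 1" if "?chain r c" for r and c :: "nat \<Rightarrow> ('a ^ 'n) set"
  proof (rule ccontr)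
    assume "\<not> r \<le> 1"
    then have c: "irreducible_in ?T (c i)" "closedin ?T (c i)" "c i \<subseteq> C" if "i \<le> 2" for i
      using that \<open>?chain r c\<close> closed by auto
    have strict_chain: "c 0 \<subset> c 1" "c 1 \<subset> c 2"
      using \<open>\<not> r \<le> 1\<close> that by (auto simp: numeral_2_eq_2)
    moreover from this have "c 0 \<subset> C" "c 1 \<subset> C" using c(3) [of 2] by blast+
    ultimately obtain x y where "c 1 = ray x" "c 0 = ray y"
      using proper_irreducible_subset [OF c(2) _ c(1)] by (metis one_le_numeral zero_le)
    then have strict: "ray y \<subset> ray x" using strict_chain(1) by simp
    then obtain a where a: "a \<noteq> 0" "y = a *s x" using in_ray [of y] unfolding ray_def by blast
    have "b *s x = (b / a) *s y" for b using a by (simp add: vec_eq_iff)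
    moreover have "b / a \<noteq> 0" if "b \<noteq> 0" for b using that a(1) by simp
    ultimately have "ray x \<subseteq> ray y" unfolding ray_def by blast
    then show False using strict by blast
  qed
  then have "Sup ?R \<le> 1"
    by (intro Sup_least) (auto simp: one_enat_def)
  moreover have "enat 1 \<in> ?R"
  proof -
    obtain x where x: "x \<in> C" "\<And>i. (x $ i)\<^sup>2 = 1 + \<kappa> i * 0" using point_exists [of 1 0] by auto
    obtain z where z: "z \<in> C" "\<And>i. (z $ i)\<^sup>2 = 1 + \<kappa> i * 1" using point_exists [of 1 1] by auto
    have "x \<noteq> 0" using x(1) by (simp add: root_curve_def)
    have "z \<notin> ray x"
    proof
      assume "z \<in> ray x"
      then obtain a where "z = a *s x" unfolding ray_def by blast
      then have "(z $ i)\<^sup>2 = a\<^sup>2 * (x $ i)\<^sup>2" for i by (simp add: power_mult_distrib)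
      then have "1 + \<kappa> i = a\<^sup>2" for i using x(2) [of i] z(2) [of i] by simp
      then show False using rep_zero(1) rep_one(1) by (metis add_left_cancel zero_neq_one)
    qed
    moreover have "ray x \<subseteq> C"
      using zariski_closed_scale [OF closedin_curve x(1)] by (auto simp: ray_def)
    ultimately have "ray x \<subset> C" using z(1) by blast
    then have "?chain 1 (\<lambda>i. if i = 0 then ray x else C)"
      using irreducible irreducible_ray [OF \<open>x \<noteq> 0\<close>] closedin_curve closedin_ray [OF \<open>x \<noteq> 0\<close>]
      by (auto simp: closedin_closed_subtopology)
    then have "\<exists>c. ?chain 1 c" by (intro exI [where x = "\<lambda>i. if i = 0 then ray x else C"])
    then show ?thesis by (intro CollectI exI [of _ 1] conjI refl)
  qed
  then have "1 \<le> Sup ?R" unfolding one_enat_def by (rule Sup_upper)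
  ultimately show ?thesis unfolding krull_dim_def by (rule antisym)
qed

end

section \<open>Smoothness\<close>

lemma dual_basis_independent:
  fixes s :: "'n::finite \<Rightarrow> 'a::field ^ 'n"
  assumes "\<And>i j. i \<in> A \<Longrightarrow> j \<in> A \<Longrightarrow> s i $ j = (if j = i then 1 else 0)"
  shows "inj_on s A" "vec.independent (s ` A)"
proof -
  show inj: "inj_on s A"
  proof (rule inj_onI)
    fix i j assume "i \<in> A" "j \<in> A" "s i = s j"
    then show "i = j" using assms [of i i] assms [of j i] by (metis zero_neq_one)
  qed
  show "vec.independent (s ` A)"
  proof (rule vec.independent_if_scalars_zero)
    fix c x assume zero: "(\<Sum>x\<in>s ` A. c x *s x) = 0" and "x \<in> s ` A"
    then obtain j where j: "j \<in> A" "x = s j" by blast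
    have "0 = (\<Sum>i\<in>A. c (s i) *s s i) $ j"
      using zero inj by (simp add: sum.reindex)
    also have "\<dots> = (\<Sum>i\<in>A. if i = j then c (s i) else 0)"
      unfolding sum_component using assms j(1) by (intro sum.cong) auto
    also have "\<dots> = c (s j)" using j(1) by simp
    finally show "c x = 0" using j(2) by simp
  qed simp
qed

lemma gradient_const [simp]: "gradient (const c) x = 0"
  by (simp add: vec_eq_iff const_def gradient_single)

lemma gradient_diff: "gradient (f - g) x = gradient f x - gradient g x"
  using gradient_add [of "f - g" g x] by simp

context root_curve_data begin

lemma deriv_along_tangent:
  "f \<in> vanishing_ideal C \<Longrightarrow> (x, v) \<in> tangents \<Longrightarrow> (\<Sum>i\<in>UNIV. gradient f x $ i * v $ i) = 0"
  unfolding vanishing_ideal_eq_J J_def deriv_along_def by blast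

text \<open>
  The two prescribed entries determine the derivatives of \<open>m\<close> and \<open>u\<close>. The remaining entries are obtained by dividing
  by their roots, since only the root of slope \<open>k1\<close> may be zero.
\<close>

lemma tangent_exists:
  assumes x: "x \<in> C" "k1 \<in> K" "k2 \<in> K" "k1 \<noteq> k2" "\<And>k. k \<in> K \<Longrightarrow> k \<noteq> k1 \<Longrightarrow> x $ rep k \<noteq> 0"
  obtains v where "(x, v) \<in> tangents" "v $ rep k1 = \<alpha>" "v $ rep k2 = \<beta>"
proof -
  define e where "e = (x $ rep k1 * \<alpha> - x $ rep k2 * \<beta>) / (k1 - k2)"
  define a where "a = x $ rep k1 * \<alpha> - k1 * e"
  define w where "w k = (if k = k1 then \<alpha> else (a + k * e) / x $ rep k)" for k
  have xw: "x $ rep k * w k = a + k * e" if "k \<in> K" for k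
    using x(5) [OF that] by (auto simp: w_def a_def)
  have xv: "x $ i * point w $ i = a + \<kappa> i * e" for i
  proof -
    have "x $ i * point w $ i = x $ rep (\<kappa> i) * w (\<kappa> i)"
      by (subst curve_nth [OF x(1), of i]) simp
    then show ?thesis using xw [of "\<kappa> i"] by simp
  qed
  have "(k1 - k2) * e = x $ rep k1 * \<alpha> - x $ rep k2 * \<beta>" using x(4) by (simp add: e_def)
  then have "a + k2 * e = x $ rep k2 * \<beta>" by (simp add: a_def algebra_simps)
  then have "w k2 = \<beta>" using x(3-5) by (auto simp: w_def)
  moreover have "w k1 = \<alpha>" by (simp add: w_def)
  moreover have "(x, point w) \<in> tangents"
    unfolding tangents_def mem_Collect_eq prod.case xv using x(1) rep rep_notin by simp
  ultimately show ?thesis using that point_rep x(2,3) by metis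
qed

text \<open>
  The vectors \<open>s i\<close> below are the basis of the orthogonal complement of the tangent plane that is dual to the
  coordinates other than \<open>p\<close> and \<open>q\<close>. Each of them is a multiple of the gradient of an equation in which only the
  coordinates \<open>p\<close>, \<open>q\<close> and \<open>i\<close> occur.
\<close>

lemma gradient_space:
  assumes x: "x \<in> C" "k1 \<in> K" "k2 \<in> K" "k1 \<noteq> k2" "\<And>k. k \<in> K \<Longrightarrow> k \<noteq> k1 \<Longrightarrow> x $ rep k \<noteq> 0"
  shows "vec.dim {gradient f x | f. f \<in> vanishing_ideal C} = CARD('n) - 2"
proof -
  let ?W = "{gradient f x | f. f \<in> vanishing_ideal C}"
  define p q where "p = rep k1" and "q = rep k2"
  define A where "A = UNIV - {p, q}"
  have pq: "\<kappa> p = k1" "\<kappa> q = k2" using rep_K x(2,3) by (auto simp: p_def q_def)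
  then have "p \<noteq> q" using x(4) by auto
  obtain v where v: "(x, v) \<in> tangents" "v $ p = 1" "v $ q = 0"
    unfolding p_def q_def using tangent_exists [OF x] by metis
  obtain w where w: "(x, w) \<in> tangents" "w $ p = 0" "w $ q = 1"
    unfolding p_def q_def using tangent_exists [OF x] by metis
  define s where "s i = axis i 1 - v $ i *s axis p 1 - w $ i *s axis q (1 :: 'a)" for i
  have s_nth: "s i $ j = (if j = i then 1 else 0)" if "j \<in> A" for i j
    using that by (auto simp: s_def A_def axis_def)
  have s_pq: "s i $ p = - v $ i" "s i $ q = - w $ i" if "i \<in> A" for i
    using that \<open>p \<noteq> q\<close> by (auto simp: s_def A_def axis_def)
  have expand: "gradient f x = (\<Sum>i\<in>A. gradient f x $ i *s s i)" if "f \<in> vanishing_ideal C" for f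
    unfolding vec_eq_iff
  proof
    let ?g = "gradient f x"
    have split: "(\<Sum>i\<in>UNIV. h i) = h p + h q + (\<Sum>i\<in>A. h i)" for h :: "'n \<Rightarrow> 'a"
    proof -
      have A: "A = UNIV - {p} - {q}" by (auto simp: A_def)
      show ?thesis
        unfolding A sum.remove [OF finite UNIV_I, of h p] using \<open>p \<noteq> q\<close>
        by (subst sum.remove [of "UNIV - {p}" q]) (auto simp: add.assoc)
    qed
    fix j
    consider "j \<in> A" | "j = p" | "j = q" by (auto simp: A_def)
    then show "?g $ j = (\<Sum>i\<in>A. ?g $ i *s s i) $ j"
    proof cases
      case 1
      then show ?thesis by (simp add: s_nth if_distrib cong: if_cong)
    next
      case 2
      have "0 = ?g $ p + (\<Sum>i\<in>A. ?g $ i * v $ i)"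
        using deriv_along_tangent [OF that v(1)] unfolding split v(2,3) by simp
      then show ?thesis
        unfolding 2 by (simp add: s_pq sum_negf eq_neg_iff_add_eq_0)
    next
      case 3
      have "0 = ?g $ q + (\<Sum>i\<in>A. ?g $ i * w $ i)"
        using deriv_along_tangent [OF that w(1)] unfolding split w(2,3) by simp
      then show ?thesis
        unfolding 3 by (simp add: s_pq sum_negf eq_neg_iff_add_eq_0)
    qed
  qed
  have in_W: "s i \<in> ?W" if i: "i \<in> A" and f: "f \<in> vanishing_ideal C" "gradient f x $ i \<noteq> 0"
      "\<And>j. j \<in> A \<Longrightarrow> j \<noteq> i \<Longrightarrow> gradient f x $ j = 0" for i f
  proof -
    obtain c where c: "gradient f x $ i = c" "c \<noteq> 0" using f(2) by simp
    have "gradient f x = (\<Sum>j\<in>A. if j = i then c *s s i else 0)"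
      using f(3) c(1) by (subst expand [OF f(1)], intro sum.cong) auto
    then have "gradient f x = c *s s i" using i by simp
    then have "gradient (const (inverse c) * f) x = s i"
      using c(2) by (simp add: gradient_mult)
    moreover have "const (inverse c) * f \<in> vanishing_ideal C"
      using f(1) by (simp add: vanishing_ideal_def mpeval_mult)
    ultimately show ?thesis by (metis (mono_tags, lifting) mem_Collect_eq)
  qed
  have "s i \<in> ?W" if i: "i \<in> A" for i
  proof (cases "\<kappa> i \<in> {k1, k2}")
    case True
    then have r: "rep (\<kappa> i) \<in> {p, q}" by (auto simp: p_def q_def)
    let ?f = "var i - const (sgn_of i) * var (rep (\<kappa> i))"
    have "gradient ?f x $ j = (if j = i then 1 else 0) - sgn_of i * (if j = rep (\<kappa> i) then 1 else 0)" for j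
      unfolding gradient_diff gradient_mult gradient_const gradient_var
      by (auto simp: axis_def)
    then show ?thesis
      using i r J_linear unfolding vanishing_ideal_eq_J [symmetric]
      by (intro in_W [OF i, of ?f]) (auto simp: A_def)
  next
    case False
    let ?k = "\<kappa> i"
    let ?f = "const (k2 - ?k) * (var p * var p) + const (?k - k1) * (var q * var q) +
      const (k1 - k2) * (var i * var i)"
    have nz: "x $ i \<noteq> 0"
      using curve_nth [OF x(1), of i] x(5) [of ?k] False by auto
    have "?f \<in> vanishing_ideal C"
      unfolding vanishing_ideal_def
    proof (intro CollectI ballI)
      fix y assume "y \<in> C"
      then obtain m u where sq: "\<And>i. (y $ i)\<^sup>2 = m + \<kappa> i * u"
        by (rule curve_squares) (use that in blast)
      show "mpeval ?f y = 0"
        unfolding mpeval_hom mpeval_const mpeval_var power2_eq_square [symmetric] sq pq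
        by (simp add: algebra_simps)
    qed
    moreover have "gradient ?f x $ j = 2 * ((k2 - ?k) * x $ p * (if j = p then 1 else 0) +
        (?k - k1) * x $ q * (if j = q then 1 else 0) + (k1 - k2) * x $ i * (if j = i then 1 else 0))" for j
      unfolding gradient_add gradient_mult gradient_const gradient_var
      by (simp add: axis_def algebra_simps)
    ultimately show ?thesis
      using i nz x(4) by (intro in_W [OF i, of ?f]) (auto simp: A_def)
  qed
  then have "s ` A \<subseteq> ?W" by blast
  moreover have "?W \<subseteq> vec.span (s ` A)"
  proof
    fix g assume "g \<in> ?W"
    then obtain f where f: "f \<in> vanishing_ideal C" "g = gradient f x" by blast
    show "g \<in> vec.span (s ` A)"
      unfolding f(2) by (subst expand [OF f(1)]) (intro vec.span_sum vec.span_scale vec.span_base imageI)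
  qed
  moreover have "vec.independent (s ` A)" "card (s ` A) = card A"
    using dual_basis_independent [of A s] s_nth by (auto intro: card_image)
  ultimately have "vec.dim ?W = card A"
    by (rule vec.dim_unique)
  also have "card A = CARD('n) - 2"
    unfolding A_def using \<open>p \<noteq> q\<close> by (simp add: card_Diff_subset)
  finally show ?thesis .
qed

lemma two_coordinates: "2 \<le> CARD('n)"
proof -
  have "rep 0 \<noteq> rep 1" using rep_zero(1) rep_one(1) by (metis zero_neq_one)
  then have "card {rep 0, rep 1} = 2" by simp
  then show ?thesis by (metis card_mono finite subset_UNIV)
qed

text \<open>Two distinct linear forms \<open>m + k u\<close> have no common zero except the origin.\<close>

lemma at_most_one_root_vanishes:
  assumes "x \<in> C"
  obtains k1 where "k1 \<in> K" "\<And>k. k \<in> K \<Longrightarrow> k \<noteq> k1 \<Longrightarrow> x $ rep k \<noteq> 0"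
proof (cases "\<exists>k\<in>K. x $ rep k = 0")
  case True
  then obtain k1 where k1: "k1 \<in> K" "x $ rep k1 = 0" by blast
  obtain m u where mu: "m \<noteq> 0 \<or> u \<noteq> 0" "\<And>i. (x $ i)\<^sup>2 = m + \<kappa> i * u"
    by (rule curve_squares [OF assms]) (use that in blast)
  have "x $ rep k \<noteq> 0" if k: "k \<in> K" "k \<noteq> k1" for k
  proof
    assume "x $ rep k = 0"
    then have "m + k * u = 0" "m + k1 * u = 0"
      using mu(2) [of "rep k"] mu(2) [of "rep k1"] k1 k rep_K by auto
    moreover have "(k - k1) * u = (m + k * u) - (m + k1 * u)" by (simp add: algebra_simps)
    ultimately have "(k - k1) * u = 0" by simp
    then have "u = 0" using k(2) by simp
    then show False using \<open>m + k * u = 0\<close> mu(1) by simp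
  qed
  then show ?thesis using that k1(1) by blast
next
  case False
  then show ?thesis using that slope_zero by blast
qed

theorem smooth_curve:
  assumes "krull_dim geom_zariski C = 1"
  shows "smooth C"
  unfolding smooth_def
proof
  fix x assume x: "x \<in> C"
  obtain k1 where k1: "k1 \<in> K" "\<And>k. k \<in> K \<Longrightarrow> k \<noteq> k1 \<Longrightarrow> x $ rep k \<noteq> 0"
    using at_most_one_root_vanishes [OF x] by blast
  obtain k2 where k2: "k2 \<in> K" "k1 \<noteq> k2"
    using slope_zero slope_one by (metis zero_neq_one)
  have "vec.dim {gradient f x | f. f \<in> vanishing_ideal C} = CARD('n) - 2"
    using x k1(1) k2 k1(2) by (rule gradient_space)
  then show "enat (vec.dim {gradient f x | f. f \<in> vanishing_ideal C}) + krull_dim geom_zariski C =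
      enat (CARD('n) - 1)"
    unfolding assms one_enat_def using two_coordinates by simp
qed

end

section \<open>Hilbert polynomial, degree and genus\<close>

text \<open>For \<open>m \<ge> 0\<close> this is the number of monomials of degree \<open>m\<close> in two variables of degree 2.\<close>

definition quadratic_count :: "int \<Rightarrow> rat" where
  "quadratic_count m = (if even m then of_int m / 2 + 1 else 0)"

text \<open>Induction on \<open>K\<close>, pairing \<open>S\<close> with \<open>insert k S\<close>. The dependence on the parity of \<open>d\<close> disappears with the
  second element of \<open>K\<close>, and each further one doubles the leading coefficient.\<close>

lemma sum_quadratic_count:
  assumes "finite K" "card K = n + 2"
  shows "(\<Sum>S\<in>Pow K. quadratic_count (d - int (card S))) = 2 ^ n * (of_int d + 1 - of_nat n / 2)"
  using assms
proof (induction n arbitrary: K d)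
  case 0
  then have "card K = 2" by simp
  then obtain a b where K: "K = {a, b}" "a \<noteq> b" unfolding card_2_iff by blast
  have [simp]: "{a} \<noteq> {a, b}" "{b} \<noteq> {a, b}" "{a} \<noteq> {b}" "{b} \<noteq> {a}" using K(2) by auto
  have "Pow K = {{}, {a}, {b}, {a, b}}" using K(1) by (auto simp: Pow_insert)
  then have "(\<Sum>S\<in>Pow K. quadratic_count (d - int (card S))) =
      quadratic_count d + (quadratic_count (d - 1) + (quadratic_count (d - 1) + quadratic_count (d - 2)))"
    using K(2) by simp
  also have "\<dots> = of_int d + 1" by (simp add: quadratic_count_def field_simps)
  finally show ?case by simp
next
  case (Suc n)
  obtain k where "k \<in> K" using Suc.prems(2) by fastforce
  define L where "L = K - {k}"
  have L: "finite L" "k \<notin> L" "K = insert k L" "card L = n + 2"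
    using Suc.prems \<open>k \<in> K\<close> by (auto simp: L_def)
  have "card (insert k S) = Suc (card S)" if "S \<in> Pow L" for S
  proof -
    have "finite S" "k \<notin> S" using that L finite_subset by auto
    then show ?thesis by simp
  qed
  then have "(\<Sum>S\<in>Pow L. quadratic_count (d - int (card (insert k S)))) =
      (\<Sum>S\<in>Pow L. quadratic_count ((d - 1) - int (card S)))"
    by (intro sum.cong arg_cong [of _ _ quadratic_count]) auto
  then have "(\<Sum>S\<in>Pow K. quadratic_count (d - int (card S))) =
      2 ^ n * (of_int d + 1 - of_nat n / 2) + 2 ^ n * (of_int (d - 1) + 1 - of_nat n / 2)"
    unfolding L(3) sum_Pow_insert [OF L(1,2)] using Suc.IH [OF L(1,4)] by simp
  then show ?case by (simp add: field_simps)
qed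

lemma card_quadratic_monomials:
  "rat_of_nat (card {(a, b). 2 * a + 2 * b = m}) = quadratic_count (int m)"
proof (cases "even m")
  case True
  then obtain l where l: "m = 2 * l" by (elim evenE)
  have "{(a, b). 2 * a + 2 * b = m} = (\<lambda>a. (a, l - a)) ` {..l}" unfolding l by force
  moreover have "inj_on (\<lambda>a. (a, l - a)) {..l}" by (auto simp: inj_on_def)
  ultimately have "card {(a, b). 2 * a + 2 * b = m} = Suc l" by (simp add: card_image)
  then show ?thesis by (simp add: quadratic_count_def l)
next
  case False
  then have "{(a, b). 2 * a + 2 * b = m} = {}" by (auto simp: even_add)
  then show ?thesis using False by (simp add: quadratic_count_def)
qed

lemma mpoly_finite_dimensional_forms:
  assumes "mpoly.independent B" "B \<subseteq> (forms d :: ('n::finite, 'a::field) mpoly set)"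
  shows "finite B"
proof -
  let ?M = "{m :: 'n \<Rightarrow>\<^sub>0 nat. (\<Sum>i\<in>UNIV. Poly_Mapping.lookup m i) = d}"
  let ?P = "Poly_Mapping.lookup ` ?M"
  have "?P \<subseteq> (\<Pi>\<^sub>E i\<in>UNIV. {..d})"
    by (auto intro: member_le_sum)
  then have "finite ?P" by (rule finite_subset) (auto intro: finite_PiE)
  moreover have "inj_on Poly_Mapping.lookup ?M"
    by (intro inj_onI poly_mapping_eqI) simp
  ultimately have "finite ?M" by (rule finite_imageD)
  moreover have "f \<in> mpoly.span ((\<lambda>m. Poly_Mapping.single m 1) ` ?M)" if "f \<in> forms d" for f :: "('n, 'a) mpoly"
    using that by (subst mpoly_eq_sum_monomials, unfold const_def)
      (intro mpoly.span_sum mpoly.span_scale mpoly.span_base, auto simp: forms_def)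
  then have "B \<subseteq> mpoly.span ((\<lambda>m. Poly_Mapping.single m 1) ` ?M)" using assms(2) by blast
  ultimately show ?thesis
    using mpoly.independent_span_bound [OF finite_imageI assms(1)] by blast
qed

text \<open>
  The family \<open>b\<close> is a basis of the degree \<open>d\<close> part of the coordinate ring, so it extends a basis of the
  degree \<open>d\<close> part of the ideal to a basis of all forms of degree \<open>d\<close>.
\<close>

lemma hilbert_function_eq_card:
  fixes b :: "'i \<Rightarrow> ('n::finite, 'a::field) mpoly"
  assumes fin: "finite I" and forms: "\<And>i. i \<in> I \<Longrightarrow> b i \<in> forms d"
    and spans: "\<And>f. f \<in> forms d \<Longrightarrow> \<exists>c. f - (\<Sum>i\<in>I. const (c i) * b i) \<in> vanishing_ideal S"
    and indep: "\<And>c i. (\<Sum>i\<in>I. const (c i) * b i) \<in> vanishing_ideal S \<Longrightarrow> i \<in> I \<Longrightarrow> c i = 0"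
  shows "hilbert_function S d = card I"
proof -
  let ?V = "forms d :: ('n, 'a) mpoly set" and ?W = "forms d \<inter> vanishing_ideal S"
  obtain B where B: "B \<subseteq> ?W" "mpoly.independent B" "?W \<subseteq> mpoly.span B" "card B = mpoly.dim ?W"
    by (rule mpoly.basis_exists)
  have finB: "finite B" using B(1,2) mpoly_finite_dimensional_forms [of B d] by blast
  have inj: "inj_on b I"
  proof (rule inj_onI)
    fix i j assume ij: "i \<in> I" "j \<in> I" "b i = b j"
    show "i = j"
    proof (rule ccontr)
      assume "i \<noteq> j"
      let ?c = "\<lambda>l. (if l = i then 1 else 0) - (if l = j then 1 else 0) :: 'a"
      have "(\<Sum>l\<in>I. const (?c l) * b l) =
          (\<Sum>l\<in>I. (if l = i then b l else 0) - (if l = j then b l else 0))"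
        by (intro sum.cong) auto
      also have "\<dots> = 0" using ij fin by (simp add: sum_subtractf)
      finally have "?c i = 0"
        using indep [of ?c i] ij(1) by (simp add: vanishing_ideal_def)
      then show False using \<open>i \<noteq> j\<close> by simp
    qed
  qed
  have W_sum: "(\<Sum>g\<in>B. const (c g) * g) \<in> vanishing_ideal S" for c
    using B(1) by (auto simp: vanishing_ideal_def mpeval_hom intro!: sum.neutral)
  have comb_zero: "c i = 0" if "(\<Sum>i\<in>I. const (c i) * b i) + (\<Sum>g\<in>B. const (c' g) * g) = 0" "i \<in> I" for c c' i
  proof -
    have "(\<Sum>i\<in>I. const (c i) * b i) = - (\<Sum>g\<in>B. const (c' g) * g)"
      using that(1) by (simp add: eq_neg_iff_add_eq_0)
    moreover have "- (\<Sum>g\<in>B. const (c' g) * g) \<in> vanishing_ideal S"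
      using W_sum [of c'] by (simp add: vanishing_ideal_def)
    ultimately show ?thesis using indep [of c i] that(2) by simp
  qed
  have disjoint: "b ` I \<inter> B = {}"
  proof (rule ccontr)
    assume "b ` I \<inter> B \<noteq> {}"
    then obtain i where i: "i \<in> I" "b i \<in> B" by blast
    let ?c = "\<lambda>l. if l = i then 1 else 0 :: 'a"
    have "(\<Sum>l\<in>I. const (?c l) * b l) = b i"
      using i(1) fin by (subst sum.mono_neutral_right [of _ "{i}"]) auto
    then have "?c i = 0" using indep [of ?c i] i B(1) by auto
    then show False by simp
  qed
  have "mpoly.dim ?V = card (b ` I \<union> B)"
  proof (rule mpoly.dim_unique [OF _ _ _ refl])
    show "b ` I \<union> B \<subseteq> ?V" using forms B(1) by blast
    show "?V \<subseteq> mpoly.span (b ` I \<union> B)"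
    proof
      fix f assume f: "f \<in> ?V"
      then obtain c where c: "f - (\<Sum>i\<in>I. const (c i) * b i) \<in> vanishing_ideal S" using spans by blast
      have "f - (\<Sum>i\<in>I. const (c i) * b i) \<in> forms d"
        using f forms by (intro forms_diff forms_sum forms_const_mult)
      then have "f - (\<Sum>i\<in>I. const (c i) * b i) \<in> mpoly.span (b ` I \<union> B)"
        using c B(3) mpoly.span_mono [of B "b ` I \<union> B"] by blast
      moreover have "(\<Sum>i\<in>I. const (c i) * b i) \<in> mpoly.span (b ` I \<union> B)"
        unfolding const_def by (intro mpoly.span_sum mpoly.span_scale mpoly.span_base) auto
      ultimately show "f \<in> mpoly.span (b ` I \<union> B)"
        using mpoly.span_add by fastforce
    qed
    show "mpoly.independent (b ` I \<union> B)"
    proof (rule mpoly.independent_if_scalars_zero)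
      show "finite (b ` I \<union> B)" using fin finB by simp
      fix c f assume zero: "(\<Sum>f\<in>b ` I \<union> B. Poly_Mapping.single 0 (c f) * f) = 0" and f: "f \<in> b ` I \<union> B"
      have eq: "(\<Sum>i\<in>I. const (c (b i)) * b i) + (\<Sum>g\<in>B. const (c g) * g) = 0"
        using zero unfolding const_def [symmetric] sum.union_disjoint [OF finite_imageI [OF fin] finB disjoint]
          sum.reindex [OF inj] by simp
      then have ci: "c (b i) = 0" if "i \<in> I" for i using comb_zero [of "\<lambda>i. c (b i)" c i] that by blast
      then have "(\<Sum>g\<in>B. const (c g) * g) = 0" using eq by simp
      then have "c g = 0" if "g \<in> B" for g
        using mpoly.independentD [OF B(2) finB order_refl _ that, of c] unfolding const_def by blast
      then show "c f = 0" using f ci by blast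
    qed
  qed
  also have "\<dots> = card I + mpoly.dim ?W"
    using fin finB disjoint inj by (simp add: card_Un_disjoint card_image B(4))
  finally show ?thesis unfolding hilbert_function_def by simp
qed

lemma hilbert_poly_unique:
  assumes "\<forall>\<^sub>F d in sequentially. poly P (of_nat d) = of_nat (hilbert_function S d)"
  shows "hilbert_poly S = P"
  unfolding hilbert_poly_def
proof (rule the_equality)
  show "\<forall>\<^sub>F d in sequentially. poly P (of_nat d) = of_nat (hilbert_function S d)" by (fact assms)
  fix Q :: "rat poly"
  assume "\<forall>\<^sub>F d in sequentially. poly Q (of_nat d) = of_nat (hilbert_function S d)"
  with assms have "\<forall>\<^sub>F d in sequentially. poly (Q - P) (of_nat d) = 0"
    by eventually_elim simp
  then obtain N where N: "\<And>d. N \<le> d \<Longrightarrow> poly (Q - P) (of_nat d) = 0"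
    by (auto simp: eventually_sequentially)
  have "infinite (of_nat ` {N..} :: rat set)"
    by (simp add: finite_image_iff inj_on_def infinite_Ici)
  moreover have "of_nat ` {N..} \<subseteq> {x. poly (Q - P) x = 0}" using N by auto
  ultimately have "infinite {x. poly (Q - P) x = 0}" using finite_subset by blast
  then show "Q = P" using poly_roots_finite [of "Q - P"] by auto
qed

context root_curve_data begin

lemma basis_in_forms:
  assumes "b \<in> indices d"
  shows "basis b \<in> forms d"
proof -
  obtain S a e where b: "b = (S, a, e)" "card S + 2 * a + 2 * e = d"
    using assms by (cases b) (auto simp: indices_def)
  have sq: "var j ^ 2 \<in> (forms 2 :: ('n, 'a) mpoly set)" for j
    using forms_power [OF forms_var [of j], of 2] by simp
  then have "mid \<in> forms 2" "step \<in> forms 2" unfolding mid_def step_def by (auto intro: forms_diff)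
  then have "basis b \<in> forms (card S + (a * 2 + e * 2))"
    unfolding b(1) basis.simps by (intro forms_mult forms_prod forms_power forms_var)
  moreover have "card S + (a * 2 + e * 2) = d" using b(2) by simp
  ultimately show ?thesis by (simp only:)
qed

lemma combination_indices:
  assumes "\<And>b. b \<notin> indices d \<Longrightarrow> c b = 0"
  shows "combination d c = (\<Sum>b\<in>indices d. const (c b) * basis b)"
  unfolding combination_def using assms indices_subset_box [of d d]
  by (intro sum.mono_neutral_right) auto

lemma hilbert_function_curve: "hilbert_function C d = card (indices d)"
proof (rule hilbert_function_eq_card [OF finite_indices basis_in_forms])
  fix f :: "('n, 'a) mpoly" assume f: "f \<in> forms d"
  then have deg: "(\<Sum>i\<in>UNIV. Poly_Mapping.lookup m i) \<le> d" if "m \<in> Poly_Mapping.keys f" for m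
    using that by (simp add: forms_def)
  show "\<exists>c. f - (\<Sum>b\<in>indices d. const (c b) * basis b) \<in> vanishing_ideal C"
  proof (rule normal_form [OF deg])
    fix c assume c: "f - combination d c \<in> J" "\<And>e b. f \<in> forms e \<Longrightarrow> b \<notin> indices e \<Longrightarrow> c b = 0"
    have "combination d c = (\<Sum>b\<in>indices d. const (c b) * basis b)"
      using c(2) [OF f] by (rule combination_indices)
    then show ?thesis using c(1) J_vanishes by (intro exI [of _ c]) auto
  qed
next
  fix c b assume zero: "(\<Sum>b\<in>indices d. const (c b) * basis b) \<in> vanishing_ideal C" and b: "b \<in> indices d"
  let ?c = "\<lambda>b. if b \<in> indices d then c b else 0"
  have "combination d ?c = (\<Sum>b\<in>indices d. const (?c b) * basis b)"
    by (rule combination_indices) simp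
  also have "\<dots> = (\<Sum>b\<in>indices d. const (c b) * basis b)" by (intro sum.cong) auto
  finally have "mpeval (combination d ?c) x = 0" if "x \<in> C" for x
    using zero that by (simp add: vanishing_ideal_def)
  then have "?c b = 0"
    using b indices_subset_box [of d d] unfolding combination_def
    by (intro basis_independent [of ?c d b]) blast+
  then show "c b = 0" using b by simp
qed

lemma card_indices:
  assumes "card K \<le> d"
  shows "rat_of_nat (card (indices d)) = (\<Sum>S\<in>Pow K. quadratic_count (int d - int (card S)))"
proof -
  have le: "card S \<le> d" if "S \<subseteq> K" for S
    using assms card_mono [OF _ that] by (meson finite_imageI finite order_trans)
  have indices: "indices d = (SIGMA S : Pow K. {(a, b). 2 * a + 2 * b = d - card S})"
  proof (rule Set.set_eqI)
    fix b :: "'a set \<times> nat \<times> nat"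
    obtain S a e where b: "b = (S, a, e)" by (cases b)
    have "card S + 2 * a + 2 * e = d \<longleftrightarrow> 2 * a + 2 * e = d - card S" if "S \<subseteq> K"
      using le [OF that] by linarith
    then show "b \<in> indices d \<longleftrightarrow> b \<in> (SIGMA S : Pow K. {(a, b). 2 * a + 2 * b = d - card S})"
      unfolding b indices_def by auto
  qed
  have fin: "finite {(a, b). 2 * a + 2 * b = m}" for m :: nat
    by (rule finite_subset [of _ "{..m} \<times> {..m}"]) auto
  have "rat_of_nat (card (indices d)) =
      (\<Sum>S\<in>Pow K. rat_of_nat (card {(a, b). 2 * a + 2 * b = d - card S}))"
    unfolding indices by (subst card_SigmaI) (auto simp: fin)
  also have "\<dots> = (\<Sum>S\<in>Pow K. quadratic_count (int d - int (card S)))"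
    unfolding card_quadratic_monomials using le by (intro sum.cong) (auto simp: of_nat_diff)
  finally show ?thesis .
qed

lemma hilbert_poly_curve:
  assumes "card K = n + 2"
  shows "hilbert_poly C = [:2 ^ n * (1 - of_nat n / 2), 2 ^ n:]"
proof (rule hilbert_poly_unique)
  have "poly [:2 ^ n * (1 - of_nat n / 2), 2 ^ n:] (rat_of_nat d) = of_nat (hilbert_function C d)"
    if "card K \<le> d" for d
    unfolding hilbert_function_curve card_indices [OF that]
    using sum_quadratic_count [of K n "int d"] assms by (simp add: algebra_simps)
  then show "\<forall>\<^sub>F d in sequentially. poly [:2 ^ n * (1 - of_nat n / 2), 2 ^ n:] (rat_of_nat d) =
      of_nat (hilbert_function C d)"
    unfolding eventually_sequentially by blast
qed

theorem degree_and_genus: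
  assumes "card K = n + 2"
  shows "proj_degree C = 2 ^ n" "genus C = 1 - 2 ^ n * (1 - of_nat n / 2)"
  by (simp_all add: proj_degree_def genus_def hilbert_poly_curve [OF assms])

end

section \<open>Magic squares of squares\<close>

text \<open>
  Every entry of a magic square is \<open>M\<^sup>2 + coeff_s i * s + coeff_t i * t\<close>, where \<open>s = A\<^sup>2 - M\<^sup>2\<close> and \<open>t = C\<^sup>2 - M\<^sup>2\<close>.
\<close>

fun coeff_s :: "coord \<Rightarrow> qbar" where
  "coeff_s cA = 1" | "coeff_s cB = - 1" | "coeff_s cC = 0"
| "coeff_s cD = - 1" | "coeff_s cM = 0" | "coeff_s cE = 1"
| "coeff_s cF = 0" | "coeff_s cG = 1" | "coeff_s cH = - 1"

fun coeff_t :: "coord \<Rightarrow> qbar" where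
  "coeff_t cA = 0" | "coeff_t cB = - 1" | "coeff_t cC = 1"
| "coeff_t cD = 1" | "coeff_t cM = 0" | "coeff_t cE = - 1"
| "coeff_t cF = - 1" | "coeff_t cG = 1" | "coeff_t cH = 0"

text \<open>On the line \<open>(s, t) = u p\<close> the entry at \<open>i\<close> is \<open>M\<^sup>2 + slope p i * u\<close>.\<close>

definition slope :: "qbar \<times> qbar \<Rightarrow> coord \<Rightarrow> qbar" where
  "slope p i = coeff_s i * fst p + coeff_t i * snd p"

lemma forall_coord: "(\<forall>i. P i) \<longleftrightarrow> P cA \<and> P cB \<and> P cC \<and> P cD \<and> P cM \<and> P cE \<and> P cF \<and> P cG \<and> P cH"
  by (metis coord.exhaust)

lemma magic_surface_parametrized:
  "x \<in> magic_surface \<longleftrightarrow> x \<noteq> 0 \<and>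
    (\<forall>i. (x $ i)\<^sup>2 = (x $ cM)\<^sup>2 + coeff_s i * ((x $ cA)\<^sup>2 - (x $ cM)\<^sup>2) +
      coeff_t i * ((x $ cC)\<^sup>2 - (x $ cM)\<^sup>2))"
proof -
  have "(a + b + c = 3 * m \<and> d + m + e = 3 * m \<and> f + g + h = 3 * m \<and> a + d + f = 3 * m \<and>
      b + m + g = 3 * m \<and> c + e + h = 3 * m \<and> a + m + h = 3 * m \<and> c + m + f = 3 * m) \<longleftrightarrow>
    (b = m - (a - m) - (c - m) \<and> d = m - (a - m) + (c - m) \<and> e = m + 1 * (a - m) + - 1 * (c - m) \<and>
     f = m - (c - m) \<and> g = m + (a - m) + (c - m) \<and> h = m - (a - m))" (is "?L \<longleftrightarrow> ?R")
    for a b c d e f g h m :: qbar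
  proof
    assume L: ?L
    have rest: "q = 3 * m - p - r \<and> r = 3 * m - p - q" if "p + q + r = 3 * m" for p q r
      unfolding that [symmetric] by simp
    have f: "f = 3 * m - c - m" and h: "h = 3 * m - a - m" and b: "b = 3 * m - a - c"
      using L rest by (blast, blast, metis add.commute add.left_commute)
    have "d = 3 * m - a - f" and "g = 3 * m - f - h" and "e = 3 * m - c - h"
      using L rest by blast+
    then show ?R using b unfolding f h by simp
  next
    assume ?R
    then have "b = m - (a - m) - (c - m)" "d = m - (a - m) + (c - m)" "e = m + 1 * (a - m) + - 1 * (c - m)"
      "f = m - (c - m)" "g = m + (a - m) + (c - m)" "h = m - (a - m)" by blast+
    then show ?L by (elim ssubst) simp
  qed
  then show ?thesis
    unfolding magic_surface_def forall_coord by simp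
qed

text \<open>The points of the magic surface at which \<open>(s, t)\<close> is proportional to \<open>p\<close>.\<close>

definition plane :: "qbar \<times> qbar \<Rightarrow> (qbar ^ coord) set" where
  "plane p = {x. x \<noteq> 0 \<and> (\<exists>m u. \<forall>i. (x $ i)\<^sup>2 = m + slope p i * u)}"

lemma plane_iff:
  assumes "p \<noteq> (0, 0)"
  shows "x \<in> plane p \<longleftrightarrow> x \<in> magic_surface \<and>
    fst p * ((x $ cC)\<^sup>2 - (x $ cM)\<^sup>2) = snd p * ((x $ cA)\<^sup>2 - (x $ cM)\<^sup>2)"
proof
  assume "x \<in> plane p"
  then obtain m u where mu: "x \<noteq> 0" "\<And>i. (x $ i)\<^sup>2 = m + slope p i * u" by (auto simp: plane_def)
  then show "x \<in> magic_surface \<and>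
      fst p * ((x $ cC)\<^sup>2 - (x $ cM)\<^sup>2) = snd p * ((x $ cA)\<^sup>2 - (x $ cM)\<^sup>2)"
    unfolding magic_surface_parametrized mu(2) by (simp add: slope_def algebra_simps)
next
  let ?s = "(x $ cA)\<^sup>2 - (x $ cM)\<^sup>2" and ?t = "(x $ cC)\<^sup>2 - (x $ cM)\<^sup>2"
  assume x: "x \<in> magic_surface \<and> fst p * ?t = snd p * ?s"
  have "\<exists>u. ?s = fst p * u \<and> ?t = snd p * u"
  proof (cases "fst p = 0")
    case True
    then have "snd p \<noteq> 0" using assms by (cases p) auto
    then show ?thesis using True x by (intro exI [of _ "?t / snd p"]) auto
  next
    case False
    then show ?thesis using x by (intro exI [of _ "?s / fst p"]) (auto simp: field_simps)
  qed
  then obtain u where u: "?s = fst p * u" "?t = snd p * u" by blast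
  have "(x $ i)\<^sup>2 = (x $ cM)\<^sup>2 + slope p i * u" for i
  proof -
    have "(x $ i)\<^sup>2 = (x $ cM)\<^sup>2 + coeff_s i * ?s + coeff_t i * ?t"
      using x unfolding magic_surface_parametrized by blast
    then show ?thesis unfolding u by (simp add: slope_def algebra_simps)
  qed
  then show "x \<in> plane p" using x unfolding plane_def magic_surface_parametrized by blast
qed

definition dirs3 :: "(qbar \<times> qbar) set" where "dirs3 = {(0, 1), (1, 0)}"
definition dirs5 :: "(qbar \<times> qbar) set" where "dirs5 = {(1, 1), (1, - 1)}"
definition dirs7 :: "(qbar \<times> qbar) set" where "dirs7 = {(1, - 2), (- 2, 1), (1, 2), (2, 1)}"

definition directions :: "(qbar \<times> qbar) set" where "directions = dirs3 \<union> dirs5 \<union> dirs7"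

lemmas dirs_defs = directions_def dirs3_def dirs5_def dirs7_def

lemma Z3_eq: "Z3 = (\<Union>p\<in>dirs3. plane p)"
proof (rule Set.set_eqI)
  fix x
  have "x \<in> Z3 \<longleftrightarrow> x \<in> magic_surface \<and> ((x $ cA)\<^sup>2 = (x $ cM)\<^sup>2 \<or> (x $ cC)\<^sup>2 = (x $ cM)\<^sup>2)"
    unfolding Z3_def power2_eq_iff by blast
  then show "x \<in> Z3 \<longleftrightarrow> x \<in> (\<Union>p\<in>dirs3. plane p)"
    by (auto simp: dirs3_def plane_iff)
qed

lemma eq_iff_proportional_diff:
  fixes c :: "'a::field"
  assumes "u - v = c * (u' - v')" "c \<noteq> 0"
  shows "u = v \<longleftrightarrow> u' = v'"
  using assms by (metis eq_iff_diff_eq_0 mult_eq_0_iff)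

lemma Z5_eq: "Z5 = (\<Union>p\<in>dirs5. plane p)"
proof (rule Set.set_eqI)
  fix x :: "qbar ^ coord"
  let ?s = "(x $ cA)\<^sup>2 - (x $ cM)\<^sup>2" and ?t = "(x $ cC)\<^sup>2 - (x $ cM)\<^sup>2"
  have "x \<in> Z5 \<longleftrightarrow> x \<in> magic_surface \<and> ((x $ cA)\<^sup>2 = (x $ cC)\<^sup>2 \<or> (x $ cA)\<^sup>2 = (x $ cF)\<^sup>2)"
    unfolding Z5_def power2_eq_iff by blast
  moreover have "((x $ cA)\<^sup>2 = (x $ cC)\<^sup>2 \<longleftrightarrow> 1 * ?t = 1 * ?s) \<and> ((x $ cA)\<^sup>2 = (x $ cF)\<^sup>2 \<longleftrightarrow> 1 * ?t = - 1 * ?s)"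
    if "x \<in> magic_surface"
  proof -
    have f: "(x $ cF)\<^sup>2 = (x $ cM)\<^sup>2 - ?t"
      using that unfolding magic_surface_parametrized forall_coord by simp
    show ?thesis unfolding f
      by (intro conjI eq_iff_proportional_diff [of _ _ "- 1"] eq_iff_proportional_diff [of _ _ 1]) simp_all
  qed
  ultimately show "x \<in> Z5 \<longleftrightarrow> x \<in> (\<Union>p\<in>dirs5. plane p)"
    unfolding dirs5_def by (auto simp: plane_iff)
qed

lemma Z7_eq: "Z7 = (\<Union>p\<in>dirs7. plane p)"
proof (rule Set.set_eqI)
  fix x :: "qbar ^ coord"
  let ?s = "(x $ cA)\<^sup>2 - (x $ cM)\<^sup>2" and ?t = "(x $ cC)\<^sup>2 - (x $ cM)\<^sup>2"
  have "x \<in> Z7 \<longleftrightarrow> x \<in> magic_surface \<and> ((x $ cA)\<^sup>2 = (x $ cB)\<^sup>2 \<or> (x $ cB)\<^sup>2 = (x $ cC)\<^sup>2 \<or>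
      (x $ cA)\<^sup>2 = (x $ cD)\<^sup>2 \<or> (x $ cC)\<^sup>2 = (x $ cE)\<^sup>2)"
    unfolding Z7_def power2_eq_iff by blast
  moreover have "((x $ cA)\<^sup>2 = (x $ cB)\<^sup>2 \<longleftrightarrow> 1 * ?t = - 2 * ?s) \<and> ((x $ cB)\<^sup>2 = (x $ cC)\<^sup>2 \<longleftrightarrow> - 2 * ?t = 1 * ?s) \<and>
      ((x $ cA)\<^sup>2 = (x $ cD)\<^sup>2 \<longleftrightarrow> 1 * ?t = 2 * ?s) \<and> ((x $ cC)\<^sup>2 = (x $ cE)\<^sup>2 \<longleftrightarrow> 2 * ?t = 1 * ?s)"
    if "x \<in> magic_surface"
  proof -
    have e: "(x $ cB)\<^sup>2 = (x $ cM)\<^sup>2 - ?s - ?t" "(x $ cD)\<^sup>2 = (x $ cM)\<^sup>2 - ?s + ?t"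
      "(x $ cE)\<^sup>2 = (x $ cM)\<^sup>2 + ?s - ?t"
      using that unfolding magic_surface_parametrized forall_coord by simp_all
    have "(x $ cA)\<^sup>2 = (x $ cB)\<^sup>2 \<longleftrightarrow> 1 * ?t = - 2 * ?s"
      unfolding e by (rule eq_iff_proportional_diff [of _ _ 1]) (simp_all add: algebra_simps)
    moreover have "(x $ cB)\<^sup>2 = (x $ cC)\<^sup>2 \<longleftrightarrow> - 2 * ?t = 1 * ?s"
      unfolding e by (rule eq_iff_proportional_diff [of _ _ 1]) (simp_all add: algebra_simps)
    moreover have "(x $ cA)\<^sup>2 = (x $ cD)\<^sup>2 \<longleftrightarrow> 1 * ?t = 2 * ?s"
      unfolding e by (rule eq_iff_proportional_diff [of _ _ "- 1"]) (simp_all add: algebra_simps)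
    moreover have "(x $ cC)\<^sup>2 = (x $ cE)\<^sup>2 \<longleftrightarrow> 2 * ?t = 1 * ?s"
      unfolding e by (rule eq_iff_proportional_diff [of _ _ 1]) (simp_all add: algebra_simps)
    ultimately show ?thesis by blast
  qed
  ultimately show "x \<in> Z7 \<longleftrightarrow> x \<in> (\<Union>p\<in>dirs7. plane p)"
    unfolding dirs7_def by (auto simp: plane_iff)
qed

text \<open>Two entries differ by a linear form in the two parameters; up to proportionality the 36 pairs of
  entries give only eight linear forms.\<close>

lemma coefficient_differences:
  assumes "i \<noteq> j"
  shows "\<exists>p\<in>directions. \<exists>c\<in>{1, - 1, 2, - 2}. coeff_s i - coeff_s j = - c * snd p \<and>
    coeff_t i - coeff_t j = c * fst p"
  using assms unfolding dirs_defs by (cases i; cases j; simp)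

lemma nondistinct_eq: "nondistinct = (\<Union>p\<in>directions. plane p)"
proof (intro Set.set_eqI iffI)
  fix x assume x: "x \<in> nondistinct"
  then obtain i j where ij: "i \<noteq> j" "(x $ i)\<^sup>2 = (x $ j)\<^sup>2" and magic: "x \<in> magic_surface"
    by (auto simp: nondistinct_def)
  let ?s = "(x $ cA)\<^sup>2 - (x $ cM)\<^sup>2" and ?t = "(x $ cC)\<^sup>2 - (x $ cM)\<^sup>2"
  have sq: "(x $ i)\<^sup>2 = (x $ cM)\<^sup>2 + coeff_s i * ?s + coeff_t i * ?t" for i
    using magic unfolding magic_surface_parametrized by blast
  obtain p c where p: "p \<in> directions" "c \<in> {1, - 1, 2, - 2}" "coeff_s i - coeff_s j = - c * snd p"
    "coeff_t i - coeff_t j = c * fst p"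
    using coefficient_differences [OF ij(1)] by blast
  have "0 = (x $ i)\<^sup>2 - (x $ j)\<^sup>2" using ij(2) by simp
  also have "\<dots> = (coeff_s i - coeff_s j) * ?s + (coeff_t i - coeff_t j) * ?t"
    unfolding sq [of i] sq [of j] by (simp add: left_diff_distrib)
  also have "\<dots> = c * (fst p * ?t - snd p * ?s)"
    unfolding p(3,4) by (simp add: algebra_simps)
  finally have "fst p * ?t = snd p * ?s" using p(2) by auto
  moreover have "p \<noteq> (0, 0)" using p(1) by (auto simp: dirs_defs)
  ultimately have "x \<in> plane p" using magic by (simp add: plane_iff)
  then show "x \<in> (\<Union>p\<in>directions. plane p)" using p(1) by blast
next
  fix x assume "x \<in> (\<Union>p\<in>directions. plane p)"
  then have "x \<in> Z3 \<union> Z5 \<union> Z7" unfolding Z3_eq Z5_eq Z7_eq directions_def by blast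
  then show "x \<in> nondistinct"
  proof -
    have "\<exists>i j. i \<noteq> j \<and> (x $ i = x $ j \<or> x $ i = - x $ j)"
      using \<open>x \<in> Z3 \<union> Z5 \<union> Z7\<close> unfolding Z3_def Z5_def Z7_def by (auto; blast)
    moreover have "x \<in> magic_surface" using \<open>x \<in> Z3 \<union> Z5 \<union> Z7\<close> by (auto simp: Z3_def Z5_def Z7_def)
    ultimately show ?thesis unfolding nondistinct_def power2_eq_iff by blast
  qed
qed

text \<open>A representative of each class of coordinates with equal squares is chosen by \<open>inv_into\<close>; the set \<open>N\<close>
  lists the other coordinates that are the negative of their representative.\<close>

definition nonreps :: "qbar \<times> qbar \<Rightarrow> coord set" where
  "nonreps p = - (inv_into UNIV (slope p) ` range (slope p))"

definition component :: "qbar \<times> qbar \<Rightarrow> coord set \<Rightarrow> (qbar ^ coord) set" where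
  "component p N = root_curve (slope p) (inv_into UNIV (slope p)) N"

definition components :: "(qbar \<times> qbar) set \<Rightarrow> (qbar ^ coord) set set" where
  "components D = {component p N | p N. p \<in> D \<and> N \<subseteq> nonreps p}"

lemma slope_range:
  "range (slope (0, 1)) = {0, 1, - 1}" "range (slope (1, 0)) = {0, 1, - 1}"
  "range (slope (1, 1)) = {0, 1, - 1, 2, - 2}" "range (slope (1, - 1)) = {0, 1, - 1, 2, - 2}"
  "range (slope (1, - 2)) = {0, 1, - 1, 2, - 2, 3, - 3}" "range (slope (- 2, 1)) = {0, 1, - 1, 2, - 2, 3, - 3}"
  "range (slope (1, 2)) = {0, 1, - 1, 2, - 2, 3, - 3}" "range (slope (2, 1)) = {0, 1, - 1, 2, - 2, 3, - 3}"
  by (auto simp: UNIV_coord slope_def)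

lemma slope_range_dirs:
  "p \<in> dirs3 \<Longrightarrow> range (slope p) = {0, 1, - 1}"
  "p \<in> dirs5 \<Longrightarrow> range (slope p) = {0, 1, - 1, 2, - 2}"
  "p \<in> dirs7 \<Longrightarrow> range (slope p) = {0, 1, - 1, 2, - 2, 3, - 3}"
  unfolding dirs3_def dirs5_def dirs7_def insert_iff empty_iff
  by (elim disjE FalseE; simp only: slope_range)+

lemma card_slopes:
  "p \<in> dirs3 \<Longrightarrow> card (range (slope p)) = 3"
  "p \<in> dirs5 \<Longrightarrow> card (range (slope p)) = 5"
  "p \<in> dirs7 \<Longrightarrow> card (range (slope p)) = 7"
  by (simp_all add: slope_range_dirs)

lemma inv_slope: "slope p (inv_into UNIV (slope p) (slope p i)) = slope p i"
  by (simp add: f_inv_into_f)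

lemma component_locale:
  assumes "p \<in> directions" "N \<subseteq> nonreps p"
  shows "root_curve_data (slope p) (inv_into UNIV (slope p)) N"
proof
  have K: "range (slope p) \<subseteq> {0, 1, - 1, 2, - 2, 3, - 3}" "{0, 1} \<subseteq> range (slope p)"
    using assms(1) slope_range_dirs [of p] unfolding directions_def by auto
  fix i
  show "slope p (inv_into UNIV (slope p) (slope p i)) = slope p i" by (rule inv_slope)
  show "inv_into UNIV (slope p) (slope p i) \<notin> N" using assms(2) by (auto simp: nonreps_def)
  have "slope p i \<in> {0, 1, - 1, 2, - 2, 3, - 3}" using K(1) by blast
  then show "slope p i \<in> \<rat>" by auto
  show "0 \<in> range (slope p)" "1 \<in> range (slope p)" using K(2) by auto
qed

text \<open>The signs \<open>N\<close> are read off from a point of the plane by comparing each coordinate with its representative.\<close>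

lemma plane_eq_components:
  assumes p: "p \<in> directions"
  shows "plane p = (\<Union>N\<in>Pow (nonreps p). component p N)"
proof (intro Set.set_eqI iffI)
  let ?r = "inv_into UNIV (slope p)"
  fix x assume "x \<in> plane p"
  then obtain m u where x: "x \<noteq> 0" "\<And>i. (x $ i)\<^sup>2 = m + slope p i * u" by (auto simp: plane_def)
  define N where "N = {i. x $ i \<noteq> x $ ?r (slope p i)}"
  have "?r (slope p (?r k)) = ?r k" if "k \<in> range (slope p)" for k
    using that by (simp add: f_inv_into_f)
  then have N: "N \<subseteq> nonreps p" by (auto simp: N_def nonreps_def)
  interpret root_curve_data "slope p" ?r N by (rule component_locale [OF p N])
  have "(x $ i)\<^sup>2 = (x $ ?r (slope p i))\<^sup>2" for i unfolding x(2) inv_slope ..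
  then have "x $ i = sgn_of i * x $ ?r (slope p i)" for i
    unfolding N_def power2_eq_iff by (cases "x $ i = x $ ?r (slope p i)") auto
  moreover have "(x $ i)\<^sup>2 = (x $ ?r 0)\<^sup>2 + slope p i * ((x $ ?r 1)\<^sup>2 - (x $ ?r 0)\<^sup>2)" for i
    unfolding x(2) by simp
  ultimately have "x \<in> component p N" using x(1) unfolding component_def root_curve_def by blast
  then show "x \<in> (\<Union>N\<in>Pow (nonreps p). component p N)" using N by blast
next
  fix x assume "x \<in> (\<Union>N\<in>Pow (nonreps p). component p N)"
  then obtain N where N: "N \<subseteq> nonreps p" "x \<in> component p N" by blast
  interpret root_curve_data "slope p" "inv_into UNIV (slope p)" N by (rule component_locale [OF p N(1)])
  have "x \<noteq> 0" using N(2) by (auto simp: component_def root_curve_def)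
  then show "x \<in> plane p"
    using curve_squares [OF N(2) [unfolded component_def]] unfolding plane_def by blast
qed

lemma Union_components:
  assumes "D \<subseteq> directions"
  shows "\<Union>(components D) = (\<Union>p\<in>D. plane p)"
proof -
  have "(\<Union>p\<in>D. plane p) = (\<Union>p\<in>D. \<Union>N\<in>Pow (nonreps p). component p N)"
    using assms by (intro SUP_cong refl plane_eq_components) auto
  also have "\<dots> = \<Union>(components D)" unfolding components_def by blast
  finally show ?thesis ..
qed

text \<open>
  The parameters \<open>m = 1\<close> and \<open>u = 1 / 7\<close> give nonzero squares for all slopes, which lie between -3 and 3.
\<close>

lemma generic_point:
  assumes "p \<in> directions" "N \<subseteq> nonreps p"
  obtains x where "x \<in> component p N" "\<And>i. (x $ i)\<^sup>2 = 1 + slope p i / 7" "\<And>i. x $ i \<noteq> 0"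
proof -
  interpret root_curve_data "slope p" "inv_into UNIV (slope p)" N by (rule component_locale [OF assms])
  obtain x where x: "x \<in> component p N" "\<And>i. (x $ i)\<^sup>2 = 1 + slope p i * (1 / 7)"
    using point_exists [of 1 "1 / 7"] unfolding component_def by auto
  have "range (slope p) \<subseteq> {0, 1, - 1, 2, - 2, 3, - 3}"
    using assms(1) slope_range_dirs [of p] unfolding directions_def by auto
  then have slopes: "slope p i \<in> {0, 1, - 1, 2, - 2, 3, - 3}" for i by blast
  have "1 + slope p i * (1 / 7) \<noteq> 0" for i
    using slopes [of i] by (auto simp: field_simps)
  then have "x $ i \<noteq> 0" for i using x(2) [of i] by auto
  then show ?thesis using that x by simp
qed

lemma directions_not_proportional:
  assumes "p \<in> directions" "q \<in> directions" "fst p * snd q = fst q * snd p"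
  shows "p = q"
  using assms unfolding dirs_defs by auto

text \<open>
  A generic point has \<open>(s, t) \<noteq> 0\<close>, which determines the direction, and nonzero coordinates, which determine the
  signs.
\<close>

lemma component_subset:
  assumes p: "p \<in> directions" "N \<subseteq> nonreps p" and q: "q \<in> directions" "N' \<subseteq> nonreps q"
    and sub: "component p N \<subseteq> component q N'"
  shows "p = q \<and> N = N'"
proof -
  obtain x where x: "x \<in> component p N" "\<And>i. (x $ i)\<^sup>2 = 1 + slope p i / 7" "\<And>i. x $ i \<noteq> 0"
    by (rule generic_point [OF p]) (use that in blast)
  have xq: "x \<in> component q N'" using x(1) sub by blast
  then have "x \<in> plane q" using plane_eq_components [OF q(1)] q(2) by blast
  moreover have "q \<noteq> (0, 0)" using q(1) by (auto simp: dirs_defs)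
  ultimately have "fst q * ((x $ cC)\<^sup>2 - (x $ cM)\<^sup>2) = snd q * ((x $ cA)\<^sup>2 - (x $ cM)\<^sup>2)"
    by (simp add: plane_iff)
  then have "fst p * snd q = fst q * snd p" unfolding x(2) by (simp add: slope_def mult.commute)
  then have pq: "p = q" using directions_not_proportional p(1) q(1) by blast
  have "i \<in> N \<longleftrightarrow> i \<in> N'" for i
  proof -
    let ?y = "x $ inv_into UNIV (slope p) (slope p i)"
    have *: "x $ i = (if i \<in> N then - 1 else 1) * ?y" "x $ i = (if i \<in> N' then - 1 else 1) * ?y"
      using x(1) xq unfolding pq component_def root_curve_def by blast+
    have "(if i \<in> N then - 1 else 1) = (if i \<in> N' then - 1 else (1 :: qbar))"
      using trans [OF sym [OF *(1)] *(2)] unfolding mult_right_cancel [OF x(3)] .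
    then show ?thesis by (simp split: if_splits)
  qed
  then show ?thesis using pq by blast
qed

lemma component_properties:
  assumes "p \<in> directions" "N \<subseteq> nonreps p"
  shows "closedin (zariski \<rat>) (component p N)" "irreducible_in geom_zariski (component p N)"
    "defined_over \<rat> (component p N)" "krull_dim geom_zariski (component p N) = 1" "smooth (component p N)"
    "card (range (slope p)) = n + 2 \<Longrightarrow> proj_degree (component p N) = 2 ^ n"
    "card (range (slope p)) = n + 2 \<Longrightarrow> genus (component p N) = 1 - 2 ^ n * (1 - of_nat n / 2)"
proof -
  interpret root_curve_data "slope p" "inv_into UNIV (slope p)" N by (rule component_locale [OF assms])
  show "closedin (zariski \<rat>) (component p N)" "irreducible_in geom_zariski (component p N)"
    "defined_over \<rat> (component p N)" "krull_dim geom_zariski (component p N) = 1" "smooth (component p N)"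
    "card (range (slope p)) = n + 2 \<Longrightarrow> proj_degree (component p N) = 2 ^ n"
    "card (range (slope p)) = n + 2 \<Longrightarrow> genus (component p N) = 1 - 2 ^ n * (1 - of_nat n / 2)"
    unfolding component_def
    using closedin_rational_curve irreducible defined_over_rationals krull_dim_curve
      smooth_curve [OF krull_dim_curve] degree_and_genus by blast+
qed

lemma finite_components: "finite D \<Longrightarrow> finite (components D)"
proof -
  assume "finite D"
  then have "finite ((\<lambda>(p, N). component p N) ` (D \<times> UNIV))" by simp
  then show ?thesis by (rule rev_finite_subset) (auto simp: components_def)
qed

lemma finite_directions: "finite directions"
  by (simp add: dirs_defs)

lemma irreducible_components_eq:
  assumes D: "D \<subseteq> directions" and Z: "Z = (\<Union>p\<in>D. plane p)"
  shows "irreducible_components (zariski \<rat>) Z = components D"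
    "irreducible_components geom_zariski Z = components D"
proof -
  have fin: "finite (components D)"
    using finite_components finite_subset [OF D finite_directions] by blast
  have Z': "Z = \<Union>(components D)" using Union_components [OF D] Z by simp
  have antichain: "C = C'" if "C \<in> components D" "C' \<in> components D" "C \<subseteq> C'" for C C'
    using that component_subset D unfolding components_def by blast
  have props: "closedin (zariski \<rat>) C" "irreducible_in geom_zariski C" if "C \<in> components D" for C
    using that component_properties(1,2) D unfolding components_def by blast+
  show "irreducible_components (zariski \<rat>) Z = components D"
    using fin Z' props(1) geom_irreducible_imp_rational_irreducible [OF props(2)] antichain
    by (rule irreducible_components_finite_Union)
  show "irreducible_components geom_zariski Z = components D"
    using fin Z' rational_closed_imp_geom_closed [OF props(1)] props(2) antichain
    by (rule irreducible_components_finite_Union)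
qed

lemma card_nonreps: "card (nonreps p) = 9 - card (range (slope p))"
proof -
  have "card (inv_into UNIV (slope p) ` range (slope p)) = card (range (slope p))"
    by (intro card_image inj_on_inv_into) simp
  moreover have "CARD(coord) = 9" by (simp add: UNIV_coord)
  ultimately show ?thesis unfolding nonreps_def Compl_eq_Diff_UNIV by (simp add: card_Diff_subset)
qed

lemma card_components:
  assumes D: "D \<subseteq> directions" and k: "\<And>p. p \<in> D \<Longrightarrow> card (range (slope p)) = k"
  shows "card (components D) = card D * 2 ^ (9 - k)"
proof -
  have "components D = (\<lambda>(p, N). component p N) ` (SIGMA p:D. Pow (nonreps p))"
    unfolding components_def by auto
  moreover have "inj_on (\<lambda>(p, N). component p N) (SIGMA p:D. Pow (nonreps p))"
  proof (rule inj_onI)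
    fix a b assume ab: "a \<in> (SIGMA p:D. Pow (nonreps p))" "b \<in> (SIGMA p:D. Pow (nonreps p))"
      "(\<lambda>(p, N). component p N) a = (\<lambda>(p, N). component p N) b"
    obtain p N q N' where "a = (p, N)" "b = (q, N')" by (cases a, cases b) blast
    then show "a = b" using component_subset [of p N q N'] ab D by auto
  qed
  ultimately have "card (components D) = card (SIGMA p:D. Pow (nonreps p))"
    by (simp add: card_image)
  also have "\<dots> = (\<Sum>p\<in>D. 2 ^ (9 - k))"
    using finite_subset [OF D finite_directions] k by (simp add: card_Pow card_nonreps)
  finally show ?thesis by simp
qed

text \<open>Away from the locus where all nine squares agree, the entries at a point of the curve of direction
  \<open>p\<close> are in bijection with the slopes of \<open>p\<close>. That locus contains no component, so its complement is dense.\<close>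

lemma generic_entries_planes:
  assumes D: "D \<subseteq> directions" and Z: "Z = (\<Union>p\<in>D. plane p)"
    and k: "\<And>p. p \<in> D \<Longrightarrow> card (range (slope p)) = k"
  shows "generic_entries Z k"
proof -
  let ?fA = "var cA ^ 2 - var cM ^ 2 :: (coord, qbar) mpoly"
  let ?fC = "var cC ^ 2 - var cM ^ 2 :: (coord, qbar) mpoly"
  define W where "W = {x :: qbar ^ coord. x \<noteq> 0 \<and> (\<forall>f\<in>{?fA, ?fC}. mpeval f x = 0)}"
  have W: "x \<in> W \<longleftrightarrow> x \<noteq> 0 \<and> (x $ cA)\<^sup>2 = (x $ cM)\<^sup>2 \<and> (x $ cC)\<^sup>2 = (x $ cM)\<^sup>2" for x
    by (simp add: W_def mpeval_hom)
  have sq: "var i ^ 2 - var j ^ 2 \<in> (forms 2 :: (coord, qbar) mpoly set)"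
    "coeffs_in \<rat> (var i ^ 2 - var j ^ 2 :: (coord, qbar) mpoly)" for i j
    using forms_power [OF forms_var [of i], of 2] forms_power [OF forms_var [of j], of 2]
    by (auto intro!: forms_diff rational_diff rational_power)
  have "\<forall>f\<in>{?fA, ?fC}. coeffs_in \<rat> f \<and> (\<exists>d. f \<in> forms d)" using sq by blast
  then have closed_W: "closedin (zariski \<rat>) W"
    unfolding closedin_rational_zariski_iff using W_def by blast
  define U where "U = Z - W"
  have "openin (subtopology (zariski \<rat>) Z) U"
  proof -
    have "openin (zariski \<rat>) (topspace (zariski \<rat>) - W)" using closed_W by blast
    moreover have "Z \<subseteq> topspace (zariski \<rat>)" by (auto simp: Z plane_def topspace_zariski)
    then have "U = (topspace (zariski \<rat>) - W) \<inter> Z" unfolding U_def by blast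
    ultimately show ?thesis unfolding openin_subtopology by blast
  qed
  moreover have "Z \<subseteq> (zariski \<rat>) closure_of U"
  proof -
    have "component p N \<subseteq> (zariski \<rat>) closure_of U" if pN: "p \<in> D" "N \<subseteq> nonreps p" for p N
    proof -
      have p: "p \<in> directions" using pN(1) D by blast
      note props = component_properties [OF p pN(2)]
      have "component p N \<subseteq> Z"
        unfolding Z plane_eq_components [OF p, symmetric] using pN plane_eq_components [OF p] by blast
      moreover have "U \<subseteq> (zariski \<rat>) closure_of U"
        by (intro closure_of_subset) (auto simp: U_def Z plane_def topspace_zariski)
      ultimately have "component p N \<subseteq> (zariski \<rat>) closure_of U \<union> W" unfolding U_def by blast
      then have "component p N \<subseteq> (zariski \<rat>) closure_of U \<or> component p N \<subseteq> W"
        using geom_irreducible_imp_rational_irreducible [OF props(2)] closed_W closedin_closure_of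
        unfolding irreducible_in_def by blast
      moreover obtain x where x: "x \<in> component p N" "\<And>i. (x $ i)\<^sup>2 = 1 + slope p i / 7"
        by (rule generic_point [OF p pN(2)]) (use that in blast)
      have "x \<notin> W"
      proof
        assume "x \<in> W"
        then have "fst p = 0" "snd p = 0" unfolding W x(2) by (simp_all add: slope_def)
        then show False using p by (auto simp: dirs_defs)
      qed
      ultimately show ?thesis using x(1) by blast
    qed
    then have "\<Union>(components D) \<subseteq> (zariski \<rat>) closure_of U" unfolding components_def by blast
    then show ?thesis unfolding Union_components [OF D] Z .
  qed
  moreover have "card (entries x) = k" if "x \<in> U" for x
  proof -
    obtain p m u where p: "p \<in> D" and mu: "x \<noteq> 0" "\<And>i. (x $ i)\<^sup>2 = m + slope p i * u"
      using \<open>x \<in> U\<close> by (auto simp: U_def Z plane_def)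
    have "u \<noteq> 0"
    proof
      assume "u = 0"
      then have "x \<in> W" unfolding W mu(2) using mu(1) by simp
      then show False using \<open>x \<in> U\<close> by (simp add: U_def)
    qed
    then have "inj_on (\<lambda>s. m + s * u) (range (slope p))" by (simp add: inj_on_def)
    moreover have "entries x = (\<lambda>s. m + s * u) ` range (slope p)"
      unfolding entries_def mu(2) by (simp add: image_image)
    ultimately show ?thesis using k [OF p] by (simp add: card_image)
  qed
  ultimately show ?thesis unfolding generic_entries_def by blast
qed

lemma components_Un: "components D \<union> components D' = components (D \<union> D')"
  unfolding components_def by blast

lemma genus_degree_components:
  assumes D: "D \<subseteq> directions" and k: "\<And>p. p \<in> D \<Longrightarrow> card (range (slope p)) = n + 2" and C: "C \<in> components D"
  shows "genus C = 1 - 2 ^ n * (1 - of_nat n / 2) \<and> proj_degree C = 2 ^ n"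
proof -
  obtain p N where "C = component p N" "p \<in> D" "N \<subseteq> nonreps p" using C unfolding components_def by blast
  then show ?thesis using component_properties(6,7) [of p N n] D k by auto
qed

theorem proposition3p1:
  shows "nondistinct = Z3 \<union> Z5 \<union> Z7 \<and>
    generic_entries Z3 3 \<and> generic_entries Z5 5 \<and> generic_entries Z7 7 \<and>
    irreducible_components (zariski \<rat>) nondistinct =
      irreducible_components (zariski \<rat>) Z3 \<union>
      irreducible_components (zariski \<rat>) Z5 \<union>
      irreducible_components (zariski \<rat>) Z7 \<and>
    irreducible_components geom_zariski nondistinct = irreducible_components (zariski \<rat>) nondistinct \<and>
    (\<forall>C\<in>irreducible_components (zariski \<rat>) nondistinct.
      defined_over \<rat> C \<and> krull_dim geom_zariski C = 1 \<and> smooth C \<and>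
      connectedin geom_zariski C) \<and>
    card (irreducible_components (zariski \<rat>) Z3) = 128 \<and>
    (\<forall>C\<in>irreducible_components (zariski \<rat>) Z3. genus C = 0 \<and> proj_degree C = 2) \<and>
    card (irreducible_components (zariski \<rat>) Z5) = 32 \<and>
    (\<forall>C\<in>irreducible_components (zariski \<rat>) Z5. genus C = 5 \<and> proj_degree C = 8) \<and>
    card (irreducible_components (zariski \<rat>) Z7) = 16 \<and>
    (\<forall>C\<in>irreducible_components (zariski \<rat>) Z7. genus C = 49 \<and> proj_degree C = 32) \<and>
    card (irreducible_components (zariski \<rat>) nondistinct) = 176"
proof -
  have sub: "dirs3 \<subseteq> directions" "dirs5 \<subseteq> directions" "dirs7 \<subseteq> directions"
    by (auto simp: directions_def)
  note irr = irreducible_components_eq [OF sub(1) Z3_eq] irreducible_components_eq [OF sub(2) Z5_eq]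
    irreducible_components_eq [OF sub(3) Z7_eq] irreducible_components_eq [OF subset_refl nondistinct_eq]
  have union: "components directions = components dirs3 \<union> components dirs5 \<union> components dirs7"
    by (simp add: components_Un directions_def)
  have "nondistinct = Z3 \<union> Z5 \<union> Z7"
    unfolding nondistinct_eq Z3_eq Z5_eq Z7_eq directions_def by blast
  moreover have "generic_entries Z3 3" "generic_entries Z5 5" "generic_entries Z7 7"
    using generic_entries_planes [OF sub(1) Z3_eq card_slopes(1)]
      generic_entries_planes [OF sub(2) Z5_eq card_slopes(2)]
      generic_entries_planes [OF sub(3) Z7_eq card_slopes(3)] by blast+
  moreover have "defined_over \<rat> C \<and> krull_dim geom_zariski C = 1 \<and> smooth C \<and> connectedin geom_zariski C"
    if C: "C \<in> components directions" for C
  proof -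
    obtain p N where "C = component p N" "p \<in> directions" "N \<subseteq> nonreps p"
      using C unfolding components_def by blast
    then show ?thesis
      using component_properties [of p N] irreducible_imp_connectedin by blast
  qed
  moreover have cards: "card (components dirs3) = 128" "card (components dirs5) = 32" "card (components dirs7) = 16"
    using card_components [OF sub(1) card_slopes(1)] card_components [OF sub(2) card_slopes(2)]
      card_components [OF sub(3) card_slopes(3)] by (simp_all add: dirs3_def dirs5_def dirs7_def)
  moreover have "genus C = 0 \<and> proj_degree C = 2" if "C \<in> components dirs3" for C
    using genus_degree_components [OF sub(1), of 1 C] card_slopes(1) that by simp
  moreover have "genus C = 5 \<and> proj_degree C = 8" if "C \<in> components dirs5" for C
    using genus_degree_components [OF sub(2), of 3 C] card_slopes(2) that by simp
  moreover have "genus C = 49 \<and> proj_degree C = 32" if "C \<in> components dirs7" for C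
    using genus_degree_components [OF sub(3), of 5 C] card_slopes(3) that by simp
  moreover have "card (components directions) = 176"
  proof -
    have disjoint: "components D \<inter> components D' = {}"
      if D: "D \<subseteq> directions" "D' \<subseteq> directions" "D \<inter> D' = {}" for D D'
    proof (rule ccontr)
      assume "components D \<inter> components D' \<noteq> {}"
      then obtain p N q N' where pq: "p \<in> D" "N \<subseteq> nonreps p" "q \<in> D'" "N' \<subseteq> nonreps q"
        "component p N = component q N'" unfolding components_def by blast
      then have "p = q" using component_subset [of p N q N'] D(1,2) by blast
      then show False using pq(1,3) D(3) by blast
    qed
    have "dirs3 \<inter> dirs5 = {}" "(dirs3 \<union> dirs5) \<inter> dirs7 = {}"
      by (auto simp: dirs3_def dirs5_def dirs7_def)
    then have "components dirs3 \<inter> components dirs5 = {}"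
      "(components dirs3 \<union> components dirs5) \<inter> components dirs7 = {}"
      using disjoint sub by (simp_all add: components_Un)
    moreover have "finite (components dirs3)" "finite (components dirs5)" "finite (components dirs7)"
      by (simp_all add: finite_components dirs3_def dirs5_def dirs7_def)
    ultimately show ?thesis unfolding union using cards by (simp add: card_Un_disjoint)
  qed
  ultimately show ?thesis unfolding irr using union by (intro conjI ballI) blast+
qed

end
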